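(* The following holds in $\mathsf{ZF}$ (Zermelo--Fraenkel set theory, without the axiom of choice). Let $\Sigma$ be a first-order signature. A class $\mathcal{K}$ of $\Sigma$-structures is a quasivariety if and only if $\mathcal{K}$ contains a unit and is closed under isomorphisms, substructures, and reduced products.
   Context: The background theory is $\mathsf{ZF}$; the axiom of choice may not be used. A first-order signature $\Sigma$ is a set of relation and function symbols, each having a fixed finite arity (constants are $0$-ary function symbols). Formulas are those of first-order logic with equality; atomic formulas are equations between terms and formulas $r(t_1,\dots,t_n)$ with $r$ a relation symbol of $\Sigma$. Structures have nonempty domain, as is customary in first-order logic. For a $\Sigma$-structure $A$ and a formula $\phi$, $A\models\phi$ means that $\phi$ is satisfied in $A$ under every assignment of elements of $A$ to its free variables. A basic Horn formula is a formula $\phi_0\vee\cdots\vee\phi_n$ ($n\geqslant 0$) where at most one of the $\phi_i$ is an atomic formula, the rest being negations of atomic formulas. It is strict if at least one (hence exactly one) of the $\phi_i$ is an atomic formula. Strict basic Horn formulas are also called quasi-identities. A class $\mathcal{K}$ of $\Sigma$-structures is a quasivariety if there is a set $\Gamma$ of quasi-identities (over $\Sigma$) such that $\mathcal{K}$ is the class of all $\Sigma$-structures satisfying every formula in $\Gamma$. A unit is a $\Sigma$-structure $A$ consisting of a single element $a$ such that $r^A(a,\dots,a)$ holds for all relation symbols $r$ in $\Sigma$. Given a family $\langle A_i\rangle_{i\in I}$ of $\Sigma$-structures (with $I$ a set) and a (proper) filter $\mathcal{F}$ over $I$, the reduced product $\prod_{\mathcal{F}}A_i$ is the structure whose domain is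 the set of classes $\bar a/\mathcal{F}$ of elements $\bar a\in\prod_{i\in I}A_i$ under the equivalence $\bar a\sim\bar b\iff\{i\in I\mid\bar a(i)=\bar b(i)\}\in\mathcal{F}$, with function symbols interpreted coordinatewise on representatives, and $r(\bar a_1/\mathcal{F},\dots,\bar a_n/\mathcal{F})$ holding iff $\{i\in I\mid r^{A_i}(\bar a_1(i),\dots,\bar a_n(i))\}\in\mathcal{F}$. (Since choice is not assumed, $\prod_{i\in I}A_i$ might be empty; reduced products are considered only when it is nonempty.) $\mathcal{K}$ is closed under isomorphisms (substructures, reduced products) if every structure isomorphic to a member of $\mathcal{K}$ (every substructure of a member of $\mathcal{K}$, every reduced product of a family of members of $\mathcal{K}$) belongs to $\mathcal{K}$. *)

theory Defs
  imports Main
begin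

text \<open>
  HOL has a choice operator, so a statement about HOL sets cannot express that a fact holds in ZF
  without choice. We therefore speak about an arbitrary model \<open>('v, mem)\<close> of first-order ZF: by
  soundness and completeness, a statement of the language of set theory is a theorem of ZF iff it
  is true in all such models. The sets of ZF are the elements of \<open>'v\<close>, the classes are the
  subsets of \<open>'v\<close> that are first-order definable with parameters, and every notion of the theorem
  (natural number, function, term, formula, structure, filter, ...) is interpreted inside the
  model, by definitions whose quantifiers range over elements of \<open>'v\<close> only.
\<close>

section \<open>Models of ZF\<close>

datatype fm = Mem nat nat | Equ nat nat | Neg fm | Conj fm fm | All nat fm

primrec sat :: "('v \<Rightarrow> 'v \<Rightarrow> bool) \<Rightarrow> (nat \<Rightarrow> 'v) \<Rightarrow> fm \<Rightarrow> bool" where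
  "sat mem e (Mem i j) \<longleftrightarrow> mem (e i) (e j)"
| "sat mem e (Equ i j) \<longleftrightarrow> e i = e j"
| "sat mem e (Neg p) \<longleftrightarrow> \<not> sat mem e p"
| "sat mem e (Conj p q) \<longleftrightarrow> sat mem e p \<and> sat mem e q"
| "sat mem e (All i p) \<longleftrightarrow> (\<forall>x. sat mem (e(i := x)) p)"

locale membership =
  fixes mem :: "'v \<Rightarrow> 'v \<Rightarrow> bool"
begin

definition elts :: "'v \<Rightarrow> 'v set" where
  "elts x = {y. mem y x}"

text \<open>The element of the model with extension \<open>X\<close>; meaningful only if there is one.\<close>

definition mk :: "'v set \<Rightarrow> 'v" where
  "mk X = (THE x. elts x = X)"

text \<open>The values of the environment \<open>e\<close> at the variables other than 0 act as parameters.\<close>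

definition definable_class :: "'v set \<Rightarrow> bool" where
  "definable_class K \<longleftrightarrow> (\<exists>p e. K = {x. sat mem (e(0 := x)) p})"

end

text \<open>
  Separation and Replacement are the first-order schemes: they are required only for formulas
  \<open>p\<close> of the language of set theory, with parameters given by \<open>e\<close>. Since \<open>a\<close> and \<open>b\<close> are not
  object-language variables, the usual restriction on the free variables of \<open>p\<close> is automatic.
  There is no axiom of choice.
\<close>

locale ZF = membership mem for mem :: "'v \<Rightarrow> 'v \<Rightarrow> bool" +
  assumes extensionality: "\<And>x y. (\<forall>z. mem z x \<longleftrightarrow> mem z y) \<Longrightarrow> x = y"
    and foundation: "\<And>x. \<exists>y. mem y x \<Longrightarrow> \<exists>y. mem y x \<and> \<not> (\<exists>z. mem z x \<and> mem z y)"
    and pairing: "\<And>x y. \<exists>z. \<forall>w. mem w z \<longleftrightarrow> w = x \<or> w = y"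
    and union: "\<And>x. \<exists>z. \<forall>w. mem w z \<longleftrightarrow> (\<exists>y. mem y x \<and> mem w y)"
    and power_set: "\<And>x. \<exists>z. \<forall>y. mem y z \<longleftrightarrow> (\<forall>w. mem w y \<longrightarrow> mem w x)"
    and infinity: "\<exists>x. (\<exists>y. mem y x \<and> (\<forall>w. \<not> mem w y)) \<and>
        (\<forall>y. mem y x \<longrightarrow> (\<exists>z. mem z x \<and> (\<forall>w. mem w z \<longleftrightarrow> mem w y \<or> w = y)))"
    and separation: "\<And>p e a. \<exists>b. \<forall>x. mem x b \<longleftrightarrow> mem x a \<and> sat mem (e(0 := x)) p"
    and replacement: "\<And>p e a.
        (\<forall>x y z. mem x a \<and> sat mem (e(0 := x, 1 := y)) p \<and> sat mem (e(0 := x, 1 := z)) p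
          \<longrightarrow> y = z)
        \<Longrightarrow> \<exists>b. \<forall>y. mem y b \<longleftrightarrow> (\<exists>x. mem x a \<and> sat mem (e(0 := x, 1 := y)) p)"

context membership
begin

section \<open>Basic set theory inside the model\<close>

definition pair :: "'v \<Rightarrow> 'v \<Rightarrow> 'v" where
  "pair x y = mk {mk {x}, mk {x, y}}"

definition fst_of :: "'v \<Rightarrow> 'v" where
  "fst_of p = (THE x. \<exists>y. p = pair x y)"

definition snd_of :: "'v \<Rightarrow> 'v" where
  "snd_of p = (THE y. \<exists>x. p = pair x y)"

definition triple :: "'v \<Rightarrow> 'v \<Rightarrow> 'v \<Rightarrow> 'v" where
  "triple x y z = pair x (pair y z)"

definition zero :: 'v where
  "zero = mk {}"

definition succ :: "'v \<Rightarrow> 'v" where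
  "succ n = mk (insert n (elts n))"

definition one :: 'v where
  "one = succ zero"

text \<open>The von Neumann natural numbers of the model; so \<open>elts n = {0, ..., n-1}\<close>.\<close>

definition omega :: 'v where
  "omega = mk {n. \<forall>X. zero \<in> elts X \<and> (\<forall>m \<in> elts X. succ m \<in> elts X) \<longrightarrow> n \<in> elts X}"

definition fun_on :: "'v \<Rightarrow> 'v \<Rightarrow> bool" where
  "fun_on f a \<longleftrightarrow> (\<forall>p \<in> elts f. \<exists>x \<in> elts a. \<exists>y. p = pair x y) \<and>
                  (\<forall>x \<in> elts a. \<exists>!y. pair x y \<in> elts f)"

definition app :: "'v \<Rightarrow> 'v \<Rightarrow> 'v" where
  "app f x = (THE y. pair x y \<in> elts f)"

definition maps :: "'v \<Rightarrow> 'v \<Rightarrow> 'v \<Rightarrow> bool" where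
  "maps f a b \<longleftrightarrow> fun_on f a \<and> (\<forall>x \<in> elts a. app f x \<in> elts b)"

definition lam :: "'v \<Rightarrow> ('v \<Rightarrow> 'v) \<Rightarrow> 'v" where
  "lam a G = mk {pair x (G x) | x. x \<in> elts a}"

text \<open>The \<open>n\<close>-tuples over \<open>d\<close> are the functions from the natural number \<open>n\<close> to \<open>d\<close>.\<close>

definition tuples :: "'v \<Rightarrow> 'v \<Rightarrow> 'v" where
  "tuples d n = mk {t. maps t n d}"

section \<open>Signatures and structures\<close>

definition is_signature :: "'v \<Rightarrow> bool" where
  "is_signature Sg \<longleftrightarrow> (\<exists>R F ar. Sg = triple R F ar \<and> elts R \<inter> elts F = {} \<and>
                                  maps ar (mk (elts R \<union> elts F)) omega)"

definition rel_syms :: "'v \<Rightarrow> 'v" where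
  "rel_syms Sg = fst_of Sg"

definition fun_syms :: "'v \<Rightarrow> 'v" where
  "fun_syms Sg = fst_of (snd_of Sg)"

definition arity :: "'v \<Rightarrow> 'v \<Rightarrow> 'v" where
  "arity Sg s = app (snd_of (snd_of Sg)) s"

definition carrier :: "'v \<Rightarrow> 'v" where
  "carrier A = fst_of A"

definition rel_int :: "'v \<Rightarrow> 'v \<Rightarrow> 'v" where
  "rel_int A r = app (fst_of (snd_of A)) r"

definition fun_int :: "'v \<Rightarrow> 'v \<Rightarrow> 'v" where
  "fun_int A f = app (snd_of (snd_of A)) f"

definition is_structure :: "'v \<Rightarrow> 'v \<Rightarrow> bool" where
  "is_structure Sg A \<longleftrightarrow>
     (\<exists>D RI FI. A = triple D RI FI \<and> elts D \<noteq> {} \<and>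
        fun_on RI (rel_syms Sg) \<and>
        (\<forall>r \<in> elts (rel_syms Sg). elts (app RI r) \<subseteq> elts (tuples D (arity Sg r))) \<and>
        fun_on FI (fun_syms Sg) \<and>
        (\<forall>f \<in> elts (fun_syms Sg). maps (app FI f) (tuples D (arity Sg f)) D))"

section \<open>Terms and quasi-identities\<close>

text \<open>
  The variables are indexed by \<open>omega\<close>. The tags \<open>zero\<close> and \<open>one\<close> separate variables from
  compound terms, equations from relational formulas, and atomic formulas from their negations.
\<close>

definition var :: "'v \<Rightarrow> 'v" where
  "var n = pair zero n"

definition fapp :: "'v \<Rightarrow> 'v \<Rightarrow> 'v" where
  "fapp f ts = pair one (pair f ts)"

definition term_closed :: "'v \<Rightarrow> 'v \<Rightarrow> bool" where
  "term_closed Sg X \<longleftrightarrow> (\<forall>n \<in> elts omega. var n \<in> elts X) \<and>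
     (\<forall>f \<in> elts (fun_syms Sg). \<forall>ts. maps ts (arity Sg f) X \<longrightarrow> fapp f ts \<in> elts X)"

definition terms :: "'v \<Rightarrow> 'v" where
  "terms Sg = mk {t. \<forall>X. term_closed Sg X \<longrightarrow> t \<in> elts X}"

text \<open>The recursive evaluation of terms in \<open>A\<close> under the assignment \<open>h\<close>, as a set function.\<close>

definition is_evaluation :: "'v \<Rightarrow> 'v \<Rightarrow> 'v \<Rightarrow> 'v \<Rightarrow> bool" where
  "is_evaluation Sg A h ev \<longleftrightarrow> maps ev (terms Sg) (carrier A) \<and>
     (\<forall>n \<in> elts omega. app ev (var n) = app h n) \<and>
     (\<forall>f \<in> elts (fun_syms Sg). \<forall>ts. maps ts (arity Sg f) (terms Sg) \<longrightarrow>
        app ev (fapp f ts) = app (fun_int A f) (lam (arity Sg f) (\<lambda>k. app ev (app ts k))))"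

definition term_val :: "'v \<Rightarrow> 'v \<Rightarrow> 'v \<Rightarrow> 'v \<Rightarrow> 'v" where
  "term_val Sg A h t = app (THE ev. is_evaluation Sg A h ev) t"

definition eq_fm :: "'v \<Rightarrow> 'v \<Rightarrow> 'v" where
  "eq_fm s t = pair zero (pair s t)"

definition rel_fm :: "'v \<Rightarrow> 'v \<Rightarrow> 'v" where
  "rel_fm r ts = pair one (pair r ts)"

definition is_atomic :: "'v \<Rightarrow> 'v \<Rightarrow> bool" where
  "is_atomic Sg \<alpha> \<longleftrightarrow>
     (\<exists>s \<in> elts (terms Sg). \<exists>t \<in> elts (terms Sg). \<alpha> = eq_fm s t) \<or>
     (\<exists>r \<in> elts (rel_syms Sg). \<exists>ts. maps ts (arity Sg r) (terms Sg) \<and> \<alpha> = rel_fm r ts)"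

definition sat_atomic :: "'v \<Rightarrow> 'v \<Rightarrow> 'v \<Rightarrow> 'v \<Rightarrow> bool" where
  "sat_atomic Sg A h \<alpha> \<longleftrightarrow>
     (\<exists>s t. \<alpha> = eq_fm s t \<and> term_val Sg A h s = term_val Sg A h t) \<or>
     (\<exists>r ts. \<alpha> = rel_fm r ts \<and>
        lam (arity Sg r) (\<lambda>k. term_val Sg A h (app ts k)) \<in> elts (rel_int A r))"

definition pos_lit :: "'v \<Rightarrow> 'v" where
  "pos_lit \<alpha> = pair zero \<alpha>"

definition neg_lit :: "'v \<Rightarrow> 'v" where
  "neg_lit \<alpha> = pair one \<alpha>"

definition is_pos_lit :: "'v \<Rightarrow> 'v \<Rightarrow> bool" where
  "is_pos_lit Sg l \<longleftrightarrow> (\<exists>\<alpha>. is_atomic Sg \<alpha> \<and> l = pos_lit \<alpha>)"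

definition is_neg_lit :: "'v \<Rightarrow> 'v \<Rightarrow> bool" where
  "is_neg_lit Sg l \<longleftrightarrow> (\<exists>\<alpha>. is_atomic Sg \<alpha> \<and> l = neg_lit \<alpha>)"

definition sat_lit :: "'v \<Rightarrow> 'v \<Rightarrow> 'v \<Rightarrow> 'v \<Rightarrow> bool" where
  "sat_lit Sg A h l \<longleftrightarrow> (\<exists>\<alpha>. l = pos_lit \<alpha> \<and> sat_atomic Sg A h \<alpha>) \<or>
                        (\<exists>\<alpha>. l = neg_lit \<alpha> \<and> \<not> sat_atomic Sg A h \<alpha>)"

text \<open>
  A basic Horn formula, i.e. a disjunction of \<open>n + 1\<close> literals with at most one of them positive,
  is the \<open>(n + 1)\<close>-tuple of its disjuncts.
\<close>

definition basic_horn :: "'v \<Rightarrow> 'v \<Rightarrow> bool" where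
  "basic_horn Sg \<phi> \<longleftrightarrow> (\<exists>n \<in> elts omega. fun_on \<phi> (succ n) \<and>
     (\<forall>k \<in> elts (succ n). is_pos_lit Sg (app \<phi> k) \<or> is_neg_lit Sg (app \<phi> k)) \<and>
     (\<forall>j \<in> elts (succ n). \<forall>k \<in> elts (succ n).
        is_pos_lit Sg (app \<phi> j) \<and> is_pos_lit Sg (app \<phi> k) \<longrightarrow> j = k))"

definition quasi_identity :: "'v \<Rightarrow> 'v \<Rightarrow> bool" where
  "quasi_identity Sg \<phi> \<longleftrightarrow>
     basic_horn Sg \<phi> \<and> (\<exists>k l. pair k l \<in> elts \<phi> \<and> is_pos_lit Sg l)"

text \<open>
  Assignments are total on the variables. As carriers are nonempty, this amounts to considering
  all assignments to the finitely many variables that occur in \<open>\<phi>\<close>.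
\<close>

definition models :: "'v \<Rightarrow> 'v \<Rightarrow> 'v \<Rightarrow> bool" where
  "models Sg A \<phi> \<longleftrightarrow>
     (\<forall>h. maps h omega (carrier A) \<longrightarrow> (\<exists>k l. pair k l \<in> elts \<phi> \<and> sat_lit Sg A h l))"

definition is_quasivariety :: "'v \<Rightarrow> 'v set \<Rightarrow> bool" where
  "is_quasivariety Sg K \<longleftrightarrow>
     (\<exists>\<Gamma>. (\<forall>\<phi> \<in> elts \<Gamma>. quasi_identity Sg \<phi>) \<and>
          K = {A. is_structure Sg A \<and> (\<forall>\<phi> \<in> elts \<Gamma>. models Sg A \<phi>)})"

section \<open>Units and closure conditions\<close>

definition is_unit :: "'v \<Rightarrow> 'v \<Rightarrow> bool" where
  "is_unit Sg A \<longleftrightarrow> is_structure Sg A \<and>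
     (\<exists>a. elts (carrier A) = {a} \<and>
          (\<forall>r \<in> elts (rel_syms Sg). lam (arity Sg r) (\<lambda>_. a) \<in> elts (rel_int A r)))"

definition is_isomorphism :: "'v \<Rightarrow> 'v \<Rightarrow> 'v \<Rightarrow> 'v \<Rightarrow> bool" where
  "is_isomorphism Sg g A B \<longleftrightarrow>
     maps g (carrier A) (carrier B) \<and> bij_betw (app g) (elts (carrier A)) (elts (carrier B)) \<and>
     (\<forall>r \<in> elts (rel_syms Sg). \<forall>t. maps t (arity Sg r) (carrier A) \<longrightarrow>
        (t \<in> elts (rel_int A r) \<longleftrightarrow>
         lam (arity Sg r) (\<lambda>k. app g (app t k)) \<in> elts (rel_int B r))) \<and>
     (\<forall>f \<in> elts (fun_syms Sg). \<forall>t. maps t (arity Sg f) (carrier A) \<longrightarrow>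
        app g (app (fun_int A f) t) =
        app (fun_int B f) (lam (arity Sg f) (\<lambda>k. app g (app t k))))"

definition closed_under_isomorphisms :: "'v \<Rightarrow> 'v set \<Rightarrow> bool" where
  "closed_under_isomorphisms Sg K \<longleftrightarrow>
     (\<forall>A \<in> K. \<forall>B. is_structure Sg B \<and> (\<exists>g. is_isomorphism Sg g A B) \<longrightarrow> B \<in> K)"

definition is_substructure :: "'v \<Rightarrow> 'v \<Rightarrow> 'v \<Rightarrow> bool" where
  "is_substructure Sg B A \<longleftrightarrow>
     is_structure Sg B \<and> is_structure Sg A \<and> elts (carrier B) \<subseteq> elts (carrier A) \<and>
     (\<forall>r \<in> elts (rel_syms Sg). \<forall>t. maps t (arity Sg r) (carrier B) \<longrightarrow>
        (t \<in> elts (rel_int B r) \<longleftrightarrow> t \<in> elts (rel_int A r))) \<and>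
     (\<forall>f \<in> elts (fun_syms Sg). \<forall>t. maps t (arity Sg f) (carrier B) \<longrightarrow>
        app (fun_int B f) t = app (fun_int A f) t)"

definition closed_under_substructures :: "'v \<Rightarrow> 'v set \<Rightarrow> bool" where
  "closed_under_substructures Sg K \<longleftrightarrow>
     (\<forall>A \<in> K. \<forall>B. is_substructure Sg B A \<longrightarrow> B \<in> K)"

definition proper_filter :: "'v \<Rightarrow> 'v \<Rightarrow> bool" where
  "proper_filter I F \<longleftrightarrow>
     (\<forall>X \<in> elts F. elts X \<subseteq> elts I) \<and> I \<in> elts F \<and> zero \<notin> elts F \<and>
     (\<forall>X \<in> elts F. \<forall>Y \<in> elts F. mk (elts X \<inter> elts Y) \<in> elts F) \<and>
     (\<forall>X \<in> elts F. \<forall>Y. elts X \<subseteq> elts Y \<and> elts Y \<subseteq> elts I \<longrightarrow> Y \<in> elts F)"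

text \<open>Below, \<open>A\<close> is a family of structures, i.e. a set function on the index set \<open>I\<close>.\<close>

definition product :: "'v \<Rightarrow> 'v \<Rightarrow> 'v" where
  "product I A = mk {a. fun_on a I \<and> (\<forall>i \<in> elts I. app a i \<in> elts (carrier (app A i)))}"

definition eq_mod :: "'v \<Rightarrow> 'v \<Rightarrow> 'v \<Rightarrow> 'v \<Rightarrow> bool" where
  "eq_mod I F a b \<longleftrightarrow> mk {i \<in> elts I. app a i = app b i} \<in> elts F"

definition mod_class :: "'v \<Rightarrow> 'v \<Rightarrow> 'v \<Rightarrow> 'v \<Rightarrow> 'v" where
  "mod_class I A F a = mk {b \<in> elts (product I A). eq_mod I F a b}"

text \<open>
  An \<open>n\<close>-tuple of classes is given by an \<open>n\<close>-tuple \<open>s\<close> of representatives; the components at \<open>i\<close>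
  form the tuple \<open>coords n s i\<close>. The interpretations in the reduced product are written as the
  images of all tuples of representatives, which is the usual definition because membership in
  \<open>F\<close> and the resulting class do not depend on the representatives.
\<close>

definition coords :: "'v \<Rightarrow> 'v \<Rightarrow> 'v \<Rightarrow> 'v" where
  "coords n s i = lam n (\<lambda>k. app (app s k) i)"

definition mod_classes :: "'v \<Rightarrow> 'v \<Rightarrow> 'v \<Rightarrow> 'v \<Rightarrow> 'v \<Rightarrow> 'v" where
  "mod_classes I A F n s = lam n (\<lambda>k. mod_class I A F (app s k))"

definition red_carrier :: "'v \<Rightarrow> 'v \<Rightarrow> 'v \<Rightarrow> 'v" where
  "red_carrier I A F = mk {mod_class I A F a | a. a \<in> elts (product I A)}"

definition red_rel :: "'v \<Rightarrow> 'v \<Rightarrow> 'v \<Rightarrow> 'v \<Rightarrow> 'v \<Rightarrow> 'v" where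
  "red_rel Sg I A F r =
     mk {mod_classes I A F (arity Sg r) s | s. maps s (arity Sg r) (product I A) \<and>
           mk {i \<in> elts I. coords (arity Sg r) s i \<in> elts (rel_int (app A i) r)} \<in> elts F}"

definition red_fun :: "'v \<Rightarrow> 'v \<Rightarrow> 'v \<Rightarrow> 'v \<Rightarrow> 'v \<Rightarrow> 'v" where
  "red_fun Sg I A F f =
     mk {pair (mod_classes I A F (arity Sg f) s)
              (mod_class I A F (lam I (\<lambda>i. app (fun_int (app A i) f) (coords (arity Sg f) s i))))
         | s. maps s (arity Sg f) (product I A)}"

definition reduced_product :: "'v \<Rightarrow> 'v \<Rightarrow> 'v \<Rightarrow> 'v \<Rightarrow> 'v" where
  "reduced_product Sg I A F =
     triple (red_carrier I A F) (lam (rel_syms Sg) (red_rel Sg I A F))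
            (lam (fun_syms Sg) (red_fun Sg I A F))"

definition closed_under_reduced_products :: "'v \<Rightarrow> 'v set \<Rightarrow> bool" where
  "closed_under_reduced_products Sg K \<longleftrightarrow>
     (\<forall>I A F. proper_filter I F \<and> fun_on A I \<and> (\<forall>i \<in> elts I. app A i \<in> K) \<and>
        elts (product I A) \<noteq> {} \<longrightarrow> reduced_product Sg I A F \<in> K)"

end

end

theory Submission
  imports Defs
begin

text \<open>
  For the nontrivial direction, let \<open>A\<close> satisfy all quasi-identities that are true in \<open>K\<close>. Take as
  index set the pairs \<open>(B, h)\<close> where \<open>B\<close> is a member of \<open>K\<close> and \<open>h\<close> is any map from \<open>A\<close> to \<open>B\<close>, and the
  filter generated by the sets of indices at which \<open>h\<close> preserves a given true fact \<open>f(t) = b\<close> or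
  \<open>r(t)\<close> of \<open>A\<close>. The unit of \<open>K\<close> makes it proper, and \<open>a \<mapsto> [h(a)]\<close> embeds \<open>A\<close> into the reduced
  product: finitely many true facts cannot force a false equation or relation, since the
  corresponding quasi-identity would hold in \<open>K\<close> and fail in \<open>A\<close>. No structure has to be chosen, as all
  of them are used. They form a set once their elements are required to be sets of terms, which is
  no restriction because only the substructure generated by countably many elements matters.

  Conversely, the truth of a quasi-identity in a reduced product involves only finitely many
  variables, so finitely many classes have to be represented by elements of the product. Its terms
  are evaluated in the direct product, which maps homomorphically to the factors and to the
  reduced product.

  Separation, replacement and induction are available only for definable predicates, and the
  natural numbers of the model need not be standard. This is why definability has to be checked
  throughout.
\<close>

section \<open>Definability\<close>

text \<open>The diagram of \<open>A\<close> cannot be written out in formulas: the variables are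
  indexed by \<open>omega\<close>, and \<open>A\<close> may be too large to be named by them. Facts
  are therefore coded with the elements of \<open>A\<close> themselves and become formulas only
  finitely many at a time, through a numbering \<open>v\<close> of \<open>A\<close> by variables
  that is faithful on a finite set and arbitrary elsewhere. An assignment \<open>k\<close> in a
  structure then yields the index whose map is \<open>k\<close> after \<open>v\<close>. Such a map
  respects just the facts at hand, which is why indices carry maps and not homomorphisms: no supply
  of separating homomorphisms is known before \<open>A\<close> is shown to lie in \<open>K\<close>.
  Facts of depth one suffice, because they are all that a homomorphism has to preserve.

  Finite means finite in the sense of the model. The length of a tuple or of a formula is an element
  of \<open>omega\<close>, not a HOL number, so Kuratowski finite sets and induction along
  \<open>omega\<close> replace the HOL notions. The other recurring obstacle is \<open>THE\<close>:
  a description can be shown definable only if it is never ambiguous, and this dictates many of the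
  unusual forms below.\<close>

primrec rename :: "(nat \<Rightarrow> nat) \<Rightarrow> fm \<Rightarrow> fm" where
  "rename f (Mem i j) = Mem (f i) (f j)"
| "rename f (Equ i j) = Equ (f i) (f j)"
| "rename f (Neg p) = Neg (rename f p)"
| "rename f (Conj p q) = Conj (rename f p) (rename f q)"
| "rename f (All i p) = All (f i) (rename f p)"

text \<open>Injectivity prevents capture: updating the renamed bound variable leaves the renamed
  free ones alone.\<close>

lemma sat_rename:
  assumes "inj f"
  shows "sat mem e (rename f p) \<longleftrightarrow> sat mem (\<lambda>i. e (f i)) p"
proof (induction p arbitrary: e)
  case (All i p)
  have "(\<lambda>j. (e(f i := x)) (f j)) = (\<lambda>j. e (f j))(i := x)" for x
    using assms by (auto simp: fun_eq_iff inj_eq)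
  then show ?case using All by simp
qed auto

lemma inj_by_parity:
  fixes f :: "nat \<Rightarrow> nat"
  assumes "\<And>a b. f (2 * a) = f (2 * b) \<Longrightarrow> a = b"
    and "\<And>a b. f (2 * a + 1) = f (2 * b + 1) \<Longrightarrow> a = b"
    and "\<And>a b. f (2 * a) \<noteq> f (2 * b + 1)"
  shows "inj f"
proof (rule injI)
  fix i j assume "f i = f j"
  then show "i = j"
    using assms by (cases "even i"; cases "even j") (metis evenE oddE)+
qed

definition mix :: "(nat \<Rightarrow> 'v) \<Rightarrow> (nat \<Rightarrow> 'v) \<Rightarrow> nat \<Rightarrow> 'v" where
  "mix e r i = (if even i then e (i div 2) else r (i div 2))"

lemma mix_simps [simp]: "mix e r (2 * a) = e a" "mix e r (Suc (2 * a)) = r a"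
  by (simp_all add: mix_def)

lemma ext_by_parity:
  fixes f g :: "nat \<Rightarrow> 'a"
  assumes "\<And>a. f (2 * a) = g (2 * a)" "\<And>a. f (Suc (2 * a)) = g (Suc (2 * a))"
  shows "f = g"
proof
  fix i show "f i = g i"
    using assms by (cases "even i") (metis evenE oddE Suc_eq_plus1)+
qed

context membership
begin

text \<open>
  Definability with parameters of predicates and functions of an environment. The even variables of
  the formula refer to the environment, the odd ones to a fixed sequence of parameters, so the
  parameters never run out. Bound variables are treated in the style of de Bruijn: under a
  quantifier, the bound variable is \<open>e 0\<close> and all others move up by one. Hence the closure rules
  below can be applied by unification.
\<close>

definition dfp :: "((nat \<Rightarrow> 'v) \<Rightarrow> bool) \<Rightarrow> bool" where
  "dfp P \<longleftrightarrow> (\<exists>p r. \<forall>e. P e \<longleftrightarrow> sat mem (mix e r) p)"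

definition dft :: "((nat \<Rightarrow> 'v) \<Rightarrow> 'v) \<Rightarrow> bool" where
  "dft T \<longleftrightarrow> dfp (\<lambda>e. e 0 = T (\<lambda>n. e (Suc n)))"

lemma dfp_rename:
  assumes "dfp P" "inj f"
  shows "dfp (\<lambda>e. P (\<lambda>n. e (f n)))"
proof -
  obtain p r where p: "\<And>e. P e \<longleftrightarrow> sat mem (mix e r) p"
    using assms(1) by (auto simp: dfp_def)
  \<comment> \<open>Only the even variables, which refer to the environment, are renamed; the
    parameters stay where they are.\<close>
  define g where "g i = (if even i then 2 * f (i div 2) else i)" for i
  have "inj g"
  proof (rule injI)
    fix i j assume eq: "g i = g j"
    then have "even i \<longleftrightarrow> even j" by (metis dvd_triv_left g_def)
    then show "i = j"
      using eq injD[OF assms(2)] unfolding g_def by (auto elim!: evenE)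
  qed
  moreover have "(\<lambda>i. mix e r (g i)) = mix (\<lambda>n. e (f n)) r" for e
    by (auto simp: mix_def g_def fun_eq_iff)
  ultimately show ?thesis
    unfolding dfp_def p by (intro exI[of _ "rename g p"] exI[of _ r]) (simp add: sat_rename)
qed

lemma dfp_not: "dfp P \<Longrightarrow> dfp (\<lambda>e. \<not> P e)"
  unfolding dfp_def by (metis sat.simps(3))

lemma dfp_conj:
  assumes "dfp P" "dfp Q"
  shows "dfp (\<lambda>e. P e \<and> Q e)"
proof -
  obtain p r where p: "\<And>e. P e \<longleftrightarrow> sat mem (mix e r) p"
    using assms(1) by (auto simp: dfp_def)
  obtain q s where q: "\<And>e. Q e \<longleftrightarrow> sat mem (mix e s) q"
    using assms(2) by (auto simp: dfp_def)
  \<comment> \<open>The two parameter sequences are interleaved into \<open>mix r s\<close>: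
    parameter number k of the first formula moves to position 2k of the new sequence, that of the
    second to position 2k + 1.\<close>
  define f where "f i = (if even i then i else 2 * (2 * (i div 2)) + 1)" for i :: nat
  define g where "g i = (if even i then i else 2 * (2 * (i div 2) + 1) + 1)" for i :: nat
  have inj: "inj f" "inj g"
    by (rule inj_by_parity; simp add: f_def g_def; presburger)+
  have div4: "Suc (4 * a) div 2 = 2 * a" "Suc (4 * a + 2) div 2 = 2 * a + 1"
    "Suc (Suc (Suc (4 * a))) div 2 = Suc (2 * a)" for a :: nat
    by presburger+
  have "(\<lambda>i. mix e (mix r s) (f i)) = mix e r" "(\<lambda>i. mix e (mix r s) (g i)) = mix e s" for e
    by (rule ext_by_parity; simp add: f_def g_def mix_def div4)+
  then show ?thesis
    unfolding dfp_def p q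
    by (intro exI[of _ "Conj (rename f p) (rename g q)"] exI[of _ "mix r s"])
      (simp add: sat_rename inj)
qed

lemma dfp_all:
  assumes "dfp (\<lambda>e. Q (\<lambda>n. e (Suc n)) (e 0))"
  shows "dfp (\<lambda>e. \<forall>x. Q e x)"
proof -
  obtain p r where p: "\<And>e. Q (\<lambda>n. e (Suc n)) (e 0) \<longleftrightarrow> sat mem (mix e r) p"
    using assms by (auto simp: dfp_def)
  \<comment> \<open>The quantified variable becomes formula variable 1, the first parameter slot,
    which is freed by moving every parameter one slot up. The other environment variables move down
    by one, undoing the shift under the quantifier.\<close>
  define f where "f i = (if i = 0 then 1 else if even i then i - 2 else i + 2)" for i :: nat
  have inj: "inj f"
    by (rule inj_by_parity; simp add: f_def; presburger)
  define s where "s i = r (i - 1)" for i :: nat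
  have env: "(\<lambda>i. ((mix e s)(1 := x)) (f i)) = mix (case_nat x e) r" for e x
    by (rule ext_by_parity) (simp_all add: f_def, auto simp: mix_def s_def split: nat.split)
  have "(\<forall>x. Q e x) \<longleftrightarrow> sat mem (mix e s) (All 1 (rename f p))" for e
    using p[of "case_nat x e" for x] by (simp add: sat_rename inj env[unfolded One_nat_def] del: fun_upd_apply)
  then show ?thesis
    unfolding dfp_def by blast
qed

lemma dfp_const: "dfp (\<lambda>e. c)"
proof (cases c)
  case True
  then show ?thesis unfolding dfp_def by (intro exI[of _ "Equ 0 0"]) simp
next
  case False
  then show ?thesis unfolding dfp_def by (intro exI[of _ "Neg (Equ 0 0)"]) simp
qed

lemma dfp_mem_var: "dfp (\<lambda>e. e i \<in> elts (e j))"
  unfolding dfp_def elts_def by (intro exI[of _ "Mem (2 * i) (2 * j)"]) (simp add: mix_def)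

lemma dft_var: "dft (\<lambda>e. e i)"
  unfolding dft_def dfp_def by (intro exI[of _ "Equ 0 (2 * Suc i)"]) (simp add: mix_def)

lemma dft_const: "dft (\<lambda>e. c)"
  unfolding dft_def dfp_def
  by (intro exI[of _ "Equ 0 1"] exI[of _ "\<lambda>_. c"]) (simp add: mix_def)

lemma dfp_disj: "dfp P \<Longrightarrow> dfp Q \<Longrightarrow> dfp (\<lambda>e. P e \<or> Q e)"
  using dfp_not[OF dfp_conj[OF dfp_not dfp_not], of P Q] by simp

lemma dfp_imp: "dfp P \<Longrightarrow> dfp Q \<Longrightarrow> dfp (\<lambda>e. P e \<longrightarrow> Q e)"
  unfolding imp_conv_disj by (intro dfp_disj dfp_not)

lemma dfp_iff: "dfp P \<Longrightarrow> dfp Q \<Longrightarrow> dfp (\<lambda>e. P e \<longleftrightarrow> Q e)"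
  unfolding iff_conv_conj_imp by (intro dfp_conj dfp_imp)

lemma dfp_ex: "dfp (\<lambda>e. Q (\<lambda>n. e (Suc n)) (e 0)) \<Longrightarrow> dfp (\<lambda>e. \<exists>x. Q e x)"
  using dfp_not[OF dfp_all[OF dfp_not], of Q] by simp

lemma dfp_subst:
  assumes "dfp (\<lambda>e. Q (\<lambda>n. e (Suc n)) (e 0))" "dft T"
  shows "dfp (\<lambda>e. Q e (T e))"
proof -
  \<comment> \<open>Substituting a definable function amounts to quantifying over the unique value
    in its graph.\<close>
  have "dfp (\<lambda>e. \<exists>x. x = T e \<and> Q e x)"
    using assms by (intro dfp_ex dfp_conj) (simp_all add: dft_def)
  then show ?thesis by simp
qed

lemma dft_lift:
  assumes "dft T"
  shows "dft (\<lambda>e. T (\<lambda>n. e (Suc n)))"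
proof -
  have "inj (\<lambda>n. case n of 0 \<Rightarrow> 0 | Suc n \<Rightarrow> Suc (Suc n))"
    by (auto simp: inj_def split: nat.splits)
  from dfp_rename[OF assms[unfolded dft_def] this] show ?thesis
    by (simp add: dft_def)
qed

lemma dfp_substs:
  assumes "dfp P" "\<And>i. i < n \<Longrightarrow> dft (S i)"
  shows "dfp (\<lambda>e. P (\<lambda>i. if i < n then S i e else e (i - n)))"
  using assms
proof (induction n arbitrary: S P)
  case 0
  then show ?case by simp
next
  case (Suc n)
  \<comment> \<open>The functions for the first n variables are substituted first, while variable n
    stays open as \<open>x\<close>. They have to be lifted, since \<open>x\<close> then occupies
    variable 0; filling in \<open>x\<close> is a single use of \<open>dfp_subst\<close>.\<close>
  define R where "R e x = P (\<lambda>i. if i < n then S i e else if i = n then x else e (i - Suc n))" for e x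
  define T where "T i = (\<lambda>e. S i (\<lambda>n. e (Suc n)))" for i
  have 1: "dfp (\<lambda>e. P (\<lambda>i. if i < n then T i e else e (i - n)))"
    unfolding T_def by (rule Suc.IH[OF Suc.prems(1)]) (rule dft_lift, rule Suc.prems(2), simp)
  have "(if i < n then T i e else e (i - n)) = (if i < n then S i (\<lambda>n. e (Suc n))
      else if i = n then e 0 else e (Suc (i - Suc n)))" for i e
    by (cases i n rule: linorder_cases) (simp_all add: T_def Suc_diff_Suc)
  then have "dfp (\<lambda>e. R (\<lambda>n. e (Suc n)) (e 0))"
    using 1 by (simp add: R_def)
  then have 2: "dfp (\<lambda>e. R e (S n e))"
    by (rule dfp_subst) (rule Suc.prems(2), simp)
  have "(if i < n then S i e else if i = n then S n e else e (i - Suc n)) =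
      (if i < Suc n then S i e else e (i - Suc n))" for i e
    by (simp add: less_Suc_eq)
  then show ?case
    using 2 by (simp only: R_def)
qed

lemma dfp1: "dfp (\<lambda>e. P (e 0)) \<Longrightarrow> dft A \<Longrightarrow> dfp (\<lambda>e. P (A e))"
  by (rule dfp_subst[where Q = "\<lambda>e x. P x"])

lemma dfp2:
  assumes "dfp (\<lambda>e. P (e 0) (e 1))" "dft A" "dft B"
  shows "dfp (\<lambda>e. P (A e) (B e))"
  using dfp_substs[OF assms(1), of 2 "\<lambda>i. [A, B] ! i"] assms(2-)
  by (force simp add: less_Suc_eq numeral_eq_Suc)

lemma dfp3:
  assumes "dfp (\<lambda>e. P (e 0) (e 1) (e 2))" "dft A" "dft B" "dft C"
  shows "dfp (\<lambda>e. P (A e) (B e) (C e))"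
  using dfp_substs[OF assms(1), of 3 "\<lambda>i. [A, B, C] ! i"] assms(2-)
  by (force simp add: less_Suc_eq numeral_eq_Suc)

lemma dft1:
  assumes "dft (\<lambda>e. F (e 0))" "dft A"
  shows "dft (\<lambda>e. F (A e))"
  unfolding dft_def
  by (rule dfp2[where P = "\<lambda>x y. x = F y", OF _ dft_var dft_lift[OF assms(2)]])
    (use assms(1) in \<open>simp add: dft_def\<close>)

lemma dft2:
  assumes "dft (\<lambda>e. F (e 0) (e 1))" "dft A" "dft B"
  shows "dft (\<lambda>e. F (A e) (B e))"
  unfolding dft_def
  by (rule dfp3[where P = "\<lambda>x y z. x = F y z",
        OF _ dft_var dft_lift[OF assms(2)] dft_lift[OF assms(3)]])
    (use assms(1) in \<open>simp add: dft_def numeral_eq_Suc\<close>)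

lemma dfp_mem: "dft S \<Longrightarrow> dft T \<Longrightarrow> dfp (\<lambda>e. S e \<in> elts (T e))"
  by (rule dfp2[where P = "\<lambda>x y. x \<in> elts y", OF dfp_mem_var])

lemma dfp_eq: "dft S \<Longrightarrow> dft T \<Longrightarrow> dfp (\<lambda>e. S e = T e)"
  by (rule dfp2[where P = "(=)"]) (use dft_var[of 0] in \<open>simp_all add: dft_def\<close>)

lemma dfp_ball:
  "dft T \<Longrightarrow> dfp (\<lambda>e. Q (\<lambda>n. e (Suc n)) (e 0)) \<Longrightarrow> dfp (\<lambda>e. \<forall>x \<in> elts (T e). Q e x)"
  unfolding Ball_def by (intro dfp_all dfp_imp dfp_mem dft_var, rule dft_lift)

lemma dfp_bex:
  "dft T \<Longrightarrow> dfp (\<lambda>e. Q (\<lambda>n. e (Suc n)) (e 0)) \<Longrightarrow> dfp (\<lambda>e. \<exists>x \<in> elts (T e). Q e x)"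
  unfolding Bex_def by (intro dfp_ex dfp_conj dfp_mem dft_var, rule dft_lift)

lemma dfp_subset: "dft S \<Longrightarrow> dft T \<Longrightarrow> dfp (\<lambda>e. elts (S e) \<subseteq> elts (T e))"
  unfolding subset_eq by (rule dfp_ball, assumption) (rule dfp_mem[OF dft_var dft_lift])

lemma dfp_skip_var:
  assumes "dfp (\<lambda>e. Q (\<lambda>n. e (Suc n)) (e 0))"
  shows "dfp (\<lambda>e. Q (\<lambda>n. e (Suc (Suc n))) (e 0))"
proof -
  have "inj (\<lambda>n. case n of 0 \<Rightarrow> 0 | Suc n \<Rightarrow> Suc (Suc n))"
    by (auto simp: inj_def split: nat.splits)
  from dfp_rename[OF assms this] show ?thesis by simp
qed

lemma dfp_lift:
  assumes "dfp P"
  shows "dfp (\<lambda>e. P (\<lambda>n. e (Suc n)))"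
  using dfp_rename[OF assms, of Suc] by simp

lemma dfp_ex1:
  assumes "dfp (\<lambda>e. Q (\<lambda>n. e (Suc n)) (e 0))"
  shows "dfp (\<lambda>e. \<exists>!x. Q e x)"
proof -
  have "dfp (\<lambda>e. \<exists>y. \<forall>x. Q e x \<longleftrightarrow> x = y)"
    by (intro dfp_ex dfp_all dfp_iff dfp_eq dft_var) (rule dfp_skip_var[OF assms])
  moreover have "(\<exists>!x. Q e x) \<longleftrightarrow> (\<exists>y. \<forall>x. Q e x \<longleftrightarrow> x = y)" for e
    by auto
  ultimately show ?thesis by simp
qed

lemma dft_if:
  assumes "dfp P" "dft S" "dft T"
  shows "dft (\<lambda>e. if P e then S e else T e)"
proof -
  have "dfp (\<lambda>e. (P (\<lambda>n. e (Suc n)) \<longrightarrow> e 0 = S (\<lambda>n. e (Suc n)))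
      \<and> (\<not> P (\<lambda>n. e (Suc n)) \<longrightarrow> e 0 = T (\<lambda>n. e (Suc n))))"
    using assms(2,3)[unfolded dft_def] dfp_lift[OF assms(1)]
    by (intro dfp_conj dfp_imp dfp_not)
  moreover have "(e 0 = (if P (\<lambda>n. e (Suc n)) then S (\<lambda>n. e (Suc n)) else T (\<lambda>n. e (Suc n)))) \<longleftrightarrow>
    ((P (\<lambda>n. e (Suc n)) \<longrightarrow> e 0 = S (\<lambda>n. e (Suc n)))
      \<and> (\<not> P (\<lambda>n. e (Suc n)) \<longrightarrow> e 0 = T (\<lambda>n. e (Suc n))))" for e
    by simp
  ultimately show ?thesis unfolding dft_def by simp
qed

lemma dft_The:
  assumes "dfp (\<lambda>e. Q (\<lambda>n. e (Suc n)) (e 0))" and "\<And>e x y. Q e x \<Longrightarrow> Q e y \<Longrightarrow> x = y"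
  shows "dft (\<lambda>e. THE x. Q e x)"
proof -
  \<comment> \<open>Where the description fails, it denotes the same element
    \<open>THE x. False\<close> for every environment, and this element can be a parameter.
    Ambiguous descriptions are excluded by the assumption.\<close>
  have "y = (THE x. Q e x) \<longleftrightarrow> Q e y \<or> \<not> (\<exists>x. Q e x) \<and> y = (THE x. False)" for e y
  proof (cases "\<exists>x. Q e x")
    case True
    then show ?thesis using assms(2) by (metis the_equality)
  next
    case False
    then have "Q e = (\<lambda>x. False)" by auto
    then show ?thesis by simp
  qed
  moreover have "dfp (\<lambda>e. Q (\<lambda>n. e (Suc n)) (e 0) \<or>
      \<not> (\<exists>x. Q (\<lambda>n. e (Suc n)) x) \<and> e 0 = (THE x. False))"
    by (intro dfp_disj dfp_conj dfp_not dfp_ex dfp_eq dft_var dft_const)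
      (rule assms(1), rule dfp_skip_var[OF assms(1)])
  ultimately show ?thesis
    unfolding dft_def by simp
qed

lemma dfp_class:
  assumes "definable_class K" "dft T"
  shows "dfp (\<lambda>e. T e \<in> K)"
proof (rule dfp1[OF _ assms(2)])
  obtain p r where K: "K = {x. sat mem (r(0 := x)) p}"
    using assms(1) by (auto simp: definable_class_def)
  \<comment> \<open>In \<open>definable_class\<close>, variable 0 is the argument and all others are
    parameters. The latter are sent to odd variables, where \<open>mix\<close> looks up
    parameters.\<close>
  define f where "f i = (if i = 0 then 0 else 2 * i + 1)" for i :: nat
  have "inj f" by (auto simp: inj_def f_def split: if_splits)
  moreover have "(\<lambda>i. mix e r (f i)) = r(0 := e 0)" for e
    by (auto simp: mix_def f_def)
  ultimately show "dfp (\<lambda>e. e 0 \<in> K)"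
    unfolding dfp_def K by (intro exI[of _ "rename f p"] exI[of _ r]) (simp add: sat_rename)
qed

section \<open>Sets\<close>

lemma dft_rename:
  assumes "dft T" "inj f"
  shows "dft (\<lambda>e. T (\<lambda>n. e (f n)))"
proof -
  have "inj (\<lambda>n. case n of 0 \<Rightarrow> 0 | Suc n \<Rightarrow> Suc (f n))"
    by (rule injI) (auto simp: inj_eq[OF assms(2)] split: nat.splits)
  from dfp_rename[OF assms(1)[unfolded dft_def] this] show ?thesis
    by (simp add: dft_def)
qed

lemma dft_skip_var:
  assumes "dft (\<lambda>e. G (\<lambda>n. e (Suc n)) (e 0))"
  shows "dft (\<lambda>e. G (\<lambda>n. e (Suc (Suc n))) (e 0))"
proof -
  have "inj (\<lambda>n. case n of 0 \<Rightarrow> 0 | Suc n \<Rightarrow> Suc (Suc n))"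
    by (auto simp: inj_def split: nat.splits)
  from dft_rename[OF assms this] show ?thesis by simp
qed

named_theorems df

lemmas [df] = dft_const dft_var dfp_const dfp_mem dfp_eq dfp_not dfp_conj dfp_disj dfp_imp dfp_iff
  dfp_all dfp_ex dfp_ball dfp_bex dfp_subset dfp_ex1 dft_if

text \<open>Separates the HOL sets that are sets of the model from mere collections of its elements;
  \<open>elts (mk X) = X\<close> is available only for the former.\<close>

definition small :: "'v set \<Rightarrow> bool" where
  "small X \<longleftrightarrow> (\<exists>x. elts x = X)"

lemma small_elts [simp]: "small (elts x)"
  by (auto simp: small_def)

definition func :: "'v \<Rightarrow> bool" where
  "func f \<longleftrightarrow> (\<forall>x y z. pair x y \<in> elts f \<and> pair x z \<in> elts f \<longrightarrow> y = z)"

text \<open>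
  \<open>app f x\<close> is a definable function of \<open>f\<close> and \<open>x\<close> only where the description in its definition
  is not ambiguous. The variant \<open>ap\<close> is definable everywhere and agrees with \<open>app\<close> on functions,
  even outside of their domain.
\<close>

definition ap :: "'v \<Rightarrow> 'v \<Rightarrow> 'v" where
  "ap f x = (THE y. pair x y \<in> elts f \<and> (\<forall>z. pair x z \<in> elts f \<longrightarrow> z = y))"

lemma app_eq_ap: "func f \<Longrightarrow> app f x = ap f x"
  unfolding app_def ap_def func_def by (rule arg_cong[where f = The]) blast

end

context ZF
begin

lemma elts_inject: "elts x = elts y \<Longrightarrow> x = y"
  using extensionality[of x y] by (auto simp: elts_def)

lemma mk_elts [simp]: "mk (elts x) = x"
  unfolding mk_def by (rule the_equality) (auto dest: elts_inject)

lemma elts_mk: "small X \<Longrightarrow> elts (mk X) = X"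
  by (auto simp: small_def)

lemma mk_inject: "small X \<Longrightarrow> small Y \<Longrightarrow> mk X = mk Y \<longleftrightarrow> X = Y"
  by (metis elts_mk)

lemma eqI: "(\<And>z. z \<in> elts x \<longleftrightarrow> z \<in> elts y) \<Longrightarrow> x = y"
  by (rule elts_inject) blast

text \<open>If the class is not a set, \<open>mk\<close> falls back on the constant value of a
  failing description, so \<open>dft_The\<close> covers every definable class at once.\<close>

lemma dft_mk [df]:
  assumes "dfp (\<lambda>e. Q (\<lambda>n. e (Suc n)) (e 0))"
  shows "dft (\<lambda>e. mk {x. Q e x})"
proof -
  have "dft (\<lambda>e. THE y. \<forall>x. x \<in> elts y \<longleftrightarrow> Q e x)"
    by (rule dft_The) (intro df, rule dfp_skip_var[OF assms], auto intro: eqI)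
  moreover have "(\<forall>x. x \<in> elts y \<longleftrightarrow> Q e x) \<longleftrightarrow> elts y = {x. Q e x}" for e y
    by auto
  ultimately show ?thesis by (simp add: mk_def)
qed

lemma small_sep:
  assumes "dfp (\<lambda>e. Q (e 0))"
  shows "small {x \<in> elts a. Q x}"
proof -
  obtain p r where p: "\<And>e. Q (e 0) \<longleftrightarrow> sat mem (mix e r) p"
    using assms by (auto simp: dfp_def)
  have "(mix e r)(0 := x) = mix (e(0 := x)) r" for e and x :: 'v
    by (rule ext_by_parity) (auto simp: mix_def)
  then have "sat mem ((mix (\<lambda>_. a) r)(0 := x)) p \<longleftrightarrow> Q x" for x
    using p[of "(\<lambda>_. a)(0 := x)"] by simp
  then show ?thesis
    using separation[of a "mix (\<lambda>_. a) r" p] by (auto simp: small_def elts_def)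
qed

lemma small_Collect:
  assumes "small X" "dfp (\<lambda>e. Q (e 0))" "\<And>x. Q x \<Longrightarrow> x \<in> X"
  shows "small {x. Q x}"
proof -
  obtain a where "elts a = X" using assms(1) by (auto simp: small_def)
  then have "{x. Q x} = {x \<in> elts a. Q x}" using assms(3) by auto
  then show ?thesis using small_sep[OF assms(2)] by metis
qed

text \<open>Predicates that mention \<open>app\<close> are often definable only after
  \<open>app\<close> has been replaced by \<open>ap\<close>; on the bounding set this makes no
  difference.\<close>

lemma small_Collect_cong:
  assumes "small X" "dfp (\<lambda>e. Q' (e 0))" "\<And>x. Q x \<Longrightarrow> x \<in> X"
    and "\<And>x. x \<in> X \<Longrightarrow> Q x = Q' x"
  shows "small {x. Q x}"
proof -
  obtain a where "elts a = X" using assms(1) by (auto simp: small_def)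
  then have "{x. Q x} = {x \<in> elts a. Q' x}" using assms(3,4) by auto
  then show ?thesis using small_sep[OF assms(2)] by metis
qed

lemma small_image:
  assumes "small X" "dft (\<lambda>e. G (e 0))"
  shows "small (G ` X)"
proof -
  obtain a where a: "elts a = X" using assms(1) by (auto simp: small_def)
  obtain p r where p: "\<And>e. e 0 = G (e (Suc 0)) \<longleftrightarrow> sat mem (mix e r) p"
    using assms(2) by (auto simp: dfp_def dft_def)
  \<comment> \<open>Replacement expects the argument at variable 0 and the value at variable 1,
    whereas the graph has the value at formula variable 0 and the argument at formula variable 2.
    The first parameter, displaced from variable 1, is stored at variable 2.\<close>
  define f where "f i = (if i = 0 then 1 else if i = 2 then 0 else if i = 1 then 2 else i)" for i :: nat
  have "inj f" by (auto simp: inj_def f_def)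
  define e' where "e' = (\<lambda>i. if i = 2 then r 0 else mix (\<lambda>_. a) r i)"
  have "(\<lambda>i. (e'(0 := x, 1 := y)) (f i)) = mix ((\<lambda>_. a)(0 := y, 1 := x)) r" for x y
    by (rule ext_by_parity) (auto simp: f_def e'_def mix_def)
  then have "sat mem (e'(0 := x, 1 := y)) (rename f p) \<longleftrightarrow> y = G x" for x y
    using p[of "(\<lambda>_. a)(0 := y, 1 := x)"] by (simp add: sat_rename[OF \<open>inj f\<close>] del: fun_upd_apply) simp
  then obtain b where "\<forall>y. mem y b \<longleftrightarrow> (\<exists>x. mem x a \<and> y = G x)"
    using replacement[of a e' "rename f p"] by auto
  then have "elts b = G ` elts a" by (auto simp: elts_def)
  then show ?thesis using a by (auto simp: small_def)
qed

lemma small_empty [simp]: "small {}"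
  using small_sep[of "\<lambda>_. False"] dfp_const by simp

lemma small_doubleton: "small {x, y}"
proof -
  obtain z where "\<forall>w. mem w z \<longleftrightarrow> w = x \<or> w = y" using pairing[of x y] by auto
  then have "elts z = {x, y}" by (auto simp: elts_def)
  then show ?thesis by (auto simp: small_def)
qed

lemma small_UN:
  assumes "small X" "dft (\<lambda>e. G (e 0))"
  shows "small (\<Union>x\<in>X. elts (G x))"
proof -
  obtain a where "elts a = G ` X" using small_image[OF assms] by (auto simp: small_def)
  moreover obtain b where "\<forall>w. mem w b \<longleftrightarrow> (\<exists>y. mem y a \<and> mem w y)"
    using union[of a] by auto
  then have "elts b = (\<Union>x\<in>elts a. elts x)" by (auto simp: elts_def)
  ultimately show ?thesis unfolding small_def by auto
qed

lemma small_Un [simp]: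
  assumes "small X" "small Y"
  shows "small (X \<union> Y)"
proof -
  obtain a b where ab: "elts a = X" "elts b = Y" using assms by (auto simp: small_def)
  have "small (\<Union>x\<in>{a, b}. elts x)"
    by (rule small_UN[OF small_doubleton, of "\<lambda>x. x"]) (rule df)
  then show ?thesis by (simp add: ab)
qed

lemma small_insert [simp]: "small X \<Longrightarrow> small (insert x X)"
  using small_Un[OF small_doubleton[of x x]] by simp

lemma small_Pow:
  assumes "small X"
  shows "small {y. elts y \<subseteq> X}"
proof -
  obtain a where "elts a = X" using assms by (auto simp: small_def)
  moreover obtain b where "\<forall>y. mem y b \<longleftrightarrow> (\<forall>w. mem w y \<longrightarrow> mem w a)"
    using power_set[of a] by auto
  then have "elts b = {y. elts y \<subseteq> elts a}" by (auto simp: elts_def)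
  ultimately show ?thesis by (auto simp: small_def)
qed

lemma dft_pair [df]:
  assumes "dft S" "dft T"
  shows "dft (\<lambda>e. pair (S e) (T e))"
proof -
  have "{z. z = x \<or> z = y} = {x, y}" for x y :: 'v
    by auto
  then have "pair x y = mk {z. z = mk {u. u = x} \<or> z = mk {u. u = x \<or> u = y}}" for x y
    by (simp add: pair_def)
  moreover have "dft (\<lambda>e. mk {z. z = mk {u. u = e 0} \<or> z = mk {u. u = e 0 \<or> u = e 1}})"
    by (intro df)
  ultimately have "dft (\<lambda>e. pair (e 0) (e 1))" by simp
  from dft2[OF this assms] show ?thesis .
qed

lemma pair_inject [simp]: "pair x y = pair x' y' \<longleftrightarrow> x = x' \<and> y = y'"
  unfolding pair_def by (simp add: mk_inject doubleton_eq_iff) metis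

lemma fst_of_pair [simp]: "fst_of (pair x y) = x"
  unfolding fst_of_def by simp

lemma snd_of_pair [simp]: "snd_of (pair x y) = y"
  unfolding snd_of_def by simp

lemma dft_fst [df]: "dft S \<Longrightarrow> dft (\<lambda>e. fst_of (S e))"
  by (rule dft1[where F = fst_of]) (unfold fst_of_def, rule dft_The, intro df, auto)

lemma dft_snd [df]: "dft S \<Longrightarrow> dft (\<lambda>e. snd_of (S e))"
  by (rule dft1[where F = snd_of]) (unfold snd_of_def, rule dft_The, intro df, auto)

lemma dft_ap [df]: "dft S \<Longrightarrow> dft T \<Longrightarrow> dft (\<lambda>e. ap (S e) (T e))"
  by (rule dft2[where F = ap]) (unfold ap_def, rule dft_The, intro df, auto)

lemma dft_triple [df]: "dft R \<Longrightarrow> dft S \<Longrightarrow> dft T \<Longrightarrow> dft (\<lambda>e. triple (R e) (S e) (T e))"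
  unfolding triple_def by (intro df)

lemma dft_lam [df]:
  assumes "dft S" "dft (\<lambda>e. G (\<lambda>n. e (Suc n)) (e 0))"
  shows "dft (\<lambda>e. lam (S e) (\<lambda>x. G e x))"
proof -
  have "dft (\<lambda>e. mk {p. \<exists>x\<in>elts (S e). p = pair x (G e x)})"
    by (intro df, rule dft_lift[OF assms(1)], rule dft_skip_var[OF assms(2)])
  moreover have "{pair x (G e x) |x. x \<in> elts (S e)} = {p. \<exists>x\<in>elts (S e). p = pair x (G e x)}" for e
    by auto
  ultimately show ?thesis by (simp add: lam_def)
qed

lemma small_Times:
  assumes "small X" "small Y"
  shows "small {pair x y |x y. x \<in> X \<and> y \<in> Y}"
proof -
  obtain a b where ab: "elts a = X" "elts b = Y" using assms by (auto simp: small_def)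
  have "small {p. \<exists>x\<in>elts a. \<exists>y\<in>elts b. p = pair x y}"
  proof (rule small_Collect)
    \<comment> \<open>A Kuratowski pair over \<open>X\<close> and \<open>Y\<close> is a set of
      subsets of their union, so two power sets bound the product.\<close>
    show "small {z. elts z \<subseteq> {z. elts z \<subseteq> X \<union> Y}}"
      using assms by (intro small_Pow small_Un)
    show "dfp (\<lambda>e. \<exists>x\<in>elts a. \<exists>y\<in>elts b. e 0 = pair x y)"
      by (intro df)
  qed (auto simp: ab pair_def elts_mk)
  moreover have "{pair x y |x y. x \<in> X \<and> y \<in> Y} = {p. \<exists>x\<in>elts a. \<exists>y\<in>elts b. p = pair x y}"
    using ab by auto
  ultimately show ?thesis by simp
qed

section \<open>Natural numbers of the model\<close>

lemma elts_zero [simp]: "elts zero = {}"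
  by (simp add: zero_def elts_mk)

lemma elts_succ [simp]: "elts (succ n) = insert n (elts n)"
  by (simp add: succ_def elts_mk)

lemma zero_iff: "x = zero \<longleftrightarrow> elts x = {}"
  by (metis elts_zero elts_inject)

lemma dft_succ [df]:
  assumes "dft S"
  shows "dft (\<lambda>e. succ (S e))"
proof (rule dft1[where F = succ, OF _ assms])
  show "dft (\<lambda>e. succ (e 0))"
    unfolding succ_def insert_compr by (intro df)
qed

lemma foundation_elts: "elts x \<noteq> {} \<Longrightarrow> \<exists>y\<in>elts x. elts x \<inter> elts y = {}"
  using foundation[of x] by (auto simp: elts_def)

lemma not_mem_self [simp]: "x \<notin> elts x"
  using foundation_elts[of "mk {x}"] by (auto simp: elts_mk)

lemma succ_neq_zero [simp]: "succ n \<noteq> zero" "zero \<noteq> succ n"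
  by (simp_all add: zero_iff) (metis elts_succ elts_zero insert_not_empty)

lemma one_neq_zero [simp]: "one \<noteq> zero" "zero \<noteq> one"
  by (simp_all add: one_def)

lemma elts_one [simp]: "elts one = {zero}"
  by (simp add: one_def)

lemma elts_omega:
  "elts omega = {n. \<forall>X. zero \<in> elts X \<and> (\<forall>m \<in> elts X. succ m \<in> elts X) \<longrightarrow> n \<in> elts X}"
proof -
  \<comment> \<open>The intersection of all inductive sets is a set because infinity provides one of
    them as a bound.\<close>
  obtain x y where x: "y \<in> elts x" "elts y = {}"
    "\<And>y. y \<in> elts x \<Longrightarrow> \<exists>z\<in>elts x. \<forall>w. w \<in> elts z \<longleftrightarrow> w \<in> elts y \<or> w = y"
    using infinity unfolding elts_def by auto
  have "zero \<in> elts x"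
    using x(1,2) zero_iff[of y] by simp
  moreover have "succ m \<in> elts x" if m: "m \<in> elts x" for m
  proof -
    obtain z where z: "z \<in> elts x" "\<forall>w. w \<in> elts z \<longleftrightarrow> w \<in> elts m \<or> w = m"
      using x(3)[OF m] by blast
    then have "z = succ m" by (intro eqI) auto
    then show ?thesis using z(1) by simp
  qed
  ultimately show ?thesis
    unfolding omega_def
    by (intro elts_mk small_Collect[OF small_elts[of x]]) (intro df, blast)
qed

lemma zero_omega [simp]: "zero \<in> elts omega"
  by (simp add: elts_omega)

lemma succ_omega [simp]: "n \<in> elts omega \<Longrightarrow> succ n \<in> elts omega"
  by (simp add: elts_omega)

lemma omega_induct [consumes 1, case_names defn zero succ]:
  assumes "n \<in> elts omega"
    and "dfp (\<lambda>e. P (e 0))"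
    and "P zero"
    and "\<And>n. n \<in> elts omega \<Longrightarrow> P n \<Longrightarrow> P (succ n)"
  shows "P n"
proof -
  define X where "X = mk {n \<in> elts omega. P n}"
  have X: "elts X = {n \<in> elts omega. P n}"
    unfolding X_def by (rule elts_mk[OF small_sep[OF assms(2)]])
  have "n \<in> elts X"
    using assms(1) unfolding elts_omega mem_Collect_eq
    by (rule allE[of _ X]) (use assms(3,4) X in auto)
  then show ?thesis by (simp add: X)
qed

lemma omega_cases [consumes 1, case_names zero succ]:
  assumes "n \<in> elts omega"
  obtains "n = zero" | m where "m \<in> elts omega" "n = succ m"
proof -
  have "n = zero \<or> (\<exists>m\<in>elts omega. n = succ m)"
    using assms by (rule omega_induct) (intro df, auto)
  then show thesis using that by blast
qed

lemma omega_trans: "n \<in> elts omega \<Longrightarrow> m \<in> elts n \<Longrightarrow> m \<in> elts omega"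
proof -
  assume "n \<in> elts omega"
  then have "elts n \<subseteq> elts omega"
    by (rule omega_induct) (intro df, auto)
  then show "m \<in> elts n \<Longrightarrow> m \<in> elts omega" by auto
qed

lemma omega_subset: "n \<in> elts omega \<Longrightarrow> elts n \<subseteq> elts omega"
  using omega_trans by blast

lemma omega_elts_trans: "n \<in> elts omega \<Longrightarrow> m \<in> elts n \<Longrightarrow> elts m \<subseteq> elts n"
proof -
  assume "n \<in> elts omega"
  then have "\<forall>m\<in>elts n. elts m \<subseteq> elts n"
    by (rule omega_induct) (intro df, auto)
  then show "m \<in> elts n \<Longrightarrow> elts m \<subseteq> elts n" by auto
qed

lemma succ_mem_succ: "n \<in> elts omega \<Longrightarrow> m \<in> elts n \<Longrightarrow> succ m \<in> elts (succ n)"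
proof -
  assume "n \<in> elts omega"
  then have "\<forall>m\<in>elts n. succ m \<in> elts (succ n)"
    by (rule omega_induct) (intro df, auto)
  then show "m \<in> elts n \<Longrightarrow> succ m \<in> elts (succ n)" by auto
qed

lemma omega_linear:
  assumes "m \<in> elts omega" "n \<in> elts omega"
  shows "m \<in> elts n \<or> m = n \<or> n \<in> elts m"
proof -
  have zero: "zero = n \<or> zero \<in> elts n" if "n \<in> elts omega" for n
    using that by (rule omega_induct) (intro df, auto)
  have "\<forall>n\<in>elts omega. m \<in> elts n \<or> m = n \<or> n \<in> elts m"
    using assms(1)
  proof (rule omega_induct)
    fix m assume m: "m \<in> elts omega" and IH: "\<forall>n\<in>elts omega. m \<in> elts n \<or> m = n \<or> n \<in> elts m"
    show "\<forall>n\<in>elts omega. succ m \<in> elts n \<or> succ m = n \<or> n \<in> elts (succ m)"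
    proof
      fix n assume n: "n \<in> elts omega"
      show "succ m \<in> elts n \<or> succ m = n \<or> n \<in> elts (succ m)"
      proof (cases "m \<in> elts n")
        case True
        then have "succ m \<in> elts (succ n)" by (rule succ_mem_succ[OF n])
        then show ?thesis by auto
      qed (use IH n in auto)
    qed
  qed (intro df, use zero in auto)
  then show ?thesis using assms(2) by auto
qed

text \<open>The union of \<open>n\<close>. Since natural numbers are transitive sets, it inverts
  \<open>succ\<close> on them.\<close>

definition pred :: "'v \<Rightarrow> 'v" where
  "pred n = mk {x. \<exists>y\<in>elts n. x \<in> elts y}"

lemma dft_pred [df]: "dft S \<Longrightarrow> dft (\<lambda>e. pred (S e))"
  by (rule dft1[where F = pred]) (unfold pred_def, intro df)

lemma pred_succ [simp]:
  assumes "n \<in> elts omega"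
  shows "pred (succ n) = n"
proof -
  have "{x. \<exists>y\<in>elts (succ n). x \<in> elts y} = elts n"
    using omega_elts_trans[OF assms] by auto
  then show ?thesis by (simp only: pred_def mk_elts)
qed

lemma omega_directed:
  assumes "m \<in> elts omega" "n \<in> elts omega"
  obtains k where "k \<in> elts omega" "elts m \<subseteq> elts k" "elts n \<subseteq> elts k"
  using omega_linear[OF assms] omega_elts_trans assms that by (metis order_refl)

section \<open>Set functions, finite choice and recursion\<close>

lemma pair_mem_fun:
  assumes "fun_on f a"
  shows "pair x y \<in> elts f \<longleftrightarrow> x \<in> elts a \<and> y = app f x"
proof -
  have ex1: "\<exists>!y. pair x y \<in> elts f" if "x \<in> elts a"
    using assms that by (simp add: fun_on_def)
  have dom: "x \<in> elts a" if "pair x y \<in> elts f"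
  proof -
    obtain x' y' where "x' \<in> elts a" "pair x y = pair x' y'"
      using assms \<open>pair x y \<in> elts f\<close> unfolding fun_on_def by blast
    then show ?thesis by simp
  qed
  show ?thesis
    using dom theI'[OF ex1] the1_equality[OF ex1] unfolding app_def by auto
qed

lemma fun_on_func: "fun_on f a \<Longrightarrow> func f"
  unfolding func_def using pair_mem_fun by metis

lemma maps_fun_on: "maps f a b \<Longrightarrow> fun_on f a"
  by (simp add: maps_def)

lemma maps_func: "maps f a b \<Longrightarrow> func f"
  using fun_on_func maps_fun_on by blast

lemma maps_app: "maps f a b \<Longrightarrow> x \<in> elts a \<Longrightarrow> app f x \<in> elts b"
  by (simp add: maps_def)

lemma maps_mono: "maps f a b \<Longrightarrow> elts b \<subseteq> elts c \<Longrightarrow> maps f a c"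
  by (auto simp: maps_def)

lemma fun_on_mem:
  assumes "fun_on f a"
  shows "p \<in> elts f \<longleftrightarrow> (\<exists>x\<in>elts a. p = pair x (app f x))"
proof
  assume p: "p \<in> elts f"
  then obtain x y where "x \<in> elts a" "p = pair x y"
    using assms unfolding fun_on_def by blast
  then show "\<exists>x\<in>elts a. p = pair x (app f x)"
    using p pair_mem_fun[OF assms] by auto
qed (use pair_mem_fun[OF assms] in auto)

lemma fun_ext:
  assumes "fun_on f a" "fun_on g a" "\<And>x. x \<in> elts a \<Longrightarrow> app f x = app g x"
  shows "f = g"
  by (rule eqI) (simp add: fun_on_mem[OF assms(1)] fun_on_mem[OF assms(2)] assms(3))

lemma lam_cong [cong]:
  "a = b \<Longrightarrow> (\<And>x. x \<in> elts b \<Longrightarrow> G x = H x) \<Longrightarrow> lam a G = lam b H"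
  unfolding lam_def by (intro arg_cong[where f = mk]) auto

text \<open>Only under this condition is \<open>lam a G\<close> the graph of \<open>G\<close> on
  \<open>a\<close>. It asks less than definability of \<open>G\<close>, which may fail outside
  \<open>a\<close>.\<close>

definition set_fun :: "'v \<Rightarrow> ('v \<Rightarrow> 'v) \<Rightarrow> bool" where
  "set_fun a G \<longleftrightarrow> small {pair x (G x) |x. x \<in> elts a}"

lemma set_funI: "dft (\<lambda>e. G (e 0)) \<Longrightarrow> set_fun a G"
proof -
  assume G: "dft (\<lambda>e. G (e 0))"
  have "small ((\<lambda>x. pair x (G x)) ` elts a)"
    by (rule small_image) (simp, intro df G)
  also have "(\<lambda>x. pair x (G x)) ` elts a = {pair x (G x) |x. x \<in> elts a}"
    by auto
  finally show ?thesis by (simp add: set_fun_def)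
qed

lemma set_fun_cong: "(\<And>x. x \<in> elts a \<Longrightarrow> G x = H x) \<Longrightarrow> set_fun a H \<Longrightarrow> set_fun a G"
proof -
  assume "\<And>x. x \<in> elts a \<Longrightarrow> G x = H x" "set_fun a H"
  moreover from this(1) have "{pair x (G x) |x. x \<in> elts a} = {pair x (H x) |x. x \<in> elts a}"
    by auto
  ultimately show ?thesis by (simp add: set_fun_def)
qed

lemma set_funI_cong: "dft (\<lambda>e. H (e 0)) \<Longrightarrow> (\<And>x. x \<in> elts a \<Longrightarrow> G x = H x) \<Longrightarrow> set_fun a G"
  by (rule set_fun_cong[OF _ set_funI])

lemma elts_lam: "set_fun a G \<Longrightarrow> elts (lam a G) = {pair x (G x) |x. x \<in> elts a}"
  unfolding lam_def set_fun_def by (rule elts_mk)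

lemma fun_on_lam: "set_fun a G \<Longrightarrow> fun_on (lam a G) a"
  unfolding fun_on_def by (auto simp: elts_lam)

lemma app_lam: "set_fun a G \<Longrightarrow> x \<in> elts a \<Longrightarrow> app (lam a G) x = G x"
  using pair_mem_fun[OF fun_on_lam, of a G x "G x"] by (auto simp: elts_lam)

lemma maps_lam: "set_fun a G \<Longrightarrow> (\<And>x. x \<in> elts a \<Longrightarrow> G x \<in> elts b) \<Longrightarrow> maps (lam a G) a b"
  unfolding maps_def by (simp add: fun_on_lam app_lam)

lemma dft_app: "func f \<Longrightarrow> dft S \<Longrightarrow> dft (\<lambda>e. app f (S e))"
  unfolding app_eq_ap by (intro df)

lemma set_fun_app: "fun_on f b \<Longrightarrow> set_fun a (app f)"
  by (rule set_funI) (intro dft_app df fun_on_func)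

lemma lam_app: "fun_on f a \<Longrightarrow> lam a (app f) = f"
  by (rule fun_ext[OF fun_on_lam _ app_lam]) (rule set_fun_app | assumption)+

lemma dfp_fun_on [df]: "dft S \<Longrightarrow> dft T \<Longrightarrow> dfp (\<lambda>e. fun_on (S e) (T e))"
  by (rule dfp2[where P = fun_on]) (unfold fun_on_def, intro df)

lemma maps_iff: "maps f a b \<longleftrightarrow> fun_on f a \<and> (\<forall>x\<in>elts a. \<exists>y\<in>elts b. pair x y \<in> elts f)"
  unfolding maps_def by (auto simp: pair_mem_fun)

lemma dfp_maps [df]: "dft R \<Longrightarrow> dft S \<Longrightarrow> dft T \<Longrightarrow> dfp (\<lambda>e. maps (R e) (S e) (T e))"
  by (rule dfp3[where P = maps]) (unfold maps_iff, intro df)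

lemma small_maps: "small {f. maps f a b}"
proof (rule small_Collect)
  show "small {f. elts f \<subseteq> {pair x y |x y. x \<in> elts a \<and> y \<in> elts b}}"
    by (intro small_Pow small_Times small_elts)
qed (intro df, auto simp: maps_def fun_on_mem)

lemma elts_tuples: "elts (tuples d n) = {t. maps t n d}"
  unfolding tuples_def by (intro elts_mk small_maps)

lemma dft_tuples [df]: "dft S \<Longrightarrow> dft T \<Longrightarrow> dft (\<lambda>e. tuples (S e) (T e))"
  by (rule dft2[where F = tuples]) (unfold tuples_def, intro df)

lemma fun_extend:
  assumes "fun_on f n"
  obtains g where "fun_on g (succ n)" "app g n = y" "\<And>k. k \<in> elts n \<Longrightarrow> app g k = app f k"
proof
  have G: "set_fun (succ n) (\<lambda>k. if k = n then y else app f k)"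
    by (rule set_funI) (intro df dft_app fun_on_func[OF assms])
  show "fun_on (lam (succ n) (\<lambda>k. if k = n then y else app f k)) (succ n)"
    by (rule fun_on_lam[OF G])
  show "app (lam (succ n) (\<lambda>k. if k = n then y else app f k)) n = y"
    by (subst app_lam[OF G]) auto
  show "app (lam (succ n) (\<lambda>k. if k = n then y else app f k)) k = app f k" if "k \<in> elts n" for k
    using that by (subst app_lam[OF G]) auto
qed

lemma fun_restrict:
  assumes "fun_on f (succ n)"
  obtains g where "fun_on g n" "\<And>k. k \<in> elts n \<Longrightarrow> app g k = app f k"
  by (rule that[OF fun_on_lam app_lam]) (rule set_fun_app[OF assms])+

lemma fun_empty: obtains f where "fun_on f zero"
  by (rule that[of zero]) (simp add: fun_on_def)

text \<open>Choice over a natural number is a theorem of ZF, by extending the function one argument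
  at a time. The induction is carried out with \<open>ap\<close>, for which its predicate is
  definable.\<close>

lemma finite_choice:
  assumes "n \<in> elts omega" "dfp (\<lambda>e. P (e 0) (e 1))" "\<And>k. k \<in> elts n \<Longrightarrow> \<exists>y. P k y"
  obtains f where "fun_on f n" "\<And>k. k \<in> elts n \<Longrightarrow> P k (app f k)"
proof -
  note P = dfp2[where P = P, OF assms(2)]
  have "(\<forall>k\<in>elts n. \<exists>y. P k y) \<longrightarrow> (\<exists>f. fun_on f n \<and> (\<forall>k\<in>elts n. P k (ap f k)))"
    using assms(1)
  proof (rule omega_induct)
    fix n
    assume IH: "(\<forall>k\<in>elts n. \<exists>y. P k y) \<longrightarrow> (\<exists>f. fun_on f n \<and> (\<forall>k\<in>elts n. P k (ap f k)))"
    show "(\<forall>k\<in>elts (succ n). \<exists>y. P k y) \<longrightarrow> (\<exists>f. fun_on f (succ n) \<and> (\<forall>k\<in>elts (succ n). P k (ap f k)))"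
    proof
      assume ex: "\<forall>k\<in>elts (succ n). \<exists>y. P k y"
      then obtain f where f: "fun_on f n" "\<forall>k\<in>elts n. P k (ap f k)" using IH by auto
      obtain y where y: "P n y" using ex by auto
      obtain g where g: "fun_on g (succ n)" "app g n = y" "\<And>k. k \<in> elts n \<Longrightarrow> app g k = app f k"
        using fun_extend[OF f(1)] by metis
      show "\<exists>f. fun_on f (succ n) \<and> (\<forall>k\<in>elts (succ n). P k (ap f k))"
        by (rule exI[of _ g]) (use f g y in \<open>auto simp: app_eq_ap[OF fun_on_func]\<close>)
    qed
  qed (intro df P, use fun_empty in auto)
  then show thesis using that assms(3) by (metis app_eq_ap fun_on_func)
qed

text \<open>Finitely many stages of an increasing construction lie below a common one. This serves
  for the argument tuples of terms and for the literals of a formula.\<close>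

lemma finite_bound:
  assumes "n \<in> elts omega" "dfp (\<lambda>e. P (e 0) (e 1))"
    and "\<And>k. k \<in> elts n \<Longrightarrow> \<exists>N\<in>elts omega. P k N"
    and mono: "\<And>k N M. P k N \<Longrightarrow> N \<in> elts omega \<Longrightarrow> M \<in> elts omega \<Longrightarrow> elts N \<subseteq> elts M \<Longrightarrow> P k M"
  obtains N where "N \<in> elts omega" "\<And>k. k \<in> elts n \<Longrightarrow> P k N"
proof -
  note P = dfp2[where P = P, OF assms(2)]
  have "(\<forall>k\<in>elts n. \<exists>N\<in>elts omega. P k N) \<longrightarrow> (\<exists>N\<in>elts omega. \<forall>k\<in>elts n. P k N)"
    using assms(1)
  proof (rule omega_induct)
    fix n
    assume IH: "(\<forall>k\<in>elts n. \<exists>N\<in>elts omega. P k N) \<longrightarrow> (\<exists>N\<in>elts omega. \<forall>k\<in>elts n. P k N)"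
    show "(\<forall>k\<in>elts (succ n). \<exists>N\<in>elts omega. P k N) \<longrightarrow> (\<exists>N\<in>elts omega. \<forall>k\<in>elts (succ n). P k N)"
    proof
      assume ex: "\<forall>k\<in>elts (succ n). \<exists>N\<in>elts omega. P k N"
      then obtain N M where NM: "N \<in> elts omega" "\<forall>k\<in>elts n. P k N" "M \<in> elts omega" "P n M"
        using IH by auto
      obtain L where L: "L \<in> elts omega" "elts N \<subseteq> elts L" "elts M \<subseteq> elts L"
        using omega_directed[OF NM(1,3)] .
      show "\<exists>N\<in>elts omega. \<forall>k\<in>elts (succ n). P k N"
        using L NM mono by (intro bexI[of _ L]) auto
    qed
  qed (intro df P, metis elts_zero empty_iff zero_omega)
  then show thesis using that assms(3) by auto
qed

lemma omega_recursion:
  assumes G: "dft (\<lambda>e. G (e 0))"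
  obtains S where "fun_on S omega" "app S zero = a" "\<And>n. n \<in> elts omega \<Longrightarrow> app S (succ n) = G (app S n)"
proof -
  note G' = dft1[where F = G, OF G]
  \<comment> \<open>\<open>att s n\<close> says that \<open>s\<close> obeys the recursion up to
    \<open>n\<close>; nothing is demanded beyond. Such attempts exist for each \<open>n\<close> and
    agree at \<open>n\<close>, both by induction.\<close>
  define att where "att s n \<longleftrightarrow> ap s zero = a \<and> (\<forall>k\<in>elts n. ap s (succ k) = G (ap s k))" for s n
  have att_zero: "att s zero \<longleftrightarrow> ap s zero = a" for s
    by (simp add: att_def)
  have att_succ: "att s (succ n) \<longleftrightarrow> att s n \<and> ap s (succ n) = G (ap s n)" for s n
    unfolding att_def elts_succ by blast
  have uniq: "\<forall>s t. att s n \<and> att t n \<longrightarrow> ap s n = ap t n" if "n \<in> elts omega" for n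
    using that
  proof (rule omega_induct)
    show "dfp (\<lambda>e. \<forall>s t. att s (e 0) \<and> att t (e 0) \<longrightarrow> ap s (e 0) = ap t (e 0))"
      unfolding att_def by (intro df G')
  qed (metis att_zero, metis att_succ)
  have ex: "\<exists>s. att s n" if "n \<in> elts omega" for n
    using that
  proof (rule omega_induct)
    show "dfp (\<lambda>e. \<exists>s. att s (e 0))"
      unfolding att_def by (intro df G')
    have "set_fun one (\<lambda>_. a)" by (intro set_funI df)
    then have "app (lam one (\<lambda>_. a)) zero = a" "func (lam one (\<lambda>_. a))"
      by (simp_all add: app_lam fun_on_func[OF fun_on_lam])
    then show "\<exists>s. att s zero"
      by (auto simp: att_zero app_eq_ap)
  next
    fix n assume n: "n \<in> elts omega" and "\<exists>s. att s n"
    then obtain s where s: "att s n" by auto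
    \<comment> \<open>The longer attempt needs a value at \<open>succ n\<close> itself, hence the
      domain \<open>succ (succ n)\<close>.\<close>
    let ?g = "\<lambda>k. if k = succ n then G (ap s n) else ap s k"
    have g: "set_fun (succ (succ n)) ?g"
      by (intro set_funI df G')
    have app: "ap (lam (succ (succ n)) ?g) k = ?g k" if "k \<in> elts (succ (succ n))" for k
      using app_lam[OF g that] app_eq_ap[OF fun_on_func[OF fun_on_lam[OF g]]] by simp
    have "zero \<in> elts (succ n)"
      using omega_linear[OF zero_omega n] by auto
    moreover have "zero \<noteq> succ n" by simp
    moreover have "succ k \<in> elts (succ n)" if "k \<in> elts n" for k
      using succ_mem_succ[OF n that] .
    moreover have "succ k \<noteq> succ n" if "k \<in> elts n" for k
      using that pred_succ[OF n] pred_succ[OF omega_trans[OF n that]] by (metis not_mem_self)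
    moreover have "k \<noteq> succ n" if "k \<in> elts (succ n)" for k
      using that by (metis not_mem_self)
    ultimately have "att (lam (succ (succ n)) ?g) n" "ap (lam (succ (succ n)) ?g) n = ap s n"
      using s unfolding att_def by (simp_all add: app)
    then have "att (lam (succ (succ n)) ?g) (succ n)"
      by (simp add: att_succ app)
    then show "\<exists>s. att s (succ n)" ..
  qed
  define R where "R n v \<longleftrightarrow> (\<exists>s. att s n \<and> ap s n = v)" for n v
  have R: "\<exists>!v. R n v" if "n \<in> elts omega" for n
    using ex[OF that] uniq[OF that] unfolding R_def by blast
  \<comment> \<open>Uniqueness is built into the description, so that it is unambiguous, and
    \<open>H\<close> definable, also at arguments outside \<open>omega\<close>.\<close>
  define H where "H n = (THE v. R n v \<and> (\<forall>w. R n w \<longrightarrow> w = v))" for n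
  have RH: "R n (H n)" if "n \<in> elts omega" for n
  proof -
    obtain v where v: "R n v" "\<And>w. R n w \<Longrightarrow> w = v" using R[of n] \<open>n \<in> elts omega\<close> by blast
    then have "H n = v" unfolding H_def by (intro the_equality) blast+
    then show ?thesis using v(1) by simp
  qed
  have "dft (\<lambda>e. H (e 0))"
    unfolding H_def R_def att_def by (rule dft_The) (intro df G', blast)
  then have H: "set_fun omega H" by (rule set_funI)
  show thesis
  proof
    show "fun_on (lam omega H) omega" by (rule fun_on_lam[OF H])
    show "app (lam omega H) zero = a"
      using RH[OF zero_omega] by (auto simp: app_lam[OF H] R_def att_zero)
    fix n assume n: "n \<in> elts omega"
    obtain s where s: "att s (succ n)" "ap s (succ n) = H (succ n)"
      using RH[OF succ_omega[OF n]] by (auto simp: R_def)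
    then have "att s n" "H (succ n) = G (ap s n)" by (simp_all add: att_succ)
    moreover have "ap s n = H n"
      using \<open>att s n\<close> RH[OF n] uniq[OF n] unfolding R_def by metis
    ultimately show "app (lam omega H) (succ n) = G (app (lam omega H) n)"
      using n by (simp add: app_lam[OF H])
  qed
qed

section \<open>Finite sets of the model\<close>

definition adj :: "'v \<Rightarrow> 'v \<Rightarrow> 'v" where
  "adj a x = mk (insert a (elts x))"

lemma elts_adj [simp]: "elts (adj a x) = insert a (elts x)"
  by (simp add: adj_def elts_mk)

lemma dft_adj [df]: "dft S \<Longrightarrow> dft T \<Longrightarrow> dft (\<lambda>e. adj (S e) (T e))"
  by (rule dft2[where F = adj]) (unfold adj_def insert_compr, intro df)

text \<open>Finiteness in the sense of Kuratowski.\<close>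

definition fin :: "'v \<Rightarrow> bool" where
  "fin x \<longleftrightarrow> (\<forall>Y. zero \<in> elts Y \<and> (\<forall>y\<in>elts Y. \<forall>a\<in>elts x. adj a y \<in> elts Y) \<longrightarrow> x \<in> elts Y)"

lemma dfp_fin [df]: "dft S \<Longrightarrow> dfp (\<lambda>e. fin (S e))"
  by (rule dfp1[where P = fin]) (unfold fin_def, intro df)

lemma fin_induct [consumes 1, case_names defn zero adj]:
  assumes "fin x" "dfp (\<lambda>e. P (e 0))" "P zero"
    and "\<And>y a. elts y \<subseteq> elts x \<Longrightarrow> a \<in> elts x \<Longrightarrow> P y \<Longrightarrow> P (adj a y)"
  shows "P x"
proof -
  have "small {y. elts y \<subseteq> elts x \<and> P y}"
    by (rule small_Collect[OF small_Pow[OF small_elts[of x]]]) (intro df assms, auto)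
  note Y = elts_mk[OF this]
  have "x \<in> elts (mk {y. elts y \<subseteq> elts x \<and> P y})"
    using assms(1)[unfolded fin_def, rule_format, of "mk {y. elts y \<subseteq> elts x \<and> P y}"] assms(3,4)
    by (auto simp: Y)
  then show ?thesis by (simp add: Y)
qed

lemma fin_zero [simp]: "fin zero"
  by (simp add: fin_def)

lemma fin_adj [simp]: "fin x \<Longrightarrow> fin (adj a x)"
  unfolding fin_def by (metis elts_adj insertCI)

lemma adj_Un: "mk (elts x \<union> elts (adj a y)) = adj a (mk (elts x \<union> elts y))"
  by (rule elts_inject) (simp add: elts_mk)

lemma dft_Un [df]: "dft S \<Longrightarrow> dft T \<Longrightarrow> dft (\<lambda>e. mk (elts (S e) \<union> elts (T e)))"
  unfolding Un_def by (rule dft2[where F = "\<lambda>x y. mk {z. z \<in> elts x \<or> z \<in> elts y}"]) (intro df)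

lemma fin_Un:
  assumes "fin x" "fin y"
  shows "fin (mk (elts x \<union> elts y))"
  using assms(2)
proof (rule fin_induct)
  show "fin (mk (elts x \<union> elts zero))" using assms(1) by simp
  show "fin (mk (elts x \<union> elts (adj a y)))" if "fin (mk (elts x \<union> elts y))" for a y
    unfolding adj_Un using that by simp
qed (intro df)

text \<open>A finite union of finite sets, phrased with finite covers: this avoids both a choice of
  one finite set for each element and the question whether subsets of finite sets are
  finite.\<close>

lemma fin_UN:
  assumes "fin d" "dfp (\<lambda>e. Q (e 0) (e 1))"
    and "\<And>x. x \<in> elts d \<Longrightarrow> \<exists>u. fin u \<and> (\<forall>y. Q x y \<longrightarrow> y \<in> elts u)"
  shows "\<exists>u. fin u \<and> (\<forall>x\<in>elts d. \<forall>y. Q x y \<longrightarrow> y \<in> elts u)"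
  using assms(1)
proof (rule fin_induct)
  note Q = dfp2[where P = Q, OF assms(2)]
  show "dfp (\<lambda>e. \<exists>u. fin u \<and> (\<forall>x\<in>elts (e 0). \<forall>y. Q x y \<longrightarrow> y \<in> elts u))"
    by (intro df Q)
  show "\<exists>u. fin u \<and> (\<forall>x\<in>elts zero. \<forall>y. Q x y \<longrightarrow> y \<in> elts u)"
    by (rule exI[of _ zero]) simp
  fix z a
  assume a: "a \<in> elts d" and "\<exists>u. fin u \<and> (\<forall>x\<in>elts z. \<forall>y. Q x y \<longrightarrow> y \<in> elts u)"
  then obtain u where u: "fin u" "\<forall>x\<in>elts z. \<forall>y. Q x y \<longrightarrow> y \<in> elts u" by auto
  obtain v where v: "fin v" "\<forall>y. Q a y \<longrightarrow> y \<in> elts v" using assms(3)[OF a] by auto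
  show "\<exists>u. fin u \<and> (\<forall>x\<in>elts (adj a z). \<forall>y. Q x y \<longrightarrow> y \<in> elts u)"
    by (rule exI[of _ "mk (elts u \<union> elts v)"]) (use u v in \<open>auto simp: elts_mk fin_Un\<close>)
qed

lemma fin_range:
  assumes "n \<in> elts omega" "fun_on f n"
  shows "\<exists>x. fin x \<and> (\<forall>k\<in>elts n. app f k \<in> elts x)"
proof -
  have "\<forall>f. fun_on f n \<longrightarrow> (\<exists>x. fin x \<and> (\<forall>k\<in>elts n. ap f k \<in> elts x))"
    using assms(1)
  proof (rule omega_induct)
    fix n
    assume IH: "\<forall>f. fun_on f n \<longrightarrow> (\<exists>x. fin x \<and> (\<forall>k\<in>elts n. ap f k \<in> elts x))"
    show "\<forall>f. fun_on f (succ n) \<longrightarrow> (\<exists>x. fin x \<and> (\<forall>k\<in>elts (succ n). ap f k \<in> elts x))"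
    proof (intro allI impI)
      fix f assume f: "fun_on f (succ n)"
      obtain g where g: "fun_on g n" "\<And>k. k \<in> elts n \<Longrightarrow> app g k = app f k"
        using fun_restrict[OF f] by blast
      obtain x where x: "fin x" "\<forall>k\<in>elts n. ap g k \<in> elts x" using IH g(1) by auto
      show "\<exists>x. fin x \<and> (\<forall>k\<in>elts (succ n). ap f k \<in> elts x)"
        by (rule exI[of _ "adj (ap f n) x"])
          (use x g f in \<open>auto simp flip: app_eq_ap[OF fun_on_func]\<close>)
    qed
  qed (intro df, metis elts_zero empty_iff fin_zero)
  then show ?thesis using assms(2) by (simp add: app_eq_ap[OF fun_on_func])
qed

text \<open>Turns Kuratowski finiteness into an enumeration, possibly with repetitions, which is
  what a tuple of literals is made from.\<close>

lemma fin_enum: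
  assumes "fin x"
  obtains n f where "n \<in> elts omega" "fun_on f n" "elts x = app f ` elts n"
proof -
  have "\<exists>n\<in>elts omega. \<exists>f. fun_on f n \<and> (\<forall>y. y \<in> elts x \<longleftrightarrow> (\<exists>k\<in>elts n. y = ap f k))"
    using assms
  proof (rule fin_induct)
    show "\<exists>n\<in>elts omega. \<exists>f. fun_on f n \<and> (\<forall>y. y \<in> elts zero \<longleftrightarrow> (\<exists>k\<in>elts n. y = ap f k))"
      using fun_empty by (intro bexI[of _ zero]) auto
    fix z a assume "\<exists>n\<in>elts omega. \<exists>f. fun_on f n \<and> (\<forall>y. y \<in> elts z \<longleftrightarrow> (\<exists>k\<in>elts n. y = ap f k))"
    then obtain n f where f: "n \<in> elts omega" "fun_on f n" "\<forall>y. y \<in> elts z \<longleftrightarrow> (\<exists>k\<in>elts n. y = ap f k)"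
      by auto
    obtain g where g: "fun_on g (succ n)" "app g n = a" "\<And>k. k \<in> elts n \<Longrightarrow> app g k = app f k"
      using fun_extend[OF f(2)] by metis
    show "\<exists>n\<in>elts omega. \<exists>f. fun_on f n \<and> (\<forall>y. y \<in> elts (adj a z) \<longleftrightarrow> (\<exists>k\<in>elts n. y = ap f k))"
      by (intro bexI[of _ "succ n"] exI[of _ g])
        (use f g in \<open>auto simp flip: app_eq_ap[OF fun_on_func]\<close>)
  qed (intro df)
  then obtain n f where "n \<in> elts omega" "fun_on f n" "\<forall>y. y \<in> elts x \<longleftrightarrow> (\<exists>k\<in>elts n. y = ap f k)"
    by auto
  then show thesis by (intro that[of n f]) (auto simp: app_eq_ap[OF fun_on_func])
qed

lemma lam_comp:
  assumes "maps g a b" "maps t n a"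
  shows "set_fun n (\<lambda>k. app g (app t k))" "maps (lam n (\<lambda>k. app g (app t k))) n b"
proof -
  show s: "set_fun n (\<lambda>k. app g (app t k))"
    by (intro set_funI dft_app df maps_func[OF assms(1)] maps_func[OF assms(2)])
  show "maps (lam n (\<lambda>k. app g (app t k))) n b"
    by (rule maps_lam[OF s]) (intro maps_app[OF assms(1)] maps_app[OF assms(2)])
qed

text \<open>\<open>k\<close> is an assignment and \<open>v\<close> a numbering by variables such
  that every element of the finite set is named correctly. Elements outside of it still get some
  number, so both maps are total.\<close>

lemma fin_cover:
  assumes "fin S" and D: "elts D \<noteq> {}"
  obtains k v where "maps k omega D" "maps v D omega" "\<And>x. x \<in> elts S \<Longrightarrow> x \<in> elts D \<Longrightarrow> app k (app v x) = x"
proof -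
  obtain c where c: "c \<in> elts D" using D by blast
  have "\<exists>k v. maps k omega D \<and> maps v D omega \<and> (\<forall>x\<in>elts S. x \<in> elts D \<longrightarrow> ap k (ap v x) = x)"
    using assms(1)
  proof (rule fin_induct)
    have "set_fun omega (\<lambda>_. c)" "set_fun D (\<lambda>_. zero)" by (intro set_funI df)+
    then have "maps (lam omega (\<lambda>_. c)) omega D" "maps (lam D (\<lambda>_. zero)) D omega"
      using c by (auto intro: maps_lam)
    then show "\<exists>k v. maps k omega D \<and> maps v D omega \<and> (\<forall>x\<in>elts zero. x \<in> elts D \<longrightarrow> ap k (ap v x) = x)"
      by auto
    fix y a assume "\<exists>k v. maps k omega D \<and> maps v D omega \<and> (\<forall>x\<in>elts y. x \<in> elts D \<longrightarrow> ap k (ap v x) = x)"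
    then obtain k v where kv: "maps k omega D" "maps v D omega"
      "\<And>x. x \<in> elts y \<Longrightarrow> x \<in> elts D \<Longrightarrow> ap k (ap v x) = x" by blast
    show "\<exists>k v. maps k omega D \<and> maps v D omega \<and> (\<forall>x\<in>elts (adj a y). x \<in> elts D \<longrightarrow> ap k (ap v x) = x)"
    proof (cases "a \<in> elts D")
      case False
      then show ?thesis using kv by (intro exI[of _ k] exI[of _ v]) auto
    next
      case True
      \<comment> \<open>The new element takes variable zero and all other numbers move up by one;
        \<open>pred\<close> undoes this shift.\<close>
      let ?k = "\<lambda>n. if n = zero then a else app k (pred n)"
      let ?v = "\<lambda>x. if x = a then zero else succ (app v x)"
      have k: "set_fun omega ?k" and v: "set_fun D ?v"
        by (intro set_funI df dft_app maps_func[OF kv(1)] maps_func[OF kv(2)])+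
      have mk: "maps (lam omega ?k) omega D"
      proof (rule maps_lam[OF k])
        show "?k n \<in> elts D" if "n \<in> elts omega" for n
          using that by (cases rule: omega_cases) (auto simp: True maps_app[OF kv(1)])
      qed
      have mv: "maps (lam D ?v) D omega"
        by (rule maps_lam[OF v]) (simp add: maps_app[OF kv(2)])
      have "ap (lam omega ?k) (ap (lam D ?v) x) = x" if x: "x \<in> elts (adj a y)" "x \<in> elts D" for x
      proof -
        have vx: "app v x \<in> elts omega" by (rule maps_app[OF kv(2) x(2)])
        have "app (lam omega ?k) (app (lam D ?v) x) = x"
        proof (cases "x = a")
          case True
          then show ?thesis using x(2) by (simp add: app_lam[OF v] app_lam[OF k])
        next
          case False
          then have "app k (app v x) = x"
            using kv(3)[of x] x by (simp add: app_eq_ap[OF maps_func[OF kv(1)]] app_eq_ap[OF maps_func[OF kv(2)]])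
          then show ?thesis using x(2) False vx by (simp add: app_lam[OF v] app_lam[OF k])
        qed
        then show ?thesis by (simp add: app_eq_ap[OF maps_func[OF mk]] app_eq_ap[OF maps_func[OF mv]])
      qed
      then show ?thesis using mk mv by blast
    qed
  qed (intro df)
  then obtain k v where "maps k omega D" "maps v D omega" "\<forall>x\<in>elts S. x \<in> elts D \<longrightarrow> ap k (ap v x) = x"
    by blast
  then show thesis
    using that[of k v] by (simp add: app_eq_ap[OF maps_func])
qed

definition pairs :: "'v set \<Rightarrow> 'v set \<Rightarrow> 'v set" where
  "pairs X Y = {pair x y |x y. x \<in> X \<and> y \<in> Y}"

lemma pair_mem_pairs [simp]: "pair x y \<in> pairs X Y \<longleftrightarrow> x \<in> X \<and> y \<in> Y"
  by (auto simp: pairs_def)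

lemma small_pairs: "small X \<Longrightarrow> small Y \<Longrightarrow> small (pairs X Y)"
  unfolding pairs_def by (rule small_Times)

lemma fun_subset_pairs:
  assumes "fun_on f a" "elts a \<subseteq> X" "\<And>x. x \<in> elts a \<Longrightarrow> app f x \<in> Y"
  shows "elts f \<subseteq> pairs X Y"
proof
  fix p assume "p \<in> elts f"
  then obtain x where "x \<in> elts a" "p = pair x (app f x)" using fun_on_mem[OF assms(1)] by blast
  then show "p \<in> pairs X Y" using assms(2,3) by auto
qed

lemma tuple_subset_pairs:
  "maps t n b \<Longrightarrow> n \<in> elts omega \<Longrightarrow> elts b \<subseteq> Y \<Longrightarrow> elts t \<subseteq> pairs (elts omega) Y"
  by (rule fun_subset_pairs[OF maps_fun_on omega_subset]) (auto dest: maps_app)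

end

section \<open>Terms and their values\<close>

locale signature = ZF mem for mem :: "'v \<Rightarrow> 'v \<Rightarrow> bool" +
  fixes Sg :: 'v
  assumes signature: "is_signature Sg"
begin

lemma maps_arity:
  "maps (snd_of (snd_of Sg)) (mk (elts (rel_syms Sg) \<union> elts (fun_syms Sg))) omega"
  using signature unfolding is_signature_def rel_syms_def fun_syms_def triple_def by auto

lemma arity_omega:
  "s \<in> elts (rel_syms Sg) \<Longrightarrow> arity Sg s \<in> elts omega"
  "s \<in> elts (fun_syms Sg) \<Longrightarrow> arity Sg s \<in> elts omega"
  using maps_app[OF maps_arity] by (simp_all add: arity_def elts_mk)

lemma dft_arity [df]: "dft S \<Longrightarrow> dft (\<lambda>e. arity Sg (S e))"
  unfolding arity_def by (intro dft_app maps_func[OF maps_arity])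

lemma dft_var_term [df]: "dft S \<Longrightarrow> dft (\<lambda>e. var (S e))"
  unfolding var_def by (intro df)

lemma dft_fapp [df]: "dft S \<Longrightarrow> dft T \<Longrightarrow> dft (\<lambda>e. fapp (S e) (T e))"
  unfolding fapp_def by (intro df)

lemma term_inject [simp]:
  "var n = var m \<longleftrightarrow> n = m"
  "fapp f ts = fapp f' ts' \<longleftrightarrow> f = f' \<and> ts = ts'"
  "var n \<noteq> fapp f ts" "fapp f ts \<noteq> var n"
  by (auto simp: var_def fapp_def)

definition closed_over :: "'v \<Rightarrow> 'v \<Rightarrow> bool" where
  "closed_over V X \<longleftrightarrow> (\<forall>n \<in> elts V. var n \<in> elts X) \<and>
     (\<forall>f \<in> elts (fun_syms Sg). \<forall>ts. maps ts (arity Sg f) X \<longrightarrow> fapp f ts \<in> elts X)"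

text \<open>Restricting the variables to \<open>V\<close> makes it possible to speak of terms in
  finitely many variables, the only ones whose values can be computed from chosen representatives of
  classes.\<close>

definition terms_over :: "'v \<Rightarrow> 'v" where
  "terms_over V = mk {t. \<forall>X. closed_over V X \<longrightarrow> t \<in> elts X}"

lemma terms_eq: "terms Sg = terms_over omega"
  by (simp add: terms_def terms_over_def term_closed_def closed_over_def)

lemma dft_terms_over [df]: "dft S \<Longrightarrow> dft (\<lambda>e. terms_over (S e))"
  by (rule dft1[where F = terms_over]) (unfold terms_over_def closed_over_def, intro df)

text \<open>Without some closed set, the intersection that defines the terms would not be known to
  be a set. The terms are built in \<open>omega\<close> stages; the union is closed because the
  arguments of a compound term are finitely many and so have all appeared at a common stage.\<close>

lemma ex_closed_over: "\<exists>X. closed_over omega X"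
proof -
  define G where "G X = mk {t. t \<in> elts X \<or>
    (\<exists>f\<in>elts (fun_syms Sg). \<exists>ts. maps ts (arity Sg f) X \<and> t = fapp f ts)}" for X
  have "small {t. t \<in> elts X \<or>
    (\<exists>f\<in>elts (fun_syms Sg). \<exists>ts. maps ts (arity Sg f) X \<and> t = fapp f ts)}" for X
  proof (rule small_Collect)
    \<comment> \<open>Arities are subsets of \<open>omega\<close>, so every argument tuple is a set
      of pairs over \<open>omega\<close> and \<open>X\<close>, and all tuples lie in one power
      set.\<close>
    define Y where "Y = {pair n x |n x. n \<in> elts omega \<and> x \<in> elts X}"
    have "small {q. elts q \<subseteq> Y}"
      unfolding Y_def by (intro small_Pow small_Times small_elts)
    then show "small (elts X \<union> {pair u v |u v. u \<in> {one} \<and>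
        v \<in> {pair f ts |f ts. f \<in> elts (fun_syms Sg) \<and> ts \<in> {q. elts q \<subseteq> Y}}})"
      by (intro small_Un small_Times small_elts small_insert small_empty)
    have "elts ts \<subseteq> Y" if ts: "maps ts (arity Sg f) X" and f: "f \<in> elts (fun_syms Sg)" for ts f
    proof
      fix p assume "p \<in> elts ts"
      then obtain k where "k \<in> elts (arity Sg f)" "p = pair k (app ts k)"
        using fun_on_mem[OF maps_fun_on[OF ts]] by auto
      then show "p \<in> Y"
        unfolding Y_def using maps_app[OF ts] omega_trans[OF arity_omega(2)[OF f]] by auto
    qed
    then show "t \<in> elts X \<union> {pair u v |u v. u \<in> {one} \<and>
        v \<in> {pair f ts |f ts. f \<in> elts (fun_syms Sg) \<and> ts \<in> {q. elts q \<subseteq> Y}}}"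
      if "t \<in> elts X \<or> (\<exists>f\<in>elts (fun_syms Sg). \<exists>ts. maps ts (arity Sg f) X \<and> t = fapp f ts)" for t
      using that unfolding fapp_def by blast
  qed (intro df)
  then have G: "t \<in> elts (G X) \<longleftrightarrow> t \<in> elts X \<or>
    (\<exists>f\<in>elts (fun_syms Sg). \<exists>ts. maps ts (arity Sg f) X \<and> t = fapp f ts)" for t X
    unfolding G_def by (simp add: elts_mk)
  have "dft (\<lambda>e. G (e 0))"
    unfolding G_def by (intro df)
  then obtain S where S: "fun_on S omega" "app S zero = mk (var ` elts omega)"
    "\<And>n. n \<in> elts omega \<Longrightarrow> app S (succ n) = G (app S n)"
    using omega_recursion[of G "mk (var ` elts omega)"] by blast
  have vars: "small (var ` elts omega)"
    by (intro small_image small_elts df)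
  have mono: "elts m \<subseteq> elts n \<longrightarrow> elts (app S m) \<subseteq> elts (app S n)"
    if "m \<in> elts omega" "n \<in> elts omega" for m n
    using that(2)
  proof (rule omega_induct)
    show "dfp (\<lambda>e. elts m \<subseteq> elts (e 0) \<longrightarrow> elts (app S m) \<subseteq> elts (app S (e 0)))"
      by (intro df dft_app fun_on_func[OF S(1)])
    show "elts m \<subseteq> elts zero \<longrightarrow> elts (app S m) \<subseteq> elts (app S zero)"
      by (simp flip: zero_iff)
    fix n assume n: "n \<in> elts omega" and IH: "elts m \<subseteq> elts n \<longrightarrow> elts (app S m) \<subseteq> elts (app S n)"
    show "elts m \<subseteq> elts (succ n) \<longrightarrow> elts (app S m) \<subseteq> elts (app S (succ n))"
    proof
      assume sub: "elts m \<subseteq> elts (succ n)"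
      show "elts (app S m) \<subseteq> elts (app S (succ n))"
      proof (cases "n \<in> elts m")
        case True
        then have "m = succ n"
          using sub omega_elts_trans[OF that(1) True] by (intro elts_inject) auto
        then show ?thesis by simp
      next
        case False
        then have "elts (app S m) \<subseteq> elts (app S n)" using sub IH by auto
        then show ?thesis unfolding S(3)[OF n] using G by blast
      qed
    qed
  qed
  define X where "X = mk (\<Union>n\<in>elts omega. elts (app S n))"
  have X: "elts X = (\<Union>n\<in>elts omega. elts (app S n))"
    unfolding X_def by (intro elts_mk small_UN small_elts dft_app fun_on_func[OF S(1)] df)
  have "closed_over omega X"
    unfolding closed_over_def
  proof (intro conjI ballI allI impI)
    fix n assume "n \<in> elts omega"
    then show "var n \<in> elts X"
      unfolding X using S(2) vars by (intro UN_I[OF zero_omega]) (simp add: elts_mk)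
  next
    fix f ts assume f: "f \<in> elts (fun_syms Sg)" and ts: "maps ts (arity Sg f) X"
    obtain N where N: "N \<in> elts omega" "\<And>k. k \<in> elts (arity Sg f) \<Longrightarrow> app ts k \<in> elts (app S N)"
    proof (rule finite_bound[OF arity_omega(2)[OF f], of "\<lambda>k N. app ts k \<in> elts (app S N)"])
      show "dfp (\<lambda>e. app ts (e 0) \<in> elts (app S (e 1)))"
        by (intro df dft_app maps_func[OF ts] fun_on_func[OF S(1)])
      show "\<exists>N\<in>elts omega. app ts k \<in> elts (app S N)" if "k \<in> elts (arity Sg f)" for k
        using maps_app[OF ts that] X by auto
      show "app ts k \<in> elts (app S M)" if "app ts k \<in> elts (app S N)" "N \<in> elts omega"
        "M \<in> elts omega" "elts N \<subseteq> elts M" for k N M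
        using that mono[of N M] by blast
    qed auto
    then have "fapp f ts \<in> elts (app S (succ N))"
      unfolding S(3)[OF N(1)] G using f ts by (auto simp: maps_def)
    then show "fapp f ts \<in> elts X"
      unfolding X using N(1) by (auto intro!: succ_omega)
  qed
  then show ?thesis ..
qed

lemma elts_terms_over:
  assumes "elts V \<subseteq> elts omega"
  shows "elts (terms_over V) = {t. \<forall>X. closed_over V X \<longrightarrow> t \<in> elts X}"
proof -
  obtain X where X: "closed_over omega X" using ex_closed_over ..
  then have "closed_over V X" using assms by (auto simp: closed_over_def)
  then show ?thesis
    unfolding terms_over_def
    by (intro elts_mk small_Collect[OF small_elts[of X]]) (unfold closed_over_def, intro df, auto)
qed

lemma terms_over_var: "elts V \<subseteq> elts omega \<Longrightarrow> n \<in> elts V \<Longrightarrow> var n \<in> elts (terms_over V)"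
  by (simp add: elts_terms_over closed_over_def)

lemma terms_over_fapp:
  assumes "elts V \<subseteq> elts omega" "f \<in> elts (fun_syms Sg)" "maps ts (arity Sg f) (terms_over V)"
  shows "fapp f ts \<in> elts (terms_over V)"
proof -
  have "fapp f ts \<in> elts X" if X: "closed_over V X" for X
  proof -
    have "elts (terms_over V) \<subseteq> elts X" using X by (auto simp: elts_terms_over[OF assms(1)])
    from maps_mono[OF assms(3) this] show ?thesis
      using X assms(2) by (auto simp: closed_over_def)
  qed
  then show ?thesis by (simp add: elts_terms_over[OF assms(1)])
qed

lemma terms_over_induct [consumes 2, case_names defn var fapp]:
  assumes "t \<in> elts (terms_over V)" "elts V \<subseteq> elts omega" "dfp (\<lambda>e. P (e 0))"
    and var: "\<And>n. n \<in> elts V \<Longrightarrow> P (var n)"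
    and fapp: "\<And>f ts. f \<in> elts (fun_syms Sg) \<Longrightarrow> maps ts (arity Sg f) (terms_over V) \<Longrightarrow>
      (\<And>k. k \<in> elts (arity Sg f) \<Longrightarrow> P (app ts k)) \<Longrightarrow> P (fapp f ts)"
  shows "P t"
proof -
  define X where "X = mk {t \<in> elts (terms_over V). P t}"
  have X: "elts X = {t \<in> elts (terms_over V). P t}"
    unfolding X_def by (intro elts_mk small_sep assms(3))
  have "closed_over V X"
    unfolding closed_over_def
  proof (intro conjI ballI allI impI)
    fix f ts assume f: "f \<in> elts (fun_syms Sg)" and ts: "maps ts (arity Sg f) X"
    have "maps ts (arity Sg f) (terms_over V)"
      using ts by (rule maps_mono) (auto simp: X)
    then show "fapp f ts \<in> elts X"
      using maps_app[OF ts] by (auto simp: X intro!: terms_over_fapp assms(2) f fapp)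
  qed (auto simp: X var intro: terms_over_var[OF assms(2)])
  then show ?thesis
    using assms(1) X elts_terms_over[OF assms(2)] by auto
qed

lemma terms_over_mono:
  assumes "elts V \<subseteq> elts W" "elts W \<subseteq> elts omega"
  shows "elts (terms_over V) \<subseteq> elts (terms_over W)"
proof -
  have "closed_over V X" if "closed_over W X" for X
    using that assms by (auto simp: closed_over_def)
  then show ?thesis using assms by (auto simp: elts_terms_over)
qed

lemma terms_over_omega: "elts V \<subseteq> elts omega \<Longrightarrow> t \<in> elts (terms_over V) \<Longrightarrow> t \<in> elts (terms Sg)"
  unfolding terms_eq using terms_over_mono by blast

lemma terms_var: "n \<in> elts omega \<Longrightarrow> var n \<in> elts (terms Sg)"
  unfolding terms_eq by (rule terms_over_var) simp

lemma terms_fapp: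
  "f \<in> elts (fun_syms Sg) \<Longrightarrow> maps ts (arity Sg f) (terms Sg) \<Longrightarrow> fapp f ts \<in> elts (terms Sg)"
  unfolding terms_eq by (rule terms_over_fapp) simp

lemmas terms_induct [consumes 1, case_names defn var fapp] =
  terms_over_induct[where V = omega, folded terms_eq, OF _ order_refl]

text \<open>By induction on the term: the bounds for its arguments are combined by
  \<open>finite_bound\<close>, as arities are natural numbers of the model.\<close>

lemma terms_bounded:
  assumes "t \<in> elts (terms Sg)"
  shows "\<exists>N\<in>elts omega. t \<in> elts (terms_over N)"
  using assms
proof (rule terms_induct)
  fix n assume n: "n \<in> elts omega"
  then show "\<exists>N\<in>elts omega. var n \<in> elts (terms_over N)"
    by (intro bexI[of _ "succ n"] terms_over_var omega_subset) auto
next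
  fix f ts assume f: "f \<in> elts (fun_syms Sg)" and ts: "maps ts (arity Sg f) (terms Sg)"
    and IH: "\<And>k. k \<in> elts (arity Sg f) \<Longrightarrow> \<exists>N\<in>elts omega. app ts k \<in> elts (terms_over N)"
  obtain N where N: "N \<in> elts omega" "\<And>k. k \<in> elts (arity Sg f) \<Longrightarrow> app ts k \<in> elts (terms_over N)"
  proof (rule finite_bound[OF arity_omega(2)[OF f], of "\<lambda>k N. app ts k \<in> elts (terms_over N)"])
    show "dfp (\<lambda>e. app ts (e 0) \<in> elts (terms_over (e 1)))"
      by (intro df dft_app maps_func[OF ts])
    show "\<exists>N\<in>elts omega. app ts k \<in> elts (terms_over N)" if "k \<in> elts (arity Sg f)" for k
      using IH[OF that] .
    show "app ts k \<in> elts (terms_over M)"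
      if "app ts k \<in> elts (terms_over N)" "N \<in> elts omega" "M \<in> elts omega" "elts N \<subseteq> elts M" for k N M
      using that terms_over_mono omega_subset by blast
  qed auto
  then show "\<exists>N\<in>elts omega. fapp f ts \<in> elts (terms_over N)"
    using ts by (intro bexI[OF terms_over_fapp N(1)] f omega_subset) (auto simp: maps_def)
qed (intro df)

end

section \<open>Structures, evaluation of terms, homomorphisms\<close>

context ZF
begin

lemma triple_inject [simp]: "triple x y z = triple x' y' z' \<longleftrightarrow> x = x' \<and> y = y' \<and> z = z'"
  by (simp add: triple_def)

lemma fst_snd_triple [simp]:
  "fst_of (triple x y z) = x" "fst_of (snd_of (triple x y z)) = y" "snd_of (snd_of (triple x y z)) = z"
  by (simp_all add: triple_def)

lemma carrier_triple [simp]: "carrier (triple D RI FI) = D"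
  by (simp add: carrier_def)

lemma dft_carrier [df]: "dft S \<Longrightarrow> dft (\<lambda>e. carrier (S e))"
  unfolding carrier_def by (intro df)

lemma is_structure_iff:
  "is_structure Sg A \<longleftrightarrow> A = triple (carrier A) (fst_of (snd_of A)) (snd_of (snd_of A)) \<and>
     elts (carrier A) \<noteq> {} \<and>
     fun_on (fst_of (snd_of A)) (rel_syms Sg) \<and>
     (\<forall>r \<in> elts (rel_syms Sg). elts (rel_int A r) \<subseteq> elts (tuples (carrier A) (arity Sg r))) \<and>
     fun_on (snd_of (snd_of A)) (fun_syms Sg) \<and>
     (\<forall>f \<in> elts (fun_syms Sg). maps (fun_int A f) (tuples (carrier A) (arity Sg f)) (carrier A))"
  (is "_ \<longleftrightarrow> ?R")
proof
  assume "is_structure Sg A"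
  then show ?R
    unfolding is_structure_def by (elim exE conjE) (simp add: rel_int_def fun_int_def)
next
  assume ?R
  then show "is_structure Sg A"
    unfolding is_structure_def rel_int_def fun_int_def
    by (intro exI[of _ "carrier A"] exI[of _ "fst_of (snd_of A)"] exI[of _ "snd_of (snd_of A)"]) auto
qed

lemma elts_carrier_nonempty: "is_structure Sg A \<Longrightarrow> elts (carrier A) \<noteq> {}"
  by (simp add: is_structure_iff)

lemma rel_int_maps:
  "is_structure Sg A \<Longrightarrow> r \<in> elts (rel_syms Sg) \<Longrightarrow> t \<in> elts (rel_int A r) \<Longrightarrow>
    maps t (arity Sg r) (carrier A)"
  by (auto simp: is_structure_iff elts_tuples)

lemma fun_int_maps:
  "is_structure Sg A \<Longrightarrow> f \<in> elts (fun_syms Sg) \<Longrightarrow>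
    maps (fun_int A f) (tuples (carrier A) (arity Sg f)) (carrier A)"
  by (auto simp: is_structure_iff)

lemma fun_int_closed:
  "is_structure Sg A \<Longrightarrow> f \<in> elts (fun_syms Sg) \<Longrightarrow> maps t (arity Sg f) (carrier A) \<Longrightarrow>
    app (fun_int A f) t \<in> elts (carrier A)"
  using maps_app[OF fun_int_maps] by (simp add: elts_tuples)

lemma rel_int_ap: "is_structure Sg A \<Longrightarrow> rel_int A r = ap (fst_of (snd_of A)) r"
  unfolding rel_int_def by (rule app_eq_ap) (auto simp: is_structure_iff intro: fun_on_func)

lemma fun_int_ap: "is_structure Sg A \<Longrightarrow> fun_int A f = ap (snd_of (snd_of A)) f"
  unfolding fun_int_def by (rule app_eq_ap) (auto simp: is_structure_iff intro: fun_on_func)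

lemma app_fun_int_ap:
  "is_structure Sg A \<Longrightarrow> f \<in> elts (fun_syms Sg) \<Longrightarrow>
    app (fun_int A f) t = ap (ap (snd_of (snd_of A)) f) t"
  using app_eq_ap[OF maps_func[OF fun_int_maps]] fun_int_ap by metis

lemma is_structure_triple:
  assumes "elts D \<noteq> {}" "set_fun (rel_syms Sg) RR" "set_fun (fun_syms Sg) FF"
    and "\<And>r t. r \<in> elts (rel_syms Sg) \<Longrightarrow> t \<in> elts (RR r) \<Longrightarrow> maps t (arity Sg r) D"
    and "\<And>f. f \<in> elts (fun_syms Sg) \<Longrightarrow> maps (FF f) (tuples D (arity Sg f)) D"
  shows "is_structure Sg (triple D (lam (rel_syms Sg) RR) (lam (fun_syms Sg) FF))"
  using assms unfolding is_structure_iff rel_int_def fun_int_def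
  by (auto simp: app_lam fun_on_lam elts_tuples)

lemma rel_int_triple [simp]:
  "set_fun R RR \<Longrightarrow> r \<in> elts R \<Longrightarrow> rel_int (triple D (lam R RR) FI) r = RR r"
  by (simp add: rel_int_def app_lam)

lemma fun_int_triple [simp]:
  "set_fun F FF \<Longrightarrow> f \<in> elts F \<Longrightarrow> fun_int (triple D RI (lam F FF)) f = FF f"
  by (simp add: fun_int_def app_lam)

end

context signature
begin

text \<open>In place of a recursion along terms, the graph of the evaluation is obtained as the
  least set of pairs that contains the values of the variables and is closed under the function
  symbols. Induction on terms shows that it is single-valued and total.\<close>

lemma ex_evaluation:
  assumes A: "is_structure Sg A" and h: "maps h omega (carrier A)"
  shows "\<exists>ev. is_evaluation Sg A h ev"
proof -
  let ?fi = "\<lambda>f t. ap (ap (snd_of (snd_of A)) f) t"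
  note fi = app_fun_int_ap[OF A]
  define closed where "closed E \<longleftrightarrow> (\<forall>n\<in>elts omega. pair (var n) (app h n) \<in> elts E) \<and>
    (\<forall>f\<in>elts (fun_syms Sg). \<forall>ts vs. maps ts (arity Sg f) (terms Sg) \<and> maps vs (arity Sg f) (carrier A) \<and>
       (\<forall>k\<in>elts (arity Sg f). pair (ap ts k) (ap vs k) \<in> elts E) \<longrightarrow>
       pair (fapp f ts) (?fi f vs) \<in> elts E)" for E
  define TA where "TA = {pair t v |t v. t \<in> elts (terms Sg) \<and> v \<in> elts (carrier A)}"
  have TA: "small TA" unfolding TA_def by (intro small_Times small_elts)
  have "closed (mk TA)"
    unfolding closed_def elts_mk[OF TA]
    using terms_var terms_fapp maps_app[OF h] fun_int_closed[OF A] by (auto simp: TA_def simp flip: fi)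
  have "small {p. \<forall>E. closed E \<longrightarrow> p \<in> elts E}"
  proof (rule small_Collect[OF TA])
    show "dfp (\<lambda>e. \<forall>E. closed E \<longrightarrow> e 0 \<in> elts E)"
      unfolding closed_def by (intro df dft_app maps_func[OF h])
    show "p \<in> TA" if "\<forall>E. closed E \<longrightarrow> p \<in> elts E" for p
      using that \<open>closed (mk TA)\<close> elts_mk[OF TA] by blast
  qed
  then obtain E where E: "elts E = {p. \<forall>E. closed E \<longrightarrow> p \<in> elts E}"
    by (auto simp: small_def)
  have closed_E: "closed E"
  proof -
    have "pair (fapp f ts) (?fi f vs) \<in> elts E"
      if f: "f \<in> elts (fun_syms Sg)" "maps ts (arity Sg f) (terms Sg)" "maps vs (arity Sg f) (carrier A)"
        and k: "\<forall>k\<in>elts (arity Sg f). pair (ap ts k) (ap vs k) \<in> elts E" for f ts vs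
    proof -
      have "pair (fapp f ts) (?fi f vs) \<in> elts E'" if E': "closed E'" for E'
      proof -
        have "\<forall>k\<in>elts (arity Sg f). pair (ap ts k) (ap vs k) \<in> elts E'"
          using k E E' by auto
        then show ?thesis using E' f unfolding closed_def by blast
      qed
      then show ?thesis by (simp add: E)
    qed
    moreover have "pair (var n) (app h n) \<in> elts E" if "n \<in> elts omega" for n
      using that by (simp add: E closed_def)
    ultimately show ?thesis unfolding closed_def by blast
  qed
  \<comment> \<open>Inversion for the least closed set: a pair that is neither the value of a
    variable nor the result of a function step could be removed from \<open>E\<close>.\<close>
  have minimal: "p \<notin> elts E"
    if p: "\<And>n. n \<in> elts omega \<Longrightarrow> p \<noteq> pair (var n) (app h n)"
      "\<And>f ts vs. f \<in> elts (fun_syms Sg) \<Longrightarrow> maps ts (arity Sg f) (terms Sg) \<Longrightarrow>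
        maps vs (arity Sg f) (carrier A) \<Longrightarrow>
        (\<And>k. k \<in> elts (arity Sg f) \<Longrightarrow> pair (app ts k) (app vs k) \<in> elts E) \<Longrightarrow>
        p \<noteq> pair (fapp f ts) (?fi f vs)" for p
  proof -
    have "small {q \<in> elts E. q \<noteq> p}"
      by (intro small_sep df)
    note E' = elts_mk[OF this]
    have "closed (mk {q \<in> elts E. q \<noteq> p})"
      unfolding closed_def E'
    proof (intro conjI ballI allI impI CollectI)
      fix n assume "n \<in> elts omega"
      then show "pair (var n) (app h n) \<in> elts E" "pair (var n) (app h n) \<noteq> p"
        using closed_E p(1) unfolding closed_def by auto
    next
      fix f ts vs
      assume f: "f \<in> elts (fun_syms Sg)" and *: "maps ts (arity Sg f) (terms Sg) \<and>
        maps vs (arity Sg f) (carrier A) \<and>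
        (\<forall>k\<in>elts (arity Sg f). pair (ap ts k) (ap vs k) \<in> {q \<in> elts E. q \<noteq> p})"
      show "pair (fapp f ts) (?fi f vs) \<in> elts E"
        using closed_E f * unfolding closed_def by blast
      have "pair (app ts k) (app vs k) \<in> elts E" if "k \<in> elts (arity Sg f)" for k
        using * that app_eq_ap[OF maps_func, of ts _ _ k] app_eq_ap[OF maps_func, of vs _ _ k] by auto
      then show "pair (fapp f ts) (?fi f vs) \<noteq> p"
        using p(2)[OF f] * by metis
    qed
    then have "p \<in> elts E \<Longrightarrow> p \<in> {q \<in> elts E. q \<noteq> p}"
      using E E' by blast
    then show ?thesis by auto
  qed
  have sub: "p \<in> TA" if "p \<in> elts E" for p
    using that \<open>closed (mk TA)\<close> E elts_mk[OF TA] by auto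
  have sub_pair: "t \<in> elts (terms Sg)" "v \<in> elts (carrier A)" if "pair t v \<in> elts E" for t v
    using sub[OF that] by (auto simp: TA_def)
  have step: "pair (fapp f ts) (?fi f vs) \<in> elts E"
    if "f \<in> elts (fun_syms Sg)" "maps ts (arity Sg f) (terms Sg)" "maps vs (arity Sg f) (carrier A)"
      "\<And>k. k \<in> elts (arity Sg f) \<Longrightarrow> pair (app ts k) (app vs k) \<in> elts E" for f ts vs
  proof -
    have "\<forall>k\<in>elts (arity Sg f). pair (ap ts k) (ap vs k) \<in> elts E"
      using that(4) app_eq_ap[OF maps_func[OF that(2)]] app_eq_ap[OF maps_func[OF that(3)]] by simp
    then show ?thesis using closed_E that(1-3) unfolding closed_def by blast
  qed
  have ex1: "\<exists>!v. pair t v \<in> elts E" if "t \<in> elts (terms Sg)" for t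
    using that
  proof (rule terms_induct)
    show "dfp (\<lambda>e. \<exists>!v. pair (e 0) v \<in> elts E)" by (intro df)
    fix n assume n: "n \<in> elts omega"
    show "\<exists>!v. pair (var n) v \<in> elts E"
    proof (rule ex1I)
      show "pair (var n) (app h n) \<in> elts E"
        using closed_E n by (auto simp: closed_def)
      show "v = app h n" if "pair (var n) v \<in> elts E" for v
        using minimal[of "pair (var n) v"] that by auto
    qed
  next
    fix f ts assume f: "f \<in> elts (fun_syms Sg)" and ts: "maps ts (arity Sg f) (terms Sg)"
      and IH: "\<And>k. k \<in> elts (arity Sg f) \<Longrightarrow> \<exists>!v. pair (app ts k) v \<in> elts E"
    have "set_fun (arity Sg f) (\<lambda>k. ap E (app ts k))"
      by (intro set_funI df dft_app maps_func[OF ts])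
    note vs = fun_on_lam[OF this] app_lam[OF this]
    let ?vs = "lam (arity Sg f) (\<lambda>k. ap E (app ts k))"
    have val: "pair (app ts k) v \<in> elts E \<longleftrightarrow> v = app ?vs k" if "k \<in> elts (arity Sg f)" for k v
    proof -
      obtain w where w: "pair (app ts k) w \<in> elts E" "\<And>z. pair (app ts k) z \<in> elts E \<Longrightarrow> z = w"
        using IH[OF \<open>k \<in> elts (arity Sg f)\<close>] by blast
      then have "ap E (app ts k) = w"
        unfolding ap_def by (intro the_equality) blast+
      then show ?thesis using w(1) w(2)[of v] vs(2)[OF \<open>k \<in> elts (arity Sg f)\<close>] by auto
    qed
    have vs_maps: "maps ?vs (arity Sg f) (carrier A)"
      unfolding maps_def using vs(1) val sub_pair(2) by blast
    show "\<exists>!v. pair (fapp f ts) v \<in> elts E"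
    proof (rule ex1I)
      show "pair (fapp f ts) (?fi f ?vs) \<in> elts E"
        using val by (intro step f ts vs_maps) auto
      fix v assume v: "pair (fapp f ts) v \<in> elts E"
      show "v = ?fi f ?vs"
      proof (rule ccontr)
        assume neq: "v \<noteq> ?fi f ?vs"
        have "pair (fapp f ts) v \<notin> elts E"
        proof (rule minimal)
          fix f' ts' vs' assume *: "maps vs' (arity Sg f') (carrier A)"
            "\<And>k. k \<in> elts (arity Sg f') \<Longrightarrow> pair (app ts' k) (app vs' k) \<in> elts E"
          show "pair (fapp f ts) v \<noteq> pair (fapp f' ts') (?fi f' vs')"
          proof
            assume eq: "pair (fapp f ts) v = pair (fapp f' ts') (?fi f' vs')"
            have "vs' = ?vs"
              by (rule fun_ext[OF maps_fun_on maps_fun_on[OF vs_maps]]) (use * eq val in auto)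
            then show False using eq neq by auto
          qed
        qed simp
        then show False using v by simp
      qed
    qed
  qed
  have fE: "fun_on E (terms Sg)"
    unfolding fun_on_def using sub ex1 unfolding TA_def by blast
  have mE: "maps E (terms Sg) (carrier A)"
    unfolding maps_def using fE sub_pair(2) pair_mem_fun[OF fE] by blast
  have "is_evaluation Sg A h E"
    unfolding is_evaluation_def
  proof (intro conjI ballI allI impI)
    show "app E (var n) = app h n" if "n \<in> elts omega" for n
      using closed_E that pair_mem_fun[OF fE, of "var n" "app h n"] by (auto simp: closed_def)
    fix f ts assume f: "f \<in> elts (fun_syms Sg)" and ts: "maps ts (arity Sg f) (terms Sg)"
    let ?vs = "lam (arity Sg f) (\<lambda>k. app E (app ts k))"
    have set: "set_fun (arity Sg f) (\<lambda>k. app E (app ts k))"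
      by (intro set_funI dft_app df maps_func[OF ts] maps_func[OF mE])
    then have vs: "maps ?vs (arity Sg f) (carrier A)"
      using maps_app[OF ts] maps_app[OF mE] by (intro maps_lam) auto
    have "pair (fapp f ts) (?fi f ?vs) \<in> elts E"
      by (rule step[OF f ts vs]) (use maps_app[OF ts] in \<open>simp add: app_lam[OF set] pair_mem_fun[OF fE]\<close>)
    then show "app E (fapp f ts) = app (fun_int A f) ?vs"
      using pair_mem_fun[OF fE] by (simp add: fi[OF f])
  qed (rule mE)
  then show ?thesis ..
qed

lemma evaluation_unique:
  assumes "is_evaluation Sg A h u" "is_evaluation Sg A h v"
  shows "u = v"
proof (rule fun_ext)
  have m: "maps u (terms Sg) (carrier A)" "maps v (terms Sg) (carrier A)"
    using assms by (auto simp: is_evaluation_def)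
  then show "fun_on u (terms Sg)" "fun_on v (terms Sg)" by (auto simp: maps_def)
  fix t assume "t \<in> elts (terms Sg)"
  then show "app u t = app v t"
  proof (rule terms_induct)
    show "dfp (\<lambda>e. app u (e 0) = app v (e 0))"
      by (intro df dft_app maps_func[OF m(1)] maps_func[OF m(2)])
    show "app u (var n) = app v (var n)" if "n \<in> elts omega" for n
      using assms that by (simp add: is_evaluation_def)
    fix f ts
    assume f: "f \<in> elts (fun_syms Sg)" "maps ts (arity Sg f) (terms Sg)"
      and IH: "\<And>k. k \<in> elts (arity Sg f) \<Longrightarrow> app u (app ts k) = app v (app ts k)"
    have "lam (arity Sg f) (\<lambda>k. app u (app ts k)) = lam (arity Sg f) (\<lambda>k. app v (app ts k))"
      using IH by (intro lam_cong) auto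
    then show "app u (fapp f ts) = app v (fapp f ts)"
      using assms f by (simp add: is_evaluation_def)
  qed
qed

definition evaluation :: "'v \<Rightarrow> 'v \<Rightarrow> 'v" where
  "evaluation A h = (THE ev. is_evaluation Sg A h ev)"

lemma term_val_eq: "term_val Sg A h t = app (evaluation A h) t"
  by (simp add: term_val_def evaluation_def)

lemma evaluation_eqI: "is_evaluation Sg A h ev \<Longrightarrow> evaluation A h = ev"
  unfolding evaluation_def by (rule the_equality) (auto intro: evaluation_unique)

lemma is_evaluation_evaluation:
  "is_structure Sg A \<Longrightarrow> maps h omega (carrier A) \<Longrightarrow> is_evaluation Sg A h (evaluation A h)"
  using ex_evaluation evaluation_eqI by metis

lemma evaluation_maps:
  "is_structure Sg A \<Longrightarrow> maps h omega (carrier A) \<Longrightarrow> maps (evaluation A h) (terms Sg) (carrier A)"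
  using is_evaluation_evaluation by (simp add: is_evaluation_def)

lemma dft_term_val:
  "is_structure Sg A \<Longrightarrow> maps h omega (carrier A) \<Longrightarrow> dft S \<Longrightarrow> dft (\<lambda>e. term_val Sg A h (S e))"
  unfolding term_val_eq by (intro dft_app maps_func[OF evaluation_maps])

lemma term_val_closed:
  "is_structure Sg A \<Longrightarrow> maps h omega (carrier A) \<Longrightarrow> t \<in> elts (terms Sg) \<Longrightarrow>
    term_val Sg A h t \<in> elts (carrier A)"
  unfolding term_val_eq by (rule maps_app[OF evaluation_maps])

lemma term_val_var:
  "is_structure Sg A \<Longrightarrow> maps h omega (carrier A) \<Longrightarrow> n \<in> elts omega \<Longrightarrow>
    term_val Sg A h (var n) = app h n"
  using is_evaluation_evaluation unfolding term_val_eq by (simp add: is_evaluation_def)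

lemma term_val_fapp:
  "is_structure Sg A \<Longrightarrow> maps h omega (carrier A) \<Longrightarrow> f \<in> elts (fun_syms Sg) \<Longrightarrow>
    maps ts (arity Sg f) (terms Sg) \<Longrightarrow>
    term_val Sg A h (fapp f ts) = app (fun_int A f) (lam (arity Sg f) (\<lambda>k. term_val Sg A h (app ts k)))"
  using is_evaluation_evaluation unfolding term_val_eq by (simp add: is_evaluation_def)

lemma term_val_tuple:
  assumes "is_structure Sg A" "maps h omega (carrier A)" "maps ts n (terms Sg)"
  shows "set_fun n (\<lambda>k. term_val Sg A h (app ts k))"
    and "maps (lam n (\<lambda>k. term_val Sg A h (app ts k))) n (carrier A)"
proof -
  show s: "set_fun n (\<lambda>k. term_val Sg A h (app ts k))"
    by (intro set_funI dft_term_val dft_app df maps_func[OF assms(3)] assms(1,2))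
  show "maps (lam n (\<lambda>k. term_val Sg A h (app ts k))) n (carrier A)"
    using assms maps_app[OF assms(3)] by (intro maps_lam[OF s] term_val_closed) auto
qed

text \<open>Homomorphisms as far as term values can see. The maps from the direct product to its
  factors and to the reduced product are of this kind, whatever relations the direct product
  carries.\<close>

definition fun_hom :: "'v \<Rightarrow> 'v \<Rightarrow> 'v \<Rightarrow> bool" where
  "fun_hom g A B \<longleftrightarrow> maps g (carrier A) (carrier B) \<and>
    (\<forall>f\<in>elts (fun_syms Sg). \<forall>t. maps t (arity Sg f) (carrier A) \<longrightarrow>
      app g (app (fun_int A f) t) = app (fun_int B f) (lam (arity Sg f) (\<lambda>k. app g (app t k))))"

text \<open>Induction on the term. The assignments are compared on \<open>V\<close> only, because
  without choice an assignment in a reduced product can be lifted to the product for finitely many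
  variables at a time.\<close>

lemma term_val_hom:
  assumes A: "is_structure Sg A" "maps h omega (carrier A)"
    and B: "is_structure Sg B" "maps h' omega (carrier B)"
    and g: "fun_hom g A B"
    and V: "elts V \<subseteq> elts omega" "\<And>n. n \<in> elts V \<Longrightarrow> app h' n = app g (app h n)"
    and t: "t \<in> elts (terms_over V)"
  shows "term_val Sg B h' t = app g (term_val Sg A h t)"
proof -
  have mg: "maps g (carrier A) (carrier B)" using g by (simp add: fun_hom_def)
  show ?thesis
    using t V(1)
  proof (rule terms_over_induct)
    show "dfp (\<lambda>e. term_val Sg B h' (e 0) = app g (term_val Sg A h (e 0)))"
      by (intro dfp_eq dft_term_val dft_app maps_func[OF mg] A B df)
    show "term_val Sg B h' (var n) = app g (term_val Sg A h (var n))" if n: "n \<in> elts V" for n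
    proof -
      have "n \<in> elts omega" using n V(1) by blast
      then show ?thesis by (simp add: term_val_var[OF A] term_val_var[OF B] V(2)[OF n])
    qed
    fix f ts
    assume f: "f \<in> elts (fun_syms Sg)" and ts: "maps ts (arity Sg f) (terms_over V)"
      and IH: "\<And>k. k \<in> elts (arity Sg f) \<Longrightarrow>
        term_val Sg B h' (app ts k) = app g (term_val Sg A h (app ts k))"
    have ts': "maps ts (arity Sg f) (terms Sg)"
      using ts by (rule maps_mono) (use terms_over_omega[OF V(1)] in blast)
    let ?vs = "lam (arity Sg f) (\<lambda>k. term_val Sg A h (app ts k))"
    note vs = term_val_tuple[OF A ts']
    have "app g (term_val Sg A h (fapp f ts)) = app (fun_int B f) (lam (arity Sg f) (\<lambda>k. app g (app ?vs k)))"
      using g f vs(2) unfolding fun_hom_def term_val_fapp[OF A f ts'] by blast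
    also have "lam (arity Sg f) (\<lambda>k. app g (app ?vs k)) = lam (arity Sg f) (\<lambda>k. term_val Sg B h' (app ts k))"
      by (rule lam_cong) (simp_all add: app_lam[OF vs(1)] IH)
    finally show "term_val Sg B h' (fapp f ts) = app g (term_val Sg A h (fapp f ts))"
      by (simp add: term_val_fapp[OF B f ts'])
  qed
qed

lemma term_val_hom_total:
  assumes "is_structure Sg A" "maps h omega (carrier A)" "is_structure Sg B" "fun_hom g A B"
    and "t \<in> elts (terms Sg)"
  shows "maps (lam omega (\<lambda>n. app g (app h n))) omega (carrier B)"
    and "term_val Sg B (lam omega (\<lambda>n. app g (app h n))) t = app g (term_val Sg A h t)"
proof -
  have mg: "maps g (carrier A) (carrier B)" using assms(4) by (simp add: fun_hom_def)
  have s: "set_fun omega (\<lambda>n. app g (app h n))"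
    by (intro set_funI dft_app df maps_func[OF mg] maps_func[OF assms(2)])
  show m: "maps (lam omega (\<lambda>n. app g (app h n))) omega (carrier B)"
    by (rule maps_lam[OF s]) (intro maps_app[OF mg] maps_app[OF assms(2)])
  show "term_val Sg B (lam omega (\<lambda>n. app g (app h n))) t = app g (term_val Sg A h t)"
    using assms(5) unfolding terms_eq
    by (intro term_val_hom[where V = omega] assms m) (simp_all add: app_lam[OF s])
qed

end

context ZF
begin

section \<open>Embeddings\<close>

lemma atom_inject [simp]:
  "eq_fm s t = eq_fm s' t' \<longleftrightarrow> s = s' \<and> t = t'"
  "rel_fm r ts = rel_fm r' ts' \<longleftrightarrow> r = r' \<and> ts = ts'"
  "eq_fm s t \<noteq> rel_fm r ts" "rel_fm r ts \<noteq> eq_fm s t"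
  by (auto simp: eq_fm_def rel_fm_def)

lemma lit_inject [simp]:
  "pos_lit a = pos_lit b \<longleftrightarrow> a = b" "neg_lit a = neg_lit b \<longleftrightarrow> a = b"
  "pos_lit a \<noteq> neg_lit b" "neg_lit b \<noteq> pos_lit a"
  by (auto simp: pos_lit_def neg_lit_def)

lemma sat_atomic_eq [simp]:
  "sat_atomic Sg A h (eq_fm s t) \<longleftrightarrow> term_val Sg A h s = term_val Sg A h t"
  by (simp add: sat_atomic_def)

lemma sat_atomic_rel [simp]:
  "sat_atomic Sg A h (rel_fm r ts) \<longleftrightarrow>
    lam (arity Sg r) (\<lambda>k. term_val Sg A h (app ts k)) \<in> elts (rel_int A r)"
  by (simp add: sat_atomic_def)

lemma sat_lit_simps [simp]:
  "sat_lit Sg A h (pos_lit a) \<longleftrightarrow> sat_atomic Sg A h a"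
  "sat_lit Sg A h (neg_lit a) \<longleftrightarrow> \<not> sat_atomic Sg A h a"
  by (simp_all add: sat_lit_def)

lemma models_iff:
  "models Sg A \<phi> \<longleftrightarrow> (\<forall>h. maps h omega (carrier A) \<longrightarrow>
    (\<forall>k a. pair k (neg_lit a) \<in> elts \<phi> \<longrightarrow> sat_atomic Sg A h a) \<longrightarrow>
    (\<exists>k a. pair k (pos_lit a) \<in> elts \<phi> \<and> sat_atomic Sg A h a))"
  unfolding models_def sat_lit_def by blast

lemma quasi_identity_literals:
  assumes "quasi_identity Sg \<phi>"
  obtains n where "n \<in> elts omega" "fun_on \<phi> (succ n)"
    "\<And>k l. pair k l \<in> elts \<phi> \<Longrightarrow> \<exists>a. is_atomic Sg a \<and> (l = pos_lit a \<or> l = neg_lit a)"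
    "\<And>k a j b. pair k (pos_lit a) \<in> elts \<phi> \<Longrightarrow> pair j (pos_lit b) \<in> elts \<phi> \<Longrightarrow> a = b"
proof -
  obtain n where n: "n \<in> elts omega" "fun_on \<phi> (succ n)"
    and lits: "\<And>k. k \<in> elts (succ n) \<Longrightarrow> is_pos_lit Sg (app \<phi> k) \<or> is_neg_lit Sg (app \<phi> k)"
    and unique: "\<And>j k. j \<in> elts (succ n) \<Longrightarrow> k \<in> elts (succ n) \<Longrightarrow>
      is_pos_lit Sg (app \<phi> j) \<Longrightarrow> is_pos_lit Sg (app \<phi> k) \<Longrightarrow> j = k"
    using assms unfolding quasi_identity_def basic_horn_def by blast
  have l: "\<exists>a. is_atomic Sg a \<and> (l = pos_lit a \<or> l = neg_lit a)" if "pair k l \<in> elts \<phi>" for k l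
    using lits[of k] that unfolding pair_mem_fun[OF n(2)] is_pos_lit_def is_neg_lit_def by blast
  have "a = b" if ab: "pair k (pos_lit a) \<in> elts \<phi>" "pair j (pos_lit b) \<in> elts \<phi>" for k a j b
  proof -
    have "is_pos_lit Sg (app \<phi> k)" "is_pos_lit Sg (app \<phi> j)"
      using l[OF ab(1)] l[OF ab(2)] ab unfolding pair_mem_fun[OF n(2)] is_pos_lit_def by auto
    then have "j = k"
      using unique[of j k] ab unfolding pair_mem_fun[OF n(2)] by blast
    then have "pos_lit a = pos_lit b"
      using ab unfolding pair_mem_fun[OF n(2)] by metis
    then show ?thesis by simp
  qed
  then show thesis using that n l by blast
qed

lemma quasi_identity_conclusion:
  assumes "quasi_identity Sg \<phi>"
  obtains k a where "pair k (pos_lit a) \<in> elts \<phi>" "is_atomic Sg a"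
  using assms unfolding quasi_identity_def is_pos_lit_def by blast

end

context signature
begin

text \<open>An isomorphism onto a substructure. Closure under isomorphisms and closure under
  substructures are both handled through this notion.\<close>

definition embedding :: "'v \<Rightarrow> 'v \<Rightarrow> 'v \<Rightarrow> bool" where
  "embedding g A B \<longleftrightarrow> fun_hom g A B \<and> inj_on (app g) (elts (carrier A)) \<and>
    (\<forall>r\<in>elts (rel_syms Sg). \<forall>t. maps t (arity Sg r) (carrier A) \<longrightarrow>
      (t \<in> elts (rel_int A r) \<longleftrightarrow> lam (arity Sg r) (\<lambda>k. app g (app t k)) \<in> elts (rel_int B r)))"

lemma embedding_maps: "embedding g A B \<Longrightarrow> maps g (carrier A) (carrier B)"
  by (simp add: embedding_def fun_hom_def)

lemma isomorphism_iff:
  "is_isomorphism Sg g A B \<longleftrightarrow> embedding g A B \<and> app g ` elts (carrier A) = elts (carrier B)"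
  unfolding is_isomorphism_def embedding_def fun_hom_def bij_betw_def by blast

lemma sat_atomic_embedding:
  assumes A: "is_structure Sg A" "maps h omega (carrier A)" and B: "is_structure Sg B"
    and g: "embedding g A B" and a: "is_atomic Sg a"
  shows "sat_atomic Sg B (lam omega (\<lambda>n. app g (app h n))) a \<longleftrightarrow> sat_atomic Sg A h a"
proof -
  have hom: "fun_hom g A B" and inj: "inj_on (app g) (elts (carrier A))"
    using g by (auto simp: embedding_def)
  note val = term_val_hom_total(2)[OF A B hom]
  from a consider s t where "s \<in> elts (terms Sg)" "t \<in> elts (terms Sg)" "a = eq_fm s t"
    | r ts where "r \<in> elts (rel_syms Sg)" "maps ts (arity Sg r) (terms Sg)" "a = rel_fm r ts"
    unfolding is_atomic_def by blast
  then show ?thesis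
  proof cases
    case 1
    then show ?thesis
      using inj_on_eq_iff[OF inj term_val_closed[OF A] term_val_closed[OF A]] by (simp add: val)
  next
    case 2
    let ?t = "lam (arity Sg r) (\<lambda>k. term_val Sg A h (app ts k))"
    note t = term_val_tuple[OF A 2(2)]
    have "lam (arity Sg r) (\<lambda>k. app g (app ?t k)) =
        lam (arity Sg r) (\<lambda>k. term_val Sg B (lam omega (\<lambda>n. app g (app h n))) (app ts k))"
      by (rule lam_cong) (simp_all add: app_lam[OF t(1)] val maps_app[OF 2(2)])
    then show ?thesis
      using g 2(1,3) t(2) by (simp add: embedding_def)
  qed
qed

lemma models_embedding:
  assumes A: "is_structure Sg A" and B: "is_structure Sg B" "models Sg B \<phi>"
    and g: "embedding g A B" and "quasi_identity Sg \<phi>"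
  shows "models Sg A \<phi>"
  unfolding models_def
proof (intro allI impI)
  fix h assume h: "maps h omega (carrier A)"
  obtain n where lits:
    "\<And>k l. pair k l \<in> elts \<phi> \<Longrightarrow> \<exists>a. is_atomic Sg a \<and> (l = pos_lit a \<or> l = neg_lit a)"
    using quasi_identity_literals[OF assms(5)] by metis
  let ?h = "lam omega (\<lambda>n. app g (app h n))"
  have "maps ?h omega (carrier B)"
    by (rule lam_comp(2)[OF embedding_maps[OF g] h])
  then obtain k l where kl: "pair k l \<in> elts \<phi>" "sat_lit Sg B ?h l"
    using B(2) unfolding models_def by blast
  then have "sat_lit Sg A h l"
    using lits[OF kl(1)] sat_atomic_embedding[OF A h B(1) g] by auto
  then show "\<exists>k l. pair k l \<in> elts \<phi> \<and> sat_lit Sg A h l" using kl(1) by blast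
qed

text \<open>Closure under isomorphisms transports membership along a map that starts in the class,
  while the preservation results for embeddings pull it back along a map that ends there. Inverses
  mediate between the two.\<close>

lemma isomorphism_sym:
  assumes A: "is_structure Sg A" and B: "is_structure Sg B" and g: "is_isomorphism Sg g A B"
  shows "\<exists>g'. is_isomorphism Sg g' B A"
proof -
  have emb: "embedding g A B" and surj: "app g ` elts (carrier A) = elts (carrier B)"
    using g by (auto simp: isomorphism_iff)
  have mg: "maps g (carrier A) (carrier B)" by (rule embedding_maps[OF emb])
  have inj: "inj_on (app g) (elts (carrier A))" using emb by (simp add: embedding_def)
  define G where "G b = (THE a. pair a b \<in> elts g)" for b
  have pair: "pair a b \<in> elts g \<longleftrightarrow> a \<in> elts (carrier A) \<and> b = app g a" for a b
    using pair_mem_fun[OF maps_fun_on[OF mg]] .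
  have G: "G (app g a) = a" if "a \<in> elts (carrier A)" for a
    unfolding G_def by (rule the_equality) (use that inj in \<open>auto simp: pair inj_on_eq_iff\<close>)
  have "dft (\<lambda>e. G (e 0))"
    unfolding G_def by (rule dft_The) (intro df, use inj in \<open>auto simp: pair inj_on_eq_iff\<close>)
  then have set_G: "set_fun (carrier B) G" by (rule set_funI)
  define g' where "g' = lam (carrier B) G"
  have g': "app g' (app g a) = a" if "a \<in> elts (carrier A)" for a
    unfolding g'_def using that surj by (subst app_lam[OF set_G]) (auto simp: G)
  have gg': "app g (app g' b) = b" "app g' b \<in> elts (carrier A)" if b: "b \<in> elts (carrier B)" for b
  proof -
    obtain a where "a \<in> elts (carrier A)" "b = app g a" using b surj by blast
    then show "app g (app g' b) = b" "app g' b \<in> elts (carrier A)" using g' by simp_all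
  qed
  have mg': "maps g' (carrier B) (carrier A)"
    unfolding g'_def using gg'(2) by (intro maps_lam[OF set_G]) (simp add: app_lam[OF set_G] g'_def)
  have comp: "lam n (\<lambda>k. app g (app (lam n (\<lambda>k. app g' (app t k))) k)) = t"
    if t: "maps t n (carrier B)" for n t
  proof -
    have "lam n (\<lambda>k. app g (app (lam n (\<lambda>k. app g' (app t k))) k)) = lam n (app t)"
      by (rule lam_cong) (simp_all add: app_lam[OF lam_comp(1)[OF mg' t]] gg' maps_app[OF t])
    then show ?thesis using lam_app[OF maps_fun_on[OF t]] by simp
  qed
  have "is_isomorphism Sg g' B A"
    unfolding isomorphism_iff embedding_def fun_hom_def
  proof (intro conjI ballI allI impI)
    show "inj_on (app g') (elts (carrier B))" by (rule inj_on_inverseI[of _ "app g"]) (rule gg'(1))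
    show "app g' ` elts (carrier B) = elts (carrier A)"
      unfolding surj[symmetric] using g' by (force simp: image_image)
    fix f t assume f: "f \<in> elts (fun_syms Sg)" and t: "maps t (arity Sg f) (carrier B)"
    let ?t = "lam (arity Sg f) (\<lambda>k. app g' (app t k))"
    have t': "maps ?t (arity Sg f) (carrier A)" by (rule lam_comp(2)[OF mg' t])
    have "app g (app (fun_int A f) ?t) = app (fun_int B f) t"
      using emb f t' comp[OF t] unfolding embedding_def fun_hom_def by simp
    then show "app g' (app (fun_int B f) t) = app (fun_int A f) ?t"
      using g' fun_int_closed[OF A f t'] by metis
  next
    fix r t assume r: "r \<in> elts (rel_syms Sg)" and t: "maps t (arity Sg r) (carrier B)"
    let ?t = "lam (arity Sg r) (\<lambda>k. app g' (app t k))"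
    have t': "maps ?t (arity Sg r) (carrier A)" by (rule lam_comp(2)[OF mg' t])
    show "t \<in> elts (rel_int B r) \<longleftrightarrow> ?t \<in> elts (rel_int A r)"
      using emb r t' comp[OF t] unfolding embedding_def by simp
  qed (rule mg')
  then show ?thesis ..
qed

text \<open>
  Transport of structure from \<open>B\<close> to \<open>D\<close> along an injection \<open>j\<close> with closed image. The set of all
  elements of the unique \<open>d\<close> with a given value \<open>j(d)\<close> is \<open>d\<close> itself, so \<open>d\<close> is described without \<open>THE\<close>.
\<close>

definition pullback :: "'v \<Rightarrow> 'v \<Rightarrow> 'v \<Rightarrow> 'v" where
  "pullback B D j = triple D
    (lam (rel_syms Sg) (\<lambda>r. mk {t. maps t (arity Sg r) D \<and>
       lam (arity Sg r) (\<lambda>k. ap j (ap t k)) \<in> elts (ap (fst_of (snd_of B)) r)}))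
    (lam (fun_syms Sg) (\<lambda>f. lam (tuples D (arity Sg f))
       (\<lambda>t. mk {x. \<exists>d\<in>elts D. x \<in> elts d \<and>
          ap j d = ap (ap (snd_of (snd_of B)) f) (lam (arity Sg f) (\<lambda>k. ap j (ap t k)))})))"

lemma
  assumes B: "is_structure Sg B" and D: "elts D \<noteq> {}" and j: "maps j D (carrier B)"
    and inj: "inj_on (app j) (elts D)"
    and closed: "\<forall>f\<in>elts (fun_syms Sg). \<forall>t. maps t (arity Sg f) D \<longrightarrow>
      (\<exists>d\<in>elts D. app j d = app (fun_int B f) (lam (arity Sg f) (\<lambda>k. app j (app t k))))"
  shows is_structure_pullback: "is_structure Sg (pullback B D j)"
    and embedding_pullback: "embedding j (pullback B D j) B"
    and carrier_pullback: "carrier (pullback B D j) = D"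
proof -
  let ?RR = "\<lambda>r. mk {t. maps t (arity Sg r) D \<and>
       lam (arity Sg r) (\<lambda>k. ap j (ap t k)) \<in> elts (ap (fst_of (snd_of B)) r)}"
  let ?ff = "\<lambda>f t. mk {x. \<exists>d\<in>elts D. x \<in> elts d \<and>
          ap j d = ap (ap (snd_of (snd_of B)) f) (lam (arity Sg f) (\<lambda>k. ap j (ap t k)))}"
  let ?FF = "\<lambda>f. lam (tuples D (arity Sg f)) (?ff f)"
  have RR: "set_fun (rel_syms Sg) ?RR" by (intro set_funI df)
  have FF: "set_fun (fun_syms Sg) ?FF" by (intro set_funI df)
  have ff: "set_fun d (?ff f)" for f d by (intro set_funI df)
  have comp: "lam n (\<lambda>k. ap j (ap t k)) = lam n (\<lambda>k. app j (app t k))" if "maps t n D" for n t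
    using app_eq_ap[OF maps_func[OF j]] app_eq_ap[OF maps_func[OF that]] by simp
  have elts_RR: "t \<in> elts (?RR r) \<longleftrightarrow> maps t (arity Sg r) D \<and>
      lam (arity Sg r) (\<lambda>k. app j (app t k)) \<in> elts (rel_int B r)" for r t
  proof -
    have "small {t. maps t (arity Sg r) D \<and>
       lam (arity Sg r) (\<lambda>k. ap j (ap t k)) \<in> elts (ap (fst_of (snd_of B)) r)}"
      by (rule small_Collect[OF small_maps[of "arity Sg r" D]]) (intro df, auto)
    from elts_mk[OF this] show ?thesis using comp rel_int_ap[OF B] by auto
  qed
  have ff_val: "?ff f t \<in> elts D \<and>
      app j (?ff f t) = app (fun_int B f) (lam (arity Sg f) (\<lambda>k. app j (app t k)))"
    if f: "f \<in> elts (fun_syms Sg)" and t: "maps t (arity Sg f) D" for f t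
  proof -
    obtain d where d: "d \<in> elts D" "app j d = app (fun_int B f) (lam (arity Sg f) (\<lambda>k. app j (app t k)))"
      using closed f t by blast
    have "{x. \<exists>d\<in>elts D. x \<in> elts d \<and>
        ap j d = ap (ap (snd_of (snd_of B)) f) (lam (arity Sg f) (\<lambda>k. ap j (ap t k)))} = elts d"
      unfolding comp[OF t]
      unfolding app_fun_int_ap[OF B f, symmetric] app_eq_ap[OF maps_func[OF j], symmetric] d(2)[symmetric]
      using inj d(1) by (auto simp: inj_on_eq_iff)
    then show ?thesis using d by simp
  qed
  show C: "carrier (pullback B D j) = D" by (simp add: pullback_def)
  show "is_structure Sg (pullback B D j)"
    unfolding pullback_def
  proof (rule is_structure_triple[OF D RR FF])
    show "maps t (arity Sg r) D" if "t \<in> elts (?RR r)" for r t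
      using that elts_RR by blast
    show "maps (?FF f) (tuples D (arity Sg f)) D" if "f \<in> elts (fun_syms Sg)" for f
      using ff_val[OF that] by (intro maps_lam[OF ff]) (simp add: elts_tuples)
  qed
  show "embedding j (pullback B D j) B"
    unfolding embedding_def fun_hom_def C
  proof (intro conjI ballI allI impI)
    fix f t assume f: "f \<in> elts (fun_syms Sg)" and t: "maps t (arity Sg f) D"
    have "app (fun_int (pullback B D j) f) t = ?ff f t"
      unfolding pullback_def fun_int_triple[OF FF f] using t by (intro app_lam[OF ff]) (simp add: elts_tuples)
    then show "app j (app (fun_int (pullback B D j) f) t) =
        app (fun_int B f) (lam (arity Sg f) (\<lambda>k. app j (app t k)))"
      using ff_val[OF f t] by simp
  next
    fix r t assume r: "r \<in> elts (rel_syms Sg)" and t: "maps t (arity Sg r) D"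
    show "t \<in> elts (rel_int (pullback B D j) r) \<longleftrightarrow>
        lam (arity Sg r) (\<lambda>k. app j (app t k)) \<in> elts (rel_int B r)"
      unfolding pullback_def rel_int_triple[OF RR r] elts_RR using t by blast
  qed (rule j, rule inj)
qed

lemma embedding_id_iff:
  assumes "is_structure Sg C" "is_structure Sg B" "elts (carrier C) \<subseteq> elts (carrier B)"
  shows "embedding (lam (carrier C) (\<lambda>x. x)) C B \<longleftrightarrow> is_substructure Sg C B"
proof -
  have s: "set_fun (carrier C) (\<lambda>x. x)" by (intro set_funI df)
  note id = app_lam[OF s]
  have m: "maps (lam (carrier C) (\<lambda>x. x)) (carrier C) (carrier B)"
    using assms(3) by (intro maps_lam[OF s]) auto
  have t: "lam n (\<lambda>k. app (lam (carrier C) (\<lambda>x. x)) (app t k)) = t" if t: "maps t n (carrier C)" for n t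
  proof -
    have "lam n (\<lambda>k. app (lam (carrier C) (\<lambda>x. x)) (app t k)) = lam n (app t)"
      by (rule lam_cong) (simp_all add: id maps_app[OF t])
    then show ?thesis using lam_app[OF maps_fun_on[OF t]] by simp
  qed
  have inj: "inj_on (app (lam (carrier C) (\<lambda>x. x))) (elts (carrier C))"
    by (simp add: inj_on_def id)
  show ?thesis
    unfolding embedding_def fun_hom_def is_substructure_def
    using assms m inj id fun_int_closed[OF assms(1)] by (auto simp: t)
qed

text \<open>\<open>A\<close> is isomorphic to its image in \<open>B\<close>, and the substructure on
  this image \<open>D\<close> is constructed as the pullback of \<open>B\<close> along the
  inclusion.\<close>

lemma closed_under_embeddings:
  assumes K: "closed_under_isomorphisms Sg K" "closed_under_substructures Sg K"
    and B: "B \<in> K" "is_structure Sg B" and A: "is_structure Sg A" and g: "embedding g A B"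
  shows "A \<in> K"
proof -
  have mg: "maps g (carrier A) (carrier B)" by (rule embedding_maps[OF g])
  define D where "D = mk (app g ` elts (carrier A))"
  have D: "elts D = app g ` elts (carrier A)"
    unfolding D_def by (intro elts_mk small_image small_elts dft_app maps_func[OF mg] df)
  have D_sub: "elts D \<subseteq> elts (carrier B)" using D maps_app[OF mg] by auto
  let ?id = "lam D (\<lambda>x. x)"
  have s: "set_fun D (\<lambda>x. x)" by (intro set_funI df)
  note id = app_lam[OF s]
  have id_comp: "lam n (\<lambda>k. app ?id (app t k)) = t" if t: "maps t n D" for n t
  proof -
    have "lam n (\<lambda>k. app ?id (app t k)) = lam n (app t)"
      by (rule lam_cong) (simp_all add: id maps_app[OF t])
    then show ?thesis using lam_app[OF maps_fun_on[OF t]] by simp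
  qed
  have closed: "\<forall>f\<in>elts (fun_syms Sg). \<forall>t. maps t (arity Sg f) D \<longrightarrow>
      (\<exists>d\<in>elts D. app ?id d = app (fun_int B f) (lam (arity Sg f) (\<lambda>k. app ?id (app t k))))"
  proof (intro ballI allI impI)
    fix f t assume f: "f \<in> elts (fun_syms Sg)" and t: "maps t (arity Sg f) D"
    have "\<exists>a. a \<in> elts (carrier A) \<and> app g a = app t k" if "k \<in> elts (arity Sg f)" for k
      using maps_app[OF t that] D by auto
    \<comment> \<open>Lifting the argument tuple back to \<open>A\<close> shows that
      \<open>D\<close> is closed under the functions of \<open>B\<close>.\<close>
    then obtain u where u: "fun_on u (arity Sg f)"
      "\<And>k. k \<in> elts (arity Sg f) \<Longrightarrow> app u k \<in> elts (carrier A) \<and> app g (app u k) = app t k"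
      using finite_choice[OF arity_omega(2)[OF f], of "\<lambda>k a. a \<in> elts (carrier A) \<and> app g a = app t k"]
        dfp_conj[OF dfp_mem[OF dft_var dft_const] dfp_eq[OF dft_app[OF maps_func[OF mg] dft_var]
          dft_app[OF maps_func[OF t] dft_var]], of 1 "carrier A" 1 0]
      by auto
    have mu: "maps u (arity Sg f) (carrier A)" using u by (simp add: maps_def)
    have "lam (arity Sg f) (\<lambda>k. app g (app u k)) = lam (arity Sg f) (app t)"
      using u(2) by (intro lam_cong) auto
    then have "lam (arity Sg f) (\<lambda>k. app g (app u k)) = t"
      using lam_app[OF maps_fun_on[OF t]] by simp
    then have eq: "app g (app (fun_int A f) u) = app (fun_int B f) t"
      using g f mu unfolding embedding_def fun_hom_def by metis
    have "app (fun_int B f) t \<in> elts D"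
      unfolding D eq[symmetric] using fun_int_closed[OF A f mu] by blast
    then show "\<exists>d\<in>elts D. app ?id d = app (fun_int B f) (lam (arity Sg f) (\<lambda>k. app ?id (app t k)))"
      using id id_comp[OF t] by auto
  qed
  have ne: "elts D \<noteq> {}" using D elts_carrier_nonempty[OF A] by auto
  have mid: "maps ?id D (carrier B)" using D_sub by (intro maps_lam[OF s]) auto
  have inj: "inj_on (app ?id) (elts D)" by (simp add: inj_on_def id)
  let ?C = "pullback B D ?id"
  note C = is_structure_pullback[OF B(2) ne mid inj closed] carrier_pullback[OF B(2) ne mid inj closed]
  have sub: "is_substructure Sg ?C B"
    using embedding_pullback[OF B(2) ne mid inj closed] embedding_id_iff[OF C(1) B(2)] C(2) D_sub by simp
  then have "?C \<in> K" using K(2) B(1) by (auto simp: closed_under_substructures_def)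
  moreover have "is_isomorphism Sg g A ?C"
    unfolding isomorphism_iff
  proof
    show "app g ` elts (carrier A) = elts (carrier ?C)" using C(2) D by simp
    have mg': "maps g (carrier A) D"
      using mg D unfolding maps_def by auto
    have tD: "maps (lam n (\<lambda>k. app g (app t k))) n D" if "maps t n (carrier A)" for n t
      by (rule lam_comp(2)[OF mg' that])
    show "embedding g A ?C"
      using g sub mg' tD unfolding embedding_def fun_hom_def is_substructure_def C(2) by simp
  qed
  ultimately show ?thesis
    using isomorphism_sym[OF A C(1)] K(1) A unfolding closed_under_isomorphisms_def by blast
qed

lemma unit_sat_atomic:
  assumes U: "is_unit Sg U" and h: "maps h omega (carrier U)" and a: "is_atomic Sg a"
  shows "sat_atomic Sg U h a"
proof -
  obtain u where u: "is_structure Sg U" "elts (carrier U) = {u}"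
    "\<And>r. r \<in> elts (rel_syms Sg) \<Longrightarrow> lam (arity Sg r) (\<lambda>_. u) \<in> elts (rel_int U r)"
    using U unfolding is_unit_def by blast
  have val: "term_val Sg U h t = u" if "t \<in> elts (terms Sg)" for t
    using term_val_closed[OF u(1) h that] u(2) by simp
  have "lam (arity Sg r) (\<lambda>k. term_val Sg U h (app ts k)) = lam (arity Sg r) (\<lambda>_. u)"
    if "maps ts (arity Sg r) (terms Sg)" for r ts
    using val maps_app[OF that] by (intro lam_cong) auto
  then show ?thesis using a u(3) val unfolding is_atomic_def by auto
qed

text \<open>All atomic formulas are true in a unit, and a quasi-identity has an unnegated disjunct:
  this is where strictness enters.\<close>

lemma unit_models:
  assumes U: "is_unit Sg U" and q: "quasi_identity Sg \<phi>"
  shows "models Sg U \<phi>"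
  unfolding models_iff using quasi_identity_conclusion[OF q] unit_sat_atomic[OF U] by metis

lemma ex_unit: "\<exists>U. is_unit Sg U"
proof -
  let ?RR = "\<lambda>r. tuples one (arity Sg r)"
  let ?FF = "\<lambda>f. lam (tuples one (arity Sg f)) (\<lambda>_. zero)"
  let ?U = "triple one (lam (rel_syms Sg) ?RR) (lam (fun_syms Sg) ?FF)"
  have RR: "set_fun (rel_syms Sg) ?RR" and FF: "set_fun (fun_syms Sg) ?FF"
    and const: "set_fun n (\<lambda>_. zero)" for n
    by (intro set_funI df)+
  have "is_structure Sg ?U"
    by (rule is_structure_triple[OF _ RR FF]) (auto simp: elts_tuples intro!: maps_lam const)
  moreover have "lam (arity Sg r) (\<lambda>_. zero) \<in> elts (rel_int ?U r)" if "r \<in> elts (rel_syms Sg)" for r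
    using that by (auto simp: rel_int_triple[OF RR] elts_tuples intro!: maps_lam const)
  ultimately show ?thesis unfolding is_unit_def by auto
qed

end

context ZF
begin

section \<open>Reduced products\<close>

lemma dft_lits [df]:
  "dft S \<Longrightarrow> dft (\<lambda>e. pos_lit (S e))" "dft S \<Longrightarrow> dft (\<lambda>e. neg_lit (S e))"
  "dft S \<Longrightarrow> dft T \<Longrightarrow> dft (\<lambda>e. eq_fm (S e) (T e))"
  "dft S \<Longrightarrow> dft T \<Longrightarrow> dft (\<lambda>e. rel_fm (S e) (T e))"
  unfolding pos_lit_def neg_lit_def eq_fm_def rel_fm_def by (intro df; assumption)+

lemma elts_product:
  assumes "fun_on A I"
  shows "a \<in> elts (product I A) \<longleftrightarrow> fun_on a I \<and> (\<forall>i\<in>elts I. app a i \<in> elts (carrier (app A i)))"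
proof -
  note A = fun_on_func[OF assms]
  define U where "U = mk (\<Union>i\<in>elts I. elts (carrier (app A i)))"
  have U: "elts U = (\<Union>i\<in>elts I. elts (carrier (app A i)))"
    unfolding U_def by (intro elts_mk small_UN small_elts df dft_app A)
  have "small {a. fun_on a I \<and> (\<forall>i\<in>elts I. app a i \<in> elts (carrier (app A i)))}"
  proof (rule small_Collect_cong)
    show "small {a. maps a I U}" by (rule small_maps)
    show "dfp (\<lambda>e. \<forall>i\<in>elts I. ap (e 0) i \<in> elts (carrier (app A i)))"
      by (intro df dft_app A)
  qed (auto simp: maps_def U app_eq_ap[OF fun_on_func])
  from elts_mk[OF this] show ?thesis by (simp add: product_def)
qed

end

locale filtered_family = signature mem Sg for mem :: "'v \<Rightarrow> 'v \<Rightarrow> bool" and Sg +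
  fixes I A F :: 'v
  assumes filter: "proper_filter I F"
    and family: "fun_on A I"
    and structures: "\<And>i. i \<in> elts I \<Longrightarrow> is_structure Sg (app A i)"
    and product_nonempty: "elts (product I A) \<noteq> {}"
begin

definition large :: "('v \<Rightarrow> bool) \<Rightarrow> bool" where
  "large P \<longleftrightarrow> mk {i \<in> elts I. P i} \<in> elts F"

lemma large_True: "large (\<lambda>i. True)"
  using filter by (simp add: large_def proper_filter_def)

lemma large_cong:
  assumes "\<And>i. i \<in> elts I \<Longrightarrow> P i = Q i"
  shows "large P \<longleftrightarrow> large Q"
proof -
  have "{i \<in> elts I. P i} = {i \<in> elts I. Q i}" using assms by blast
  then show ?thesis by (simp add: large_def)
qed

text \<open>The filter consists of sets of the model, hence the smallness assumptions: on other
  collections \<open>mk\<close> has nothing to do with its argument.\<close>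

lemma large_mono:
  assumes "large P" "small {i \<in> elts I. P i}" "small {i \<in> elts I. Q i}"
    and "\<And>i. i \<in> elts I \<Longrightarrow> P i \<Longrightarrow> Q i"
  shows "large Q"
proof -
  have "\<forall>X\<in>elts F. \<forall>Y. elts X \<subseteq> elts Y \<and> elts Y \<subseteq> elts I \<longrightarrow> Y \<in> elts F"
    using filter unfolding proper_filter_def by blast
  moreover have "elts (mk {i \<in> elts I. P i}) \<subseteq> elts (mk {i \<in> elts I. Q i})"
    "elts (mk {i \<in> elts I. Q i}) \<subseteq> elts I"
    using assms(4) by (auto simp: elts_mk[OF assms(2)] elts_mk[OF assms(3)])
  ultimately show ?thesis using assms(1) unfolding large_def by blast
qed

lemma large_conj:
  assumes "large P" "large Q" "small {i \<in> elts I. P i}" "small {i \<in> elts I. Q i}"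
  shows "large (\<lambda>i. P i \<and> Q i)"
proof -
  have "mk (elts (mk {i \<in> elts I. P i}) \<inter> elts (mk {i \<in> elts I. Q i})) \<in> elts F"
    using filter assms(1,2) unfolding proper_filter_def large_def by blast
  moreover have "{i \<in> elts I. P i} \<inter> {i \<in> elts I. Q i} = {i \<in> elts I. P i \<and> Q i}" by blast
  ultimately show ?thesis unfolding large_def by (simp add: elts_mk[OF assms(3)] elts_mk[OF assms(4)])
qed

text \<open>Closure of the filter under binary intersections extends to \<open>n\<close> many sets
  by induction inside the model. As \<open>n\<close> may be nonstandard, an induction in HOL would
  not reach it.\<close>

lemma large_finite:
  assumes "n \<in> elts omega" "dfp (\<lambda>e. Q (e 0) (e 1))" "\<And>k. k \<in> elts n \<Longrightarrow> large (Q k)"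
  shows "large (\<lambda>i. \<forall>k\<in>elts n. Q k i)"
proof -
  note Q = dfp2[where P = Q, OF assms(2)]
  have "(\<forall>k\<in>elts n. large (Q k)) \<longrightarrow> large (\<lambda>i. \<forall>k\<in>elts n. Q k i)"
    using assms(1)
  proof (rule omega_induct)
    show "dfp (\<lambda>e. (\<forall>k\<in>elts (e 0). large (Q k)) \<longrightarrow> large (\<lambda>i. \<forall>k\<in>elts (e 0). Q k i))"
      unfolding large_def by (intro df Q)
    fix n
    assume IH: "(\<forall>k\<in>elts n. large (Q k)) \<longrightarrow> large (\<lambda>i. \<forall>k\<in>elts n. Q k i)"
    show "(\<forall>k\<in>elts (succ n). large (Q k)) \<longrightarrow> large (\<lambda>i. \<forall>k\<in>elts (succ n). Q k i)"
    proof
      assume "\<forall>k\<in>elts (succ n). large (Q k)"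
      then have "large (\<lambda>i. Q n i \<and> (\<forall>k\<in>elts n. Q k i))"
        using IH by (intro large_conj small_sep) (simp, simp, intro df Q, intro df Q)
      then show "large (\<lambda>i. \<forall>k\<in>elts (succ n). Q k i)" by simp
    qed
  qed (simp add: large_True)
  then show ?thesis using assms(3) by blast
qed

abbreviation PA :: 'v where
  "PA \<equiv> product I A"

lemma func_A: "func A"
  by (rule fun_on_func[OF family])

lemma elts_Prod: "a \<in> elts PA \<longleftrightarrow> fun_on a I \<and> (\<forall>i\<in>elts I. app a i \<in> elts (carrier (app A i)))"
  by (rule elts_product[OF family])

lemma Prod_func: "a \<in> elts PA \<Longrightarrow> func a"
  using elts_Prod fun_on_func by blast

lemma Prod_app: "a \<in> elts PA \<Longrightarrow> i \<in> elts I \<Longrightarrow> app a i \<in> elts (carrier (app A i))"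
  using elts_Prod by blast

lemma coords_ap: "maps s n PA \<Longrightarrow> coords n s i = lam n (\<lambda>k. ap (ap s k) i)"
  unfolding coords_def
  by (rule lam_cong) (simp_all add: app_eq_ap[OF Prod_func] maps_app flip: app_eq_ap[OF maps_func])

lemma coords_maps:
  assumes "maps s n PA"
  shows "set_fun n (\<lambda>k. app (app s k) i)"
    and "i \<in> elts I \<Longrightarrow> maps (coords n s i) n (carrier (app A i))"
proof -
  show s: "set_fun n (\<lambda>k. app (app s k) i)"
    by (rule set_funI_cong[of "\<lambda>k. ap (app s k) i"])
      (intro df dft_app maps_func[OF assms], simp add: app_eq_ap[OF Prod_func] maps_app[OF assms])
  show "i \<in> elts I \<Longrightarrow> maps (coords n s i) n (carrier (app A i))"
    unfolding coords_def by (intro maps_lam[OF s] Prod_app maps_app[OF assms])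
qed

definition pointwise :: "'v \<Rightarrow> 'v \<Rightarrow> 'v" where
  "pointwise f s = lam I (\<lambda>i. app (fun_int (app A i) f) (coords (arity Sg f) s i))"

text \<open>
  Here and below, a primed constant is the variant of the constant without prime that is definable
  everywhere, since \<open>ap\<close> replaces \<open>app\<close>.
\<close>

definition pointwise' :: "'v \<Rightarrow> 'v \<Rightarrow> 'v" where
  "pointwise' f s = lam I (\<lambda>i. ap (ap (snd_of (snd_of (ap A i))) f) (lam (arity Sg f) (\<lambda>k. ap (ap s k) i)))"

lemma dft_pointwise' [df]: "dft S \<Longrightarrow> dft T \<Longrightarrow> dft (\<lambda>e. pointwise' (S e) (T e))"
  by (rule dft2[where F = pointwise']) (unfold pointwise'_def, intro df)

lemma
  assumes f: "f \<in> elts (fun_syms Sg)" and s: "maps s (arity Sg f) PA"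
  shows pointwise_eq: "pointwise f s = pointwise' f s"
    and pointwise_app: "i \<in> elts I \<Longrightarrow>
      app (pointwise f s) i = app (fun_int (app A i) f) (coords (arity Sg f) s i)"
    and pointwise_Prod: "pointwise f s \<in> elts PA"
proof -
  have eq: "app (fun_int (app A i) f) (coords (arity Sg f) s i) =
      ap (ap (snd_of (snd_of (ap A i))) f) (lam (arity Sg f) (\<lambda>k. ap (ap s k) i))"
    if "i \<in> elts I" for i
    using app_fun_int_ap[OF structures[OF that] f] by (simp add: coords_ap[OF s] app_eq_ap[OF func_A])
  show "pointwise f s = pointwise' f s"
    unfolding pointwise_def pointwise'_def by (rule lam_cong) (simp_all add: eq)
  have set: "set_fun I (\<lambda>i. app (fun_int (app A i) f) (coords (arity Sg f) s i))"
    by (rule set_funI_cong[OF _ eq]) (intro df)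
  show app: "app (pointwise f s) i = app (fun_int (app A i) f) (coords (arity Sg f) s i)"
    if "i \<in> elts I" for i
    unfolding pointwise_def by (rule app_lam[OF set that])
  show "pointwise f s \<in> elts PA"
    unfolding elts_Prod
  proof (intro conjI ballI)
    show "fun_on (pointwise f s) I" unfolding pointwise_def by (rule fun_on_lam[OF set])
    show "app (pointwise f s) i \<in> elts (carrier (app A i))" if "i \<in> elts I" for i
      unfolding app[OF that] by (rule fun_int_closed[OF structures[OF that] f coords_maps(2)[OF s that]])
  qed
qed

text \<open>The relations of the direct product are irrelevant, since only terms are evaluated in it.\<close>

definition direct_product :: 'v where
  "direct_product = triple PA (lam (rel_syms Sg) (\<lambda>r. zero))
    (lam (fun_syms Sg) (\<lambda>f. lam (tuples PA (arity Sg f)) (pointwise' f)))"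

lemma direct_product:
  shows carrier_direct_product: "carrier direct_product = PA"
    and is_structure_direct_product: "is_structure Sg direct_product"
    and fun_int_direct_product: "f \<in> elts (fun_syms Sg) \<Longrightarrow> maps s (arity Sg f) PA \<Longrightarrow>
      app (fun_int direct_product f) s = pointwise f s"
proof -
  have FF: "set_fun (fun_syms Sg) (\<lambda>f. lam (tuples PA (arity Sg f)) (pointwise' f))"
    by (intro set_funI df)
  have ff: "set_fun d (pointwise' f)" for d f
    by (intro set_funI df)
  show "carrier direct_product = PA" by (simp add: direct_product_def)
  show "app (fun_int direct_product f) s = pointwise f s"
    if "f \<in> elts (fun_syms Sg)" "maps s (arity Sg f) PA"
    unfolding direct_product_def fun_int_triple[OF FF that(1)] pointwise_eq[OF that]
    by (rule app_lam[OF ff]) (simp add: elts_tuples that(2))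
  show "is_structure Sg direct_product"
    unfolding direct_product_def
  proof (rule is_structure_triple[OF product_nonempty _ FF])
    show "maps (lam (tuples PA (arity Sg f)) (pointwise' f)) (tuples PA (arity Sg f)) PA"
      if "f \<in> elts (fun_syms Sg)" for f
    proof (rule maps_lam[OF ff])
      fix s assume "s \<in> elts (tuples PA (arity Sg f))"
      then have s: "maps s (arity Sg f) PA" by (simp add: elts_tuples)
      show "pointwise' f s \<in> elts PA" using pointwise_Prod[OF that s] pointwise_eq[OF that s] by simp
    qed
  qed (intro set_funI df, simp)
qed

definition proj :: "'v \<Rightarrow> 'v" where
  "proj i = lam PA (\<lambda>a. app a i)"

lemma
  assumes i: "i \<in> elts I"
  shows proj_app: "a \<in> elts PA \<Longrightarrow> app (proj i) a = app a i"
    and proj_hom: "fun_hom (proj i) direct_product (app A i)"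
proof -
  have set: "set_fun PA (\<lambda>a. app a i)"
    by (rule set_funI_cong[of "\<lambda>a. ap a i"]) (intro df, simp add: app_eq_ap[OF Prod_func])
  show app: "app (proj i) a = app a i" if "a \<in> elts PA" for a
    unfolding proj_def by (rule app_lam[OF set that])
  show "fun_hom (proj i) direct_product (app A i)"
    unfolding fun_hom_def carrier_direct_product
  proof (intro conjI ballI allI impI)
    show "maps (proj i) PA (carrier (app A i))"
      unfolding proj_def by (rule maps_lam[OF set]) (rule Prod_app[OF _ i])
    fix f s assume f: "f \<in> elts (fun_syms Sg)" and s: "maps s (arity Sg f) PA"
    have "coords (arity Sg f) s i = lam (arity Sg f) (\<lambda>k. app (proj i) (app s k))"
      unfolding coords_def by (rule lam_cong) (simp_all add: app maps_app[OF s])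
    then show "app (proj i) (app (fun_int direct_product f) s) =
        app (fun_int (app A i) f) (lam (arity Sg f) (\<lambda>k. app (proj i) (app s k)))"
      by (simp add: fun_int_direct_product[OF f s] app pointwise_Prod[OF f s] pointwise_app[OF f s i])
  qed
qed

section \<open>Classes modulo the filter\<close>

lemma eq_mod_iff: "eq_mod I F a b \<longleftrightarrow> large (\<lambda>i. app a i = app b i)"
  by (simp add: eq_mod_def large_def)

lemma small_agree: "a \<in> elts PA \<Longrightarrow> b \<in> elts PA \<Longrightarrow> small {i \<in> elts I. app a i = app b i}"
  by (intro small_sep df dft_app Prod_func)

lemma eq_mod_refl: "eq_mod I F a a"
  by (simp add: eq_mod_iff large_True)

lemma eq_mod_sym: "eq_mod I F a b \<Longrightarrow> eq_mod I F b a"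
  unfolding eq_mod_iff by (simp add: eq_commute)

lemma eq_mod_trans:
  assumes "eq_mod I F a b" "eq_mod I F b c" "a \<in> elts PA" "b \<in> elts PA" "c \<in> elts PA"
  shows "eq_mod I F a c"
proof -
  have "large (\<lambda>i. app a i = app b i \<and> app b i = app c i)"
    using assms unfolding eq_mod_iff by (intro large_conj small_agree)
  moreover have "small {i \<in> elts I. app a i = app b i \<and> app b i = app c i}"
    by (intro small_sep df dft_app Prod_func assms)
  ultimately show ?thesis
    unfolding eq_mod_iff using small_agree[OF assms(3,5)] by (rule large_mono) simp
qed

abbreviation cls :: "'v \<Rightarrow> 'v" where
  "cls \<equiv> mod_class I A F"

definition cls' :: "'v \<Rightarrow> 'v" where
  "cls' a = mk {b. b \<in> elts PA \<and> mk {i. i \<in> elts I \<and> ap a i = ap b i} \<in> elts F}"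

lemma dft_cls' [df]: "dft S \<Longrightarrow> dft (\<lambda>e. cls' (S e))"
  by (rule dft1[where F = cls']) (unfold cls'_def, intro df)

lemma eq_mod_ap:
  "a \<in> elts PA \<Longrightarrow> b \<in> elts PA \<Longrightarrow>
    eq_mod I F a b \<longleftrightarrow> mk {i. i \<in> elts I \<and> ap a i = ap b i} \<in> elts F"
  by (simp add: eq_mod_def app_eq_ap[OF Prod_func])

lemma cls_eq: "a \<in> elts PA \<Longrightarrow> cls a = cls' a"
  unfolding mod_class_def cls'_def using eq_mod_ap by (intro arg_cong[where f = mk]) blast

lemma elts_cls:
  assumes "a \<in> elts PA"
  shows "elts (cls a) = {b \<in> elts PA. eq_mod I F a b}"
proof -
  have "small {b. b \<in> elts PA \<and> eq_mod I F a b}"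
  proof (rule small_Collect_cong[OF small_elts[of PA]])
    show "dfp (\<lambda>e. mk {i. i \<in> elts I \<and> ap a i = ap (e 0) i} \<in> elts F)" by (intro df)
  qed (use assms in \<open>auto simp: eq_mod_ap\<close>)
  then show ?thesis unfolding mod_class_def by (rule elts_mk)
qed

lemma cls_eq_iff:
  assumes "a \<in> elts PA" "b \<in> elts PA"
  shows "cls a = cls b \<longleftrightarrow> eq_mod I F a b"
proof
  assume "cls a = cls b"
  then have "b \<in> elts (cls a)" by (simp add: elts_cls[OF assms(2)] eq_mod_refl assms(2))
  then show "eq_mod I F a b" by (simp add: elts_cls[OF assms(1)])
next
  assume ab: "eq_mod I F a b"
  have "eq_mod I F a c \<longleftrightarrow> eq_mod I F b c" if "c \<in> elts PA" for c
    using eq_mod_trans[OF ab _ assms that] eq_mod_trans[OF eq_mod_sym[OF ab] _ assms(2,1) that] by blast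
  then have "elts (cls a) = elts (cls b)" unfolding elts_cls[OF assms(1)] elts_cls[OF assms(2)] by blast
  then show "cls a = cls b" by (rule elts_inject)
qed

lemma elts_red_carrier: "elts (red_carrier I A F) = cls ` elts PA"
proof -
  have "cls ` elts PA = cls' ` elts PA" by (intro image_cong) (auto simp: cls_eq)
  moreover have "small (cls' ` elts PA)" by (intro small_image small_elts df)
  moreover have "{cls a |a. a \<in> elts PA} = cls ` elts PA" by auto
  ultimately show ?thesis unfolding red_carrier_def by (simp add: elts_mk)
qed

lemma mod_classes_eq: "maps s n PA \<Longrightarrow> mod_classes I A F n s = lam n (\<lambda>k. cls' (ap s k))"
  unfolding mod_classes_def
  by (rule lam_cong) (simp_all add: cls_eq maps_app flip: app_eq_ap[OF maps_func])

lemma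
  assumes s: "maps s n PA"
  shows mod_classes_app: "k \<in> elts n \<Longrightarrow> app (mod_classes I A F n s) k = cls (app s k)"
    and mod_classes_maps: "maps (mod_classes I A F n s) n (red_carrier I A F)"
proof -
  have set: "set_fun n (\<lambda>k. cls (app s k))"
    by (rule set_funI_cong[of "\<lambda>k. cls' (app s k)"])
      (intro df dft_app maps_func[OF s], simp add: cls_eq maps_app[OF s])
  show "k \<in> elts n \<Longrightarrow> app (mod_classes I A F n s) k = cls (app s k)"
    unfolding mod_classes_def by (rule app_lam[OF set])
  show "maps (mod_classes I A F n s) n (red_carrier I A F)"
    unfolding mod_classes_def by (rule maps_lam[OF set]) (auto simp: elts_red_carrier maps_app[OF s])
qed

lemma mod_classes_eq_iff:
  assumes "maps s n PA" "maps s' n PA"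
  shows "mod_classes I A F n s = mod_classes I A F n s' \<longleftrightarrow>
    (\<forall>k\<in>elts n. eq_mod I F (app s k) (app s' k))"
proof
  assume "mod_classes I A F n s = mod_classes I A F n s'"
  then show "\<forall>k\<in>elts n. eq_mod I F (app s k) (app s' k)"
    using mod_classes_app[OF assms(1)] mod_classes_app[OF assms(2)] cls_eq_iff
      maps_app[OF assms(1)] maps_app[OF assms(2)] by metis
next
  assume "\<forall>k\<in>elts n. eq_mod I F (app s k) (app s' k)"
  then show "mod_classes I A F n s = mod_classes I A F n s'"
    unfolding mod_classes_def using cls_eq_iff maps_app[OF assms(1)] maps_app[OF assms(2)]
    by (intro lam_cong) auto
qed

text \<open>The length of the tuple is a natural number of the model, so representatives of its
  classes are found by finite choice.\<close>

lemma ex_representatives: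
  assumes n: "n \<in> elts omega" and t: "maps t n (red_carrier I A F)"
  obtains s where "maps s n PA" "t = mod_classes I A F n s"
proof -
  have "\<exists>a. a \<in> elts PA \<and> app t k = cls' a" if "k \<in> elts n" for k
    using maps_app[OF t that] elts_red_carrier cls_eq by auto
  moreover have "dfp (\<lambda>e. e 1 \<in> elts PA \<and> app t (e 0) = cls' (e 1))"
    by (intro df dft_app maps_func[OF t])
  ultimately obtain s where s: "fun_on s n"
    "\<And>k. k \<in> elts n \<Longrightarrow> app s k \<in> elts PA \<and> app t k = cls' (app s k)"
    using finite_choice[OF n, of "\<lambda>k a. a \<in> elts PA \<and> app t k = cls' a"] by auto
  then have m: "maps s n PA" by (simp add: maps_def)
  have "t = mod_classes I A F n s"
    using maps_fun_on[OF t] maps_fun_on[OF mod_classes_maps[OF m]]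
    by (rule fun_ext) (use s mod_classes_app[OF m] in \<open>simp add: cls_eq\<close>)
  then show thesis using m that by blast
qed

text \<open>Representatives of the same classes agree on a large set at each position of the tuple,
  and finitely many large sets have a large intersection. Independence of the representatives, for
  relations and for functions, rests on this.\<close>

lemma coords_eq:
  assumes "n \<in> elts omega" "maps s n PA" "maps s' n PA"
    "mod_classes I A F n s = mod_classes I A F n s'"
  shows "large (\<lambda>i. coords n s i = coords n s' i)"
    and "small {i \<in> elts I. coords n s i = coords n s' i}"
proof -
  show sm: "small {i \<in> elts I. coords n s i = coords n s' i}"
    unfolding coords_ap[OF assms(2)] coords_ap[OF assms(3)] by (intro small_sep df)
  have ap: "app (app u k) i = ap (ap u k) i" if "maps u n PA" "k \<in> elts n" for u k i
    using app_eq_ap[OF maps_func[OF that(1)]] app_eq_ap[OF Prod_func[OF maps_app[OF that]]] by simp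
  have "large (\<lambda>i. \<forall>k\<in>elts n. ap (ap s k) i = ap (ap s' k) i)"
  proof (rule large_finite[OF assms(1)])
    show "dfp (\<lambda>e. ap (ap s (e 0)) (e 1) = ap (ap s' (e 0)) (e 1))" by (intro df)
    show "large (\<lambda>i. ap (ap s k) i = ap (ap s' k) i)" if "k \<in> elts n" for k
    proof -
      have "large (\<lambda>i. app (app s k) i = app (app s' k) i)"
        using mod_classes_eq_iff[OF assms(2,3)] assms(4) that unfolding eq_mod_iff by blast
      then show ?thesis unfolding ap[OF assms(2) that] ap[OF assms(3) that] .
    qed
  qed
  then show "large (\<lambda>i. coords n s i = coords n s' i)"
  proof (rule large_mono)
    show "small {i \<in> elts I. \<forall>k\<in>elts n. ap (ap s k) i = ap (ap s' k) i}" by (intro small_sep df)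
    show "small {i \<in> elts I. coords n s i = coords n s' i}" by (rule sm)
    show "coords n s i = coords n s' i" if "\<forall>k\<in>elts n. ap (ap s k) i = ap (ap s' k) i" for i
      unfolding coords_ap[OF assms(2)] coords_ap[OF assms(3)] using that by (intro lam_cong) auto
  qed
qed

section \<open>Relations and functions of the reduced product\<close>

lemma small_coords_rel:
  assumes r: "r \<in> elts (rel_syms Sg)" and s: "maps s (arity Sg r) PA"
  shows "small {i \<in> elts I. coords (arity Sg r) s i \<in> elts (rel_int (app A i) r)}"
  by (rule small_Collect_cong[OF small_elts[of I],
        where Q' = "\<lambda>i. lam (arity Sg r) (\<lambda>k. ap (ap s k) i) \<in> elts (ap (fst_of (snd_of (app A i))) r)"])
    (intro df dft_app func_A, auto simp: coords_ap[OF s] rel_int_ap[OF structures])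

definition large_rel' :: "'v \<Rightarrow> 'v \<Rightarrow> bool" where
  "large_rel' r s \<longleftrightarrow> large (\<lambda>i. lam (arity Sg r) (\<lambda>k. ap (ap s k) i) \<in> elts (ap (fst_of (snd_of (ap A i))) r))"

lemma dfp_large_rel' [df]: "dft S \<Longrightarrow> dft T \<Longrightarrow> dfp (\<lambda>e. large_rel' (S e) (T e))"
  by (rule dfp2[where P = large_rel']) (unfold large_rel'_def large_def, intro df)

lemma coords_rel_ap:
  assumes s: "maps s (arity Sg r) PA"
  shows "large (\<lambda>i. coords (arity Sg r) s i \<in> elts (rel_int (app A i) r)) \<longleftrightarrow> large_rel' r s"
proof -
  have "rel_int (app A i) r = ap (fst_of (snd_of (ap A i))) r" if "i \<in> elts I" for i
    using rel_int_ap[OF structures[OF that]] by (simp add: app_eq_ap[OF func_A])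
  then show ?thesis unfolding large_rel'_def by (intro large_cong) (simp add: coords_ap[OF s])
qed

definition red_rel' :: "'v \<Rightarrow> 'v" where
  "red_rel' r = mk {t. \<exists>s. maps s (arity Sg r) PA \<and> t = lam (arity Sg r) (\<lambda>k. cls' (ap s k)) \<and>
     large_rel' r s}"

lemma red_rel_set_eq:
  "{mod_classes I A F (arity Sg r) s | s. maps s (arity Sg r) PA \<and>
     large (\<lambda>i. coords (arity Sg r) s i \<in> elts (rel_int (app A i) r))} =
   {t. \<exists>s. maps s (arity Sg r) PA \<and> t = lam (arity Sg r) (\<lambda>k. cls' (ap s k)) \<and>
     large_rel' r s}"
  (is "?L = ?R")
proof (intro set_eqI iffI)
  fix t assume "t \<in> ?L"
  then obtain s where s: "maps s (arity Sg r) PA" "t = mod_classes I A F (arity Sg r) s"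
    "large (\<lambda>i. coords (arity Sg r) s i \<in> elts (rel_int (app A i) r))" by blast
  then show "t \<in> ?R" using mod_classes_eq[OF s(1)] coords_rel_ap[OF s(1)] by auto
next
  fix t assume "t \<in> ?R"
  then obtain s where s: "maps s (arity Sg r) PA" "t = lam (arity Sg r) (\<lambda>k. cls' (ap s k))"
    "large_rel' r s"
    by blast
  then show "t \<in> ?L"
    by (intro CollectI exI[of _ s]) (simp add: mod_classes_eq[OF s(1)] coords_rel_ap[OF s(1)])
qed

lemma red_rel_eq: "red_rel Sg I A F r = red_rel' r"
  unfolding red_rel_def red_rel'_def large_def[symmetric] red_rel_set_eq ..

lemma set_fun_red_rel: "set_fun d (red_rel Sg I A F)"
proof -
  have "dft (\<lambda>e. red_rel' (e 0))" unfolding red_rel'_def by (intro df)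
  then show ?thesis by (rule set_funI_cong) (rule red_rel_eq)
qed

lemma elts_red_rel:
  "t \<in> elts (red_rel Sg I A F r) \<longleftrightarrow> (\<exists>s. maps s (arity Sg r) PA \<and>
     t = mod_classes I A F (arity Sg r) s \<and> large (\<lambda>i. coords (arity Sg r) s i \<in> elts (rel_int (app A i) r)))"
proof -
  let ?X = "{t. \<exists>s. maps s (arity Sg r) PA \<and> t = lam (arity Sg r) (\<lambda>k. cls' (ap s k)) \<and>
     large_rel' r s}"
  have "small ?X"
  proof (rule small_Collect[OF small_maps[of "arity Sg r" "red_carrier I A F"]])
    show "t \<in> {t. maps t (arity Sg r) (red_carrier I A F)}"
      if "\<exists>s. maps s (arity Sg r) PA \<and> t = lam (arity Sg r) (\<lambda>k. cls' (ap s k)) \<and>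
        large_rel' r s" for t
      using that mod_classes_maps mod_classes_eq by fastforce
  qed (intro df)
  then show ?thesis
    unfolding red_rel_def large_def[symmetric] red_rel_set_eq[symmetric] by (auto simp: elts_mk)
qed

abbreviation RP :: 'v where
  "RP \<equiv> reduced_product Sg I A F"

lemma pointwise_cong:
  assumes f: "f \<in> elts (fun_syms Sg)" and s: "maps s (arity Sg f) PA" "maps s' (arity Sg f) PA"
    and eq: "mod_classes I A F (arity Sg f) s = mod_classes I A F (arity Sg f) s'"
  shows "cls (pointwise f s) = cls (pointwise f s')"
proof -
  note P = pointwise_Prod[OF f s(1)] pointwise_Prod[OF f s(2)]
  have "large (\<lambda>i. app (pointwise f s) i = app (pointwise f s') i)"
    using coords_eq[OF arity_omega(2)[OF f] s eq] small_agree[OF P]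
    by (rule large_mono) (simp add: pointwise_app[OF f s(1)] pointwise_app[OF f s(2)])
  then show ?thesis by (simp add: cls_eq_iff[OF P] eq_mod_iff)
qed

definition red_fun' :: "'v \<Rightarrow> 'v" where
  "red_fun' f = mk {p. \<exists>s. maps s (arity Sg f) PA \<and>
     p = pair (lam (arity Sg f) (\<lambda>k. cls' (ap s k))) (cls' (pointwise' f s))}"

lemma red_fun_set_eq:
  assumes f: "f \<in> elts (fun_syms Sg)"
  shows "{pair (mod_classes I A F (arity Sg f) s)
              (mod_class I A F (lam I (\<lambda>i. app (fun_int (app A i) f) (coords (arity Sg f) s i))))
         | s. maps s (arity Sg f) PA} =
    {p. \<exists>s. maps s (arity Sg f) PA \<and>
     p = pair (lam (arity Sg f) (\<lambda>k. cls' (ap s k))) (cls' (pointwise' f s))}"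
proof -
  have "pair (mod_classes I A F (arity Sg f) s)
      (mod_class I A F (lam I (\<lambda>i. app (fun_int (app A i) f) (coords (arity Sg f) s i)))) =
    pair (lam (arity Sg f) (\<lambda>k. cls' (ap s k))) (cls' (pointwise' f s))"
    if "maps s (arity Sg f) PA" for s
    unfolding pointwise_def[symmetric] mod_classes_eq[OF that] cls_eq[OF pointwise_Prod[OF f that]]
    by (simp add: pointwise_eq[OF f that])
  then show ?thesis by (metis (no_types, lifting))
qed

lemma set_fun_red_fun: "set_fun (fun_syms Sg) (red_fun Sg I A F)"
proof -
  have "dft (\<lambda>e. red_fun' (e 0))" unfolding red_fun'_def by (intro df)
  then show ?thesis
    by (rule set_funI_cong) (simp add: red_fun_def red_fun'_def red_fun_set_eq)
qed

lemma elts_red_fun: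
  assumes f: "f \<in> elts (fun_syms Sg)"
  shows "p \<in> elts (red_fun Sg I A F f) \<longleftrightarrow> (\<exists>s. maps s (arity Sg f) PA \<and>
    p = pair (mod_classes I A F (arity Sg f) s) (cls (pointwise f s)))"
proof -
  let ?X = "{p. \<exists>s. maps s (arity Sg f) PA \<and>
     p = pair (lam (arity Sg f) (\<lambda>k. cls' (ap s k))) (cls' (pointwise' f s))}"
  have "small ((\<lambda>s. pair (lam (arity Sg f) (\<lambda>k. cls' (ap s k))) (cls' (pointwise' f s))) `
      {s. maps s (arity Sg f) PA})"
    by (intro small_image small_maps df)
  moreover have "((\<lambda>s. pair (lam (arity Sg f) (\<lambda>k. cls' (ap s k))) (cls' (pointwise' f s))) `
      {s. maps s (arity Sg f) PA}) = ?X"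
    by blast
  ultimately have "small ?X" by simp
  then have "elts (red_fun Sg I A F f) = {pair (mod_classes I A F (arity Sg f) s)
              (mod_class I A F (lam I (\<lambda>i. app (fun_int (app A i) f) (coords (arity Sg f) s i))))
         | s. maps s (arity Sg f) PA}"
    unfolding red_fun_def red_fun_set_eq[OF f, symmetric] by (rule elts_mk)
  then show ?thesis unfolding pointwise_def[symmetric] by blast
qed

lemma
  assumes f: "f \<in> elts (fun_syms Sg)"
  shows red_fun_maps: "maps (red_fun Sg I A F f) (tuples (red_carrier I A F) (arity Sg f)) (red_carrier I A F)"
    and red_fun_app: "maps s (arity Sg f) PA \<Longrightarrow>
      app (red_fun Sg I A F f) (mod_classes I A F (arity Sg f) s) = cls (pointwise f s)"
proof -
  let ?T = "tuples (red_carrier I A F) (arity Sg f)" and ?f = "red_fun Sg I A F f"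
  \<comment> \<open>The graph is an image over all tuples of representatives; it is single-valued
    because the resulting class is the same for all of them.\<close>
  have pair: "pair (mod_classes I A F (arity Sg f) s) y \<in> elts ?f \<longleftrightarrow> y = cls (pointwise f s)"
    if "maps s (arity Sg f) PA" for s y
  proof -
    have "pair (mod_classes I A F (arity Sg f) s) y \<in> elts ?f \<longleftrightarrow> (\<exists>s'. maps s' (arity Sg f) PA \<and>
        mod_classes I A F (arity Sg f) s = mod_classes I A F (arity Sg f) s' \<and> y = cls (pointwise f s'))"
      unfolding elts_red_fun[OF f] by simp
    also have "\<dots> \<longleftrightarrow> y = cls (pointwise f s)"
    proof
      show "y = cls (pointwise f s)" if "\<exists>s'. maps s' (arity Sg f) PA \<and>
          mod_classes I A F (arity Sg f) s = mod_classes I A F (arity Sg f) s' \<and> y = cls (pointwise f s')"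
        using that pointwise_cong[OF f \<open>maps s (arity Sg f) PA\<close>] by (elim exE conjE) simp
    qed (intro exI[of _ s], simp add: that)
    finally show ?thesis .
  qed
  have rep: "\<exists>s. maps s (arity Sg f) PA \<and> t = mod_classes I A F (arity Sg f) s" if "t \<in> elts ?T" for t
    using that ex_representatives[OF arity_omega(2)[OF f]] unfolding elts_tuples by blast
  have fun_on: "fun_on ?f ?T"
    unfolding fun_on_def
  proof (intro conjI ballI)
    fix p assume "p \<in> elts ?f"
    then obtain s where "maps s (arity Sg f) PA" "p = pair (mod_classes I A F (arity Sg f) s) (cls (pointwise f s))"
      using elts_red_fun[OF f] by blast
    then show "\<exists>x\<in>elts ?T. \<exists>y. p = pair x y"
      using mod_classes_maps unfolding elts_tuples by blast
  next
    fix t assume "t \<in> elts ?T"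
    then show "\<exists>!y. pair t y \<in> elts ?f" using rep pair by metis
  qed
  show app: "app ?f (mod_classes I A F (arity Sg f) s) = cls (pointwise f s)"
    if "maps s (arity Sg f) PA" for s
    using pair[OF that, of "cls (pointwise f s)"] pair_mem_fun[OF fun_on] by metis
  show "maps ?f ?T (red_carrier I A F)"
    unfolding maps_def
  proof (intro conjI ballI fun_on)
    fix t assume "t \<in> elts ?T"
    then obtain s where s: "maps s (arity Sg f) PA" "t = mod_classes I A F (arity Sg f) s" using rep by blast
    then show "app ?f t \<in> elts (red_carrier I A F)"
      using app[OF s(1)] pointwise_Prod[OF f s(1)] elts_red_carrier by simp
  qed
qed

lemma carrier_RP [simp]: "carrier RP = red_carrier I A F"
  by (simp add: reduced_product_def)

lemma rel_int_RP: "r \<in> elts (rel_syms Sg) \<Longrightarrow> rel_int RP r = red_rel Sg I A F r"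
  unfolding reduced_product_def by (rule rel_int_triple[OF set_fun_red_rel])

lemma fun_int_RP: "f \<in> elts (fun_syms Sg) \<Longrightarrow> fun_int RP f = red_fun Sg I A F f"
  unfolding reduced_product_def by (rule fun_int_triple[OF set_fun_red_fun])

lemma is_structure_RP: "is_structure Sg RP"
  unfolding reduced_product_def
proof (rule is_structure_triple[OF _ set_fun_red_rel set_fun_red_fun])
  show "elts (red_carrier I A F) \<noteq> {}"
    using product_nonempty by (simp add: elts_red_carrier)
  show "maps t (arity Sg r) (red_carrier I A F)" if "t \<in> elts (red_rel Sg I A F r)" for r t
    using that mod_classes_maps unfolding elts_red_rel by blast
qed (rule red_fun_maps)

text \<open>The definition of the relation only yields some tuple \<open>s'\<close> of
  representatives with a large set. Since \<open>s\<close> and \<open>s'\<close> agree on a large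
  set, the condition passes to the given tuple \<open>s\<close>.\<close>

lemma rel_RP:
  assumes r: "r \<in> elts (rel_syms Sg)" and s: "maps s (arity Sg r) PA"
  shows "mod_classes I A F (arity Sg r) s \<in> elts (rel_int RP r) \<longleftrightarrow>
    large (\<lambda>i. coords (arity Sg r) s i \<in> elts (rel_int (app A i) r))"
proof
  assume "mod_classes I A F (arity Sg r) s \<in> elts (rel_int RP r)"
  then obtain s' where s': "maps s' (arity Sg r) PA"
    "mod_classes I A F (arity Sg r) s = mod_classes I A F (arity Sg r) s'"
    "large (\<lambda>i. coords (arity Sg r) s' i \<in> elts (rel_int (app A i) r))"
    unfolding rel_int_RP[OF r] elts_red_rel by blast
  note eq = coords_eq[OF arity_omega(1)[OF r] s s'(1,2)]
  have "large (\<lambda>i. coords (arity Sg r) s i = coords (arity Sg r) s' i \<and>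
      coords (arity Sg r) s' i \<in> elts (rel_int (app A i) r))"
    by (intro large_conj eq s'(3) small_coords_rel r s'(1))
  moreover have "small {i \<in> elts I. coords (arity Sg r) s i = coords (arity Sg r) s' i \<and>
      coords (arity Sg r) s' i \<in> elts (rel_int (app A i) r)}"
    by (rule small_Collect_cong[OF small_elts[of I],
        where Q' = "\<lambda>i. lam (arity Sg r) (\<lambda>k. ap (ap s k) i) = lam (arity Sg r) (\<lambda>k. ap (ap s' k) i) \<and>
          lam (arity Sg r) (\<lambda>k. ap (ap s' k) i) \<in> elts (ap (fst_of (snd_of (app A i))) r)"])
      (intro df dft_app func_A, auto simp: coords_ap[OF s] coords_ap[OF s'(1)] rel_int_ap[OF structures])
  ultimately show "large (\<lambda>i. coords (arity Sg r) s i \<in> elts (rel_int (app A i) r))"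
    using small_coords_rel[OF r s] by (rule large_mono) simp
next
  assume "large (\<lambda>i. coords (arity Sg r) s i \<in> elts (rel_int (app A i) r))"
  then show "mod_classes I A F (arity Sg r) s \<in> elts (rel_int RP r)"
    unfolding rel_int_RP[OF r] elts_red_rel using s by blast
qed

definition quot :: 'v where
  "quot = lam PA cls"

lemma quot_app: "a \<in> elts PA \<Longrightarrow> app quot a = cls a"
  and quot_hom: "fun_hom quot direct_product RP"
proof -
  have set: "set_fun PA cls"
    by (rule set_funI_cong[of cls']) (intro df, rule cls_eq)
  show app: "app quot a = cls a" if "a \<in> elts PA" for a
    unfolding quot_def by (rule app_lam[OF set that])
  show "fun_hom quot direct_product RP"
    unfolding fun_hom_def carrier_direct_product carrier_RP
  proof (intro conjI ballI allI impI)
    show "maps quot PA (red_carrier I A F)"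
      unfolding quot_def by (rule maps_lam[OF set]) (simp add: elts_red_carrier)
    fix f s assume f: "f \<in> elts (fun_syms Sg)" and s: "maps s (arity Sg f) PA"
    have "lam (arity Sg f) (\<lambda>k. app quot (app s k)) = mod_classes I A F (arity Sg f) s"
      unfolding mod_classes_def by (rule lam_cong) (simp_all add: app maps_app[OF s])
    then show "app quot (app (fun_int direct_product f) s) =
        app (fun_int RP f) (lam (arity Sg f) (\<lambda>k. app quot (app s k)))"
      by (simp add: fun_int_direct_product[OF f s] app pointwise_Prod[OF f s] fun_int_RP[OF f] red_fun_app[OF f s])
  qed
qed

end

section \<open>Truth of quasi-identities in reduced products\<close>

context signature
begin

definition atomic_over :: "'v \<Rightarrow> 'v \<Rightarrow> bool" where
  "atomic_over V a \<longleftrightarrow>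
     (\<exists>s \<in> elts (terms_over V). \<exists>t \<in> elts (terms_over V). a = eq_fm s t) \<or>
     (\<exists>r \<in> elts (rel_syms Sg). \<exists>ts. maps ts (arity Sg r) (terms_over V) \<and> a = rel_fm r ts)"

lemma dfp_atomic_over [df]: "dft S \<Longrightarrow> dft T \<Longrightarrow> dfp (\<lambda>e. atomic_over (S e) (T e))"
  by (rule dfp2[where P = atomic_over]) (unfold atomic_over_def, intro df)

lemma atomic_over_mono:
  assumes "atomic_over V a" "elts V \<subseteq> elts W" "elts W \<subseteq> elts omega"
  shows "atomic_over W a"
  using assms(1) maps_mono[OF _ terms_over_mono[OF assms(2,3)]] terms_over_mono[OF assms(2,3)]
  unfolding atomic_over_def by blast

lemma is_atomic_over: "is_atomic Sg a \<longleftrightarrow> atomic_over omega a"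
  by (simp add: is_atomic_def atomic_over_def terms_eq)

lemma atomic_bounded:
  assumes "is_atomic Sg a"
  shows "\<exists>N\<in>elts omega. atomic_over N a"
proof -
  from assms consider s t where "s \<in> elts (terms Sg)" "t \<in> elts (terms Sg)" "a = eq_fm s t"
    | r ts where "r \<in> elts (rel_syms Sg)" "maps ts (arity Sg r) (terms Sg)" "a = rel_fm r ts"
    unfolding is_atomic_def by blast
  then show ?thesis
  proof cases
    case 1
    obtain M N where MN: "M \<in> elts omega" "s \<in> elts (terms_over M)" "N \<in> elts omega" "t \<in> elts (terms_over N)"
      using terms_bounded[OF 1(1)] terms_bounded[OF 1(2)] by blast
    obtain L where L: "L \<in> elts omega" "elts M \<subseteq> elts L" "elts N \<subseteq> elts L"
      using omega_directed[OF MN(1,3)] by blast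
    have "s \<in> elts (terms_over L)" "t \<in> elts (terms_over L)"
      using MN terms_over_mono[OF L(2) omega_subset[OF L(1)]] terms_over_mono[OF L(3) omega_subset[OF L(1)]]
      by blast+
    then show ?thesis using L(1) 1(3) unfolding atomic_over_def by blast
  next
    case 2
    have mono: "app ts k \<in> elts (terms_over M)"
      if "app ts k \<in> elts (terms_over N)" "N \<in> elts omega" "M \<in> elts omega" "elts N \<subseteq> elts M" for k N M
      using that terms_over_mono omega_subset by blast
    have "dfp (\<lambda>e. app ts (e 0) \<in> elts (terms_over (e 1)))"
      by (intro df dft_app maps_func[OF 2(2)])
    then obtain N where N: "N \<in> elts omega" "\<And>k. k \<in> elts (arity Sg r) \<Longrightarrow> app ts k \<in> elts (terms_over N)"
      using finite_bound[OF arity_omega(1)[OF 2(1)], of "\<lambda>k N. app ts k \<in> elts (terms_over N)"]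
        terms_bounded[OF maps_app[OF 2(2)]] mono by blast
    then have "maps ts (arity Sg r) (terms_over N)" using 2(2) by (simp add: maps_def)
    then show ?thesis using N(1) 2(1,3) unfolding atomic_over_def by blast
  qed
qed

end

context filtered_family
begin

text \<open>For atomic formulas in finitely many variables, truth in the reduced product is truth at
  a large set of indices. The finitely many premises thus hold together at a large set, and at each
  of its indices the factor forces the conclusion.\<close>

lemma reduced_product_models:
  assumes q: "quasi_identity Sg \<phi>" and mod: "\<And>i. i \<in> elts I \<Longrightarrow> models Sg (app A i) \<phi>"
  shows "models Sg RP \<phi>"
  unfolding models_iff
proof (intro allI impI)
  fix h
  assume h: "maps h omega (carrier RP)"
    and prem: "\<forall>k a. pair k (neg_lit a) \<in> elts \<phi> \<longrightarrow> sat_atomic Sg RP h a"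
  obtain n where n: "n \<in> elts omega" "fun_on \<phi> (succ n)"
    and lits: "\<And>k l. pair k l \<in> elts \<phi> \<Longrightarrow> \<exists>a. is_atomic Sg a \<and> (l = pos_lit a \<or> l = neg_lit a)"
    and uniq: "\<And>k a j b. pair k (pos_lit a) \<in> elts \<phi> \<Longrightarrow> pair j (pos_lit b) \<in> elts \<phi> \<Longrightarrow> a = b"
    using quasi_identity_literals[OF q] by blast
  \<comment> \<open>A bound on the variables of the literal at position \<open>k\<close>;
    \<open>finite_bound\<close> turns these bounds into a single \<open>N\<close> for the whole
    formula.\<close>
  define over where "over k N \<longleftrightarrow> (\<forall>a. pair k (pos_lit a) \<in> elts \<phi> \<or> pair k (neg_lit a) \<in> elts \<phi> \<longrightarrow>
      atomic_over N a)" for k N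
  have "\<exists>N\<in>elts omega. over k N" if k: "k \<in> elts (succ n)" for k
  proof -
    obtain a where a: "is_atomic Sg a" "app \<phi> k = pos_lit a \<or> app \<phi> k = neg_lit a"
      using lits[of k "app \<phi> k"] k unfolding pair_mem_fun[OF n(2)] by blast
    then have "b = a" if "pair k (pos_lit b) \<in> elts \<phi> \<or> pair k (neg_lit b) \<in> elts \<phi>" for b
      using that unfolding pair_mem_fun[OF n(2)] by (metis lit_inject)
    then show ?thesis unfolding over_def using atomic_bounded[OF a(1)] by blast
  qed
  moreover have "dfp (\<lambda>e. over (e 0) (e 1))" unfolding over_def by (intro df)
  moreover have "over k M" if "over k N" "N \<in> elts omega" "M \<in> elts omega" "elts N \<subseteq> elts M" for k N M
    using that atomic_over_mono[OF _ that(4) omega_subset[OF that(3)]] unfolding over_def by blast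
  ultimately obtain N where N: "N \<in> elts omega" "\<And>k. k \<in> elts (succ n) \<Longrightarrow> over k N"
    using finite_bound[OF succ_omega[OF n(1)], of over] by blast
  then have atom_N: "atomic_over N a" if "pair k (pos_lit a) \<in> elts \<phi> \<or> pair k (neg_lit a) \<in> elts \<phi>" for k a
    using that unfolding over_def pair_mem_fun[OF n(2)] by blast

  have "\<exists>a. a \<in> elts PA \<and> app h m = cls' a" if "m \<in> elts N" for m
    using maps_app[OF h omega_trans[OF N(1) that]] cls_eq by (auto simp: elts_red_carrier)
  moreover have "dfp (\<lambda>e. e 1 \<in> elts PA \<and> app h (e 0) = cls' (e 1))"
    by (intro df dft_app maps_func[OF h])
  ultimately obtain g where g: "fun_on g N"
    "\<And>m. m \<in> elts N \<Longrightarrow> app g m \<in> elts PA \<and> app h m = cls' (app g m)"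
    using finite_choice[OF N(1), of "\<lambda>m a. a \<in> elts PA \<and> app h m = cls' a"] by auto
  obtain c where c: "c \<in> elts PA" using product_nonempty by blast
  \<comment> \<open>Representatives are chosen for the variables below \<open>N\<close> only. All
    others get the default \<open>c\<close>, on which no term of the formula depends.\<close>
  define h' where "h' = lam omega (\<lambda>m. if m \<in> elts N then app g m else c)"
  have set_h': "set_fun omega (\<lambda>m. if m \<in> elts N then app g m else c)"
    by (intro set_funI df dft_app fun_on_func[OF g(1)])
  have h': "maps h' omega (carrier direct_product)"
    unfolding h'_def carrier_direct_product by (rule maps_lam[OF set_h']) (simp add: g(2) c)
  have h'_N: "app h m = app quot (app h' m)" if "m \<in> elts N" for m
    unfolding h'_def app_lam[OF set_h' omega_trans[OF N(1) that]]
    using g(2)[OF that] that by (simp add: quot_app cls_eq)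

  note DP = is_structure_direct_product
  \<comment> \<open>Terms are evaluated once, in the direct product. A coordinate of the result is
    the value in that factor, and its class is the value in the reduced product.\<close>
  define E where "E = evaluation direct_product h'"
  have E: "maps E (terms Sg) PA"
    using evaluation_maps[OF DP h'] by (simp add: E_def carrier_direct_product)
  have val_RP: "term_val Sg RP h t = cls (app E t)" if "t \<in> elts (terms_over N)" for t
  proof -
    have "term_val Sg RP h t = app quot (term_val Sg direct_product h' t)"
      by (rule term_val_hom[OF DP h' is_structure_RP h quot_hom omega_subset[OF N(1)] h'_N that])
    then show ?thesis
      using quot_app[OF maps_app[OF E terms_over_omega[OF omega_subset[OF N(1)] that]]]
      by (simp add: term_val_eq E_def)
  qed
  define hh where "hh i = lam omega (\<lambda>n. app (proj i) (app h' n))" for i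
  have hh: "maps (hh i) omega (carrier (app A i))" if "i \<in> elts I" for i
    unfolding hh_def
    by (rule term_val_hom_total(1)[OF DP h' structures[OF that] proj_hom[OF that] terms_var[OF zero_omega]])
  have val_A: "term_val Sg (app A i) (hh i) t = app (app E t) i"
    if i: "i \<in> elts I" and t: "t \<in> elts (terms Sg)" for i t
    using term_val_hom_total(2)[OF DP h' structures[OF i] proj_hom[OF i] t]
      proj_app[OF i maps_app[OF E t]]
    by (simp add: hh_def E_def term_val_eq)

  \<comment> \<open>\<open>S a i\<close> expresses truth of \<open>a\<close> in the factor at
    \<open>i\<close> through the one set function \<open>E\<close>. This makes it definable in
    \<open>a\<close> and \<open>i\<close> jointly, as the sets of indices below require.\<close>
  define S where "S a i \<longleftrightarrow> (\<exists>s t. a = eq_fm s t \<and> ap (app E s) i = ap (app E t) i) \<or>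
     (\<exists>r ts. a = rel_fm r ts \<and>
        lam (arity Sg r) (\<lambda>k. ap (app E (ap ts k)) i) \<in> elts (ap (fst_of (snd_of (app A i))) r))" for a i
  have S_dfp: "dft U \<Longrightarrow> dft V \<Longrightarrow> dfp (\<lambda>e. S (U e) (V e))" for U V
    by (rule dfp2[where P = S])
      (unfold S_def, intro df dft_app maps_func[OF E] func_A)
  have app_E: "app (app E t) i = ap (app E t) i" if "t \<in> elts (terms Sg)" for t i
    by (rule app_eq_ap[OF Prod_func[OF maps_app[OF E that]]])
  have S_sat: "S a i \<longleftrightarrow> sat_atomic Sg (app A i) (hh i) a" if i: "i \<in> elts I" and a: "is_atomic Sg a" for a i
  proof -
    have "lam (arity Sg r) (\<lambda>k. ap (app E (ap ts k)) i) =
        lam (arity Sg r) (\<lambda>k. term_val Sg (app A i) (hh i) (app ts k))"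
      if "maps ts (arity Sg r) (terms Sg)" for r ts
      using maps_app[OF that]
      by (intro lam_cong) (simp_all add: val_A[OF i] app_E flip: app_eq_ap[OF maps_func[OF that]])
    then show ?thesis
      using a unfolding is_atomic_def S_def
      by (auto simp: val_A[OF i] app_E rel_int_ap[OF structures[OF i]])
  qed
  have S_small: "small {i \<in> elts I. S a i}" for a
    by (intro small_sep S_dfp df)
  have los: "sat_atomic Sg RP h a \<longleftrightarrow> large (S a)" if a: "atomic_over N a" for a
  proof -
    have sub: "t \<in> elts (terms Sg)" if "t \<in> elts (terms_over N)" for t
      using terms_over_omega[OF omega_subset[OF N(1)] that] .
    from a consider s t where "s \<in> elts (terms_over N)" "t \<in> elts (terms_over N)" "a = eq_fm s t"
      | r ts where "r \<in> elts (rel_syms Sg)" "maps ts (arity Sg r) (terms_over N)" "a = rel_fm r ts"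
      unfolding atomic_over_def by blast
    then show ?thesis
    proof cases
      case 1
      then have "sat_atomic Sg RP h a \<longleftrightarrow> large (\<lambda>i. app (app E s) i = app (app E t) i)"
        using cls_eq_iff[OF maps_app[OF E sub] maps_app[OF E sub]] by (simp add: val_RP eq_mod_iff)
      also have "\<dots> \<longleftrightarrow> large (S a)"
        by (rule large_cong) (use 1 in \<open>simp add: S_def app_E sub\<close>)
      finally show ?thesis .
    next
      case 2
      have ts: "maps ts (arity Sg r) (terms Sg)"
        using maps_mono[OF 2(2)] sub by blast
      let ?s = "lam (arity Sg r) (\<lambda>k. app E (app ts k))"
      note s = lam_comp[OF E ts]
      have "lam (arity Sg r) (\<lambda>k. term_val Sg RP h (app ts k)) = mod_classes I A F (arity Sg r) ?s"
        unfolding mod_classes_def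
        by (rule lam_cong) (simp_all add: app_lam[OF s(1)] val_RP maps_app[OF 2(2)])
      then have "sat_atomic Sg RP h a \<longleftrightarrow>
          large (\<lambda>i. coords (arity Sg r) ?s i \<in> elts (rel_int (app A i) r))"
        using rel_RP[OF 2(1) s(2)] 2(3) by simp
      also have "\<dots> \<longleftrightarrow> large (S a)"
      proof (rule large_cong)
        fix i assume i: "i \<in> elts I"
        have "coords (arity Sg r) ?s i = lam (arity Sg r) (\<lambda>k. ap (app E (ap ts k)) i)"
          unfolding coords_def
          by (rule lam_cong)
            (simp_all add: app_lam[OF s(1)] app_E maps_app[OF ts] flip: app_eq_ap[OF maps_func[OF ts]])
        then show "coords (arity Sg r) ?s i \<in> elts (rel_int (app A i) r) \<longleftrightarrow> S a i"
          using 2(3) by (simp add: S_def rel_int_ap[OF structures[OF i]])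
      qed
      finally show ?thesis .
    qed
  qed

  \<comment> \<open>The premises are indexed by the positions in the formula, that is by a natural
    number of the model. At a position without a negative literal the condition is vacuous.\<close>
  define Q where "Q k i \<longleftrightarrow> (\<forall>b. pair k (neg_lit b) \<in> elts \<phi> \<longrightarrow> S b i)" for k i
  have Q_dfp: "dfp (\<lambda>e. Q (e 0) (e 1))"
    unfolding Q_def by (intro df S_dfp)
  have Q_small: "small {i \<in> elts I. \<forall>k\<in>elts (succ n). Q k i}"
    by (intro small_sep df dfp2[where P = Q, OF Q_dfp])
  have "large (\<lambda>i. \<forall>k\<in>elts (succ n). Q k i)"
  proof (rule large_finite[OF succ_omega[OF n(1)] Q_dfp])
    fix k
    show "large (Q k)"
    proof (cases "\<exists>b. pair k (neg_lit b) \<in> elts \<phi>")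
      case True
      then obtain b where b: "pair k (neg_lit b) \<in> elts \<phi>" by blast
      then have "Q k = S b"
        unfolding Q_def pair_mem_fun[OF n(2)] fun_eq_iff by (metis lit_inject(2))
      then show ?thesis using b prem los[OF atom_N] by metis
    next
      case False
      then have "Q k = (\<lambda>i. True)" by (auto simp: Q_def)
      then show ?thesis by (simp add: large_True)
    qed
  qed
  moreover obtain k0 a0 where a0: "pair k0 (pos_lit a0) \<in> elts \<phi>" "is_atomic Sg a0"
    using quasi_identity_conclusion[OF q] .
  moreover have "S a0 i" if i: "i \<in> elts I" and Qi: "\<forall>k\<in>elts (succ n). Q k i" for i
  proof -
    have "\<forall>k b. pair k (neg_lit b) \<in> elts \<phi> \<longrightarrow> sat_atomic Sg (app A i) (hh i) b"
    proof (intro allI impI)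
      fix k b assume kb: "pair k (neg_lit b) \<in> elts \<phi>"
      then have "S b i" using Qi unfolding Q_def pair_mem_fun[OF n(2)] by blast
      moreover have "is_atomic Sg b" using lits[OF kb] by auto
      ultimately show "sat_atomic Sg (app A i) (hh i) b" using S_sat[OF i] by blast
    qed
    \<comment> \<open>The true disjunct found at \<open>i\<close> could vary with \<open>i\<close>,
      but all positive literals of the formula contain the same atomic formula
      \<open>a0\<close>.\<close>
    then obtain k a where "pair k (pos_lit a) \<in> elts \<phi>" "sat_atomic Sg (app A i) (hh i) a"
      using mod[OF i] hh[OF i] unfolding models_iff by blast
    then show ?thesis using uniq[OF _ a0(1)] S_sat[OF i a0(2)] by blast
  qed
  ultimately have "large (S a0)"
    using large_mono[OF _ Q_small S_small, of a0] by blast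
  then show "\<exists>k a. pair k (pos_lit a) \<in> elts \<phi> \<and> sat_atomic Sg RP h a"
    using a0(1) los[OF atom_N] by blast
qed

end

context signature
begin

section \<open>Axiomatizing closed classes\<close>

lemma dfp_lit_preds [df]:
  shows "dft S \<Longrightarrow> dfp (\<lambda>e. is_atomic Sg (S e))"
    and "dft S \<Longrightarrow> dfp (\<lambda>e. is_pos_lit Sg (S e))"
    and "dft S \<Longrightarrow> dfp (\<lambda>e. is_neg_lit Sg (S e))"
proof -
  have a: "dft S \<Longrightarrow> dfp (\<lambda>e. is_atomic Sg (S e))" for S
    unfolding is_atomic_over by (intro df)
  show "dft S \<Longrightarrow> dfp (\<lambda>e. is_atomic Sg (S e))" by (rule a)
  show "dft S \<Longrightarrow> dfp (\<lambda>e. is_pos_lit Sg (S e))"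
    by (rule dfp1[where P = "is_pos_lit Sg"]) (unfold is_pos_lit_def, intro df a)
  show "dft S \<Longrightarrow> dfp (\<lambda>e. is_neg_lit Sg (S e))"
    by (rule dfp1[where P = "is_neg_lit Sg"]) (unfold is_neg_lit_def, intro df a)
qed

lemma quasi_identity_ap:
  "quasi_identity Sg \<phi> \<longleftrightarrow> (\<exists>n \<in> elts omega. fun_on \<phi> (succ n) \<and>
     (\<forall>k \<in> elts (succ n). is_pos_lit Sg (ap \<phi> k) \<or> is_neg_lit Sg (ap \<phi> k)) \<and>
     (\<forall>j \<in> elts (succ n). \<forall>k \<in> elts (succ n).
        is_pos_lit Sg (ap \<phi> j) \<and> is_pos_lit Sg (ap \<phi> k) \<longrightarrow> j = k)) \<and>
     (\<exists>k l. pair k l \<in> elts \<phi> \<and> is_pos_lit Sg l)"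
proof -
  show ?thesis
  proof (cases "func \<phi>")
    case True
    show ?thesis unfolding quasi_identity_def basic_horn_def app_eq_ap[OF True] ..
  next
    case False
    then have "\<not> fun_on \<phi> n" for n using fun_on_func by blast
    then show ?thesis unfolding quasi_identity_def basic_horn_def by simp
  qed
qed

lemma dfp_quasi_identity: "dfp (\<lambda>e. quasi_identity Sg (e 0))"
  unfolding quasi_identity_ap by (intro df)

definition is_evaluation' :: "'v \<Rightarrow> 'v \<Rightarrow> 'v \<Rightarrow> bool" where
  "is_evaluation' A h ev \<longleftrightarrow> maps ev (terms Sg) (carrier A) \<and>
     (\<forall>n \<in> elts omega. ap ev (var n) = ap h n) \<and>
     (\<forall>f \<in> elts (fun_syms Sg). \<forall>ts. maps ts (arity Sg f) (terms Sg) \<longrightarrow>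
        ap ev (fapp f ts) = ap (ap (snd_of (snd_of A)) f) (lam (arity Sg f) (\<lambda>k. ap ev (ap ts k))))"

definition sat_atomic' :: "'v \<Rightarrow> 'v \<Rightarrow> 'v \<Rightarrow> bool" where
  "sat_atomic' A ev a \<longleftrightarrow> (\<exists>s t. a = eq_fm s t \<and> ap ev s = ap ev t) \<or>
     (\<exists>r ts. a = rel_fm r ts \<and>
        lam (arity Sg r) (\<lambda>k. ap ev (ap ts k)) \<in> elts (ap (fst_of (snd_of A)) r))"

lemma is_evaluation_ap:
  assumes A: "is_structure Sg A" and h: "maps h omega (carrier A)"
  shows "is_evaluation Sg A h ev \<longleftrightarrow> is_evaluation' A h ev"
proof (cases "maps ev (terms Sg) (carrier A)")
  case True
  have "app (fun_int A f) (lam (arity Sg f) (\<lambda>k. app ev (app ts k))) =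
      ap (ap (snd_of (snd_of A)) f) (lam (arity Sg f) (\<lambda>k. ap ev (ap ts k)))"
    if "f \<in> elts (fun_syms Sg)" "maps ts (arity Sg f) (terms Sg)" for f ts
    using app_fun_int_ap[OF A that(1)] app_eq_ap[OF maps_func[OF True]] app_eq_ap[OF maps_func[OF that(2)]]
    by simp
  then show ?thesis
    using True app_eq_ap[OF maps_func[OF True]] app_eq_ap[OF maps_func[OF h]]
    unfolding is_evaluation_def is_evaluation'_def by simp
next
  case False
  then show ?thesis unfolding is_evaluation_def is_evaluation'_def by simp
qed

lemma sat_atomic_ap:
  assumes A: "is_structure Sg A" and h: "maps h omega (carrier A)" and a: "is_atomic Sg a"
  shows "sat_atomic Sg A h a \<longleftrightarrow> sat_atomic' A (evaluation A h) a"
proof -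
  note ev = app_eq_ap[OF maps_func[OF evaluation_maps[OF A h]]]
  have "lam (arity Sg r) (\<lambda>k. term_val Sg A h (app ts k)) =
      lam (arity Sg r) (\<lambda>k. ap (evaluation A h) (ap ts k))" if "maps ts (arity Sg r) (terms Sg)" for r ts
    using app_eq_ap[OF maps_func[OF that]] by (simp add: term_val_eq ev)
  then show ?thesis
    using a unfolding is_atomic_def sat_atomic'_def
    by (auto simp: rel_int_ap[OF A] term_val_eq ev)
qed

text \<open>The official notion of truth passes through a description of the evaluation and through
  \<open>app\<close>. Since exactly one evaluation exists, it can be quantified over instead, and
  the result is definable in the structure and the formula together.\<close>

lemma models_ap:
  assumes A: "is_structure Sg A" and q: "quasi_identity Sg \<phi>"
  shows "models Sg A \<phi> \<longleftrightarrow> (\<forall>h. maps h omega (carrier A) \<longrightarrow> (\<exists>ev. is_evaluation' A h ev \<and>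
    (\<exists>k a. pair k (pos_lit a) \<in> elts \<phi> \<and> sat_atomic' A ev a \<or>
       pair k (neg_lit a) \<in> elts \<phi> \<and> \<not> sat_atomic' A ev a)))"
proof -
  have "is_atomic Sg a" if "pair k (pos_lit a) \<in> elts \<phi> \<or> pair k (neg_lit a) \<in> elts \<phi>" for k a
    using quasi_identity_literals[OF q] that by (metis lit_inject)
  then have "(\<exists>k l. pair k l \<in> elts \<phi> \<and> sat_lit Sg A h l) \<longleftrightarrow> (\<exists>ev. is_evaluation' A h ev \<and>
    (\<exists>k a. pair k (pos_lit a) \<in> elts \<phi> \<and> sat_atomic' A ev a \<or>
       pair k (neg_lit a) \<in> elts \<phi> \<and> \<not> sat_atomic' A ev a))" if h: "maps h omega (carrier A)" for h
    using sat_atomic_ap[OF A h] is_evaluation_ap[OF A h] is_evaluation_evaluation[OF A h]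
      evaluation_eqI[of A h] unfolding sat_lit_def by metis
  then show ?thesis unfolding models_def by blast
qed

lemma small_atomic: "small {a. is_atomic Sg a}"
proof (rule small_Collect)
  let ?T = "elts (terms Sg)"
  let ?RT = "pairs (elts (rel_syms Sg)) {t. elts t \<subseteq> pairs (elts omega) ?T}"
  show "small (pairs {zero} (pairs ?T ?T) \<union> pairs {one} ?RT)"
    by (intro small_Un small_pairs small_Pow small_elts small_insert small_empty)
  show "a \<in> pairs {zero} (pairs ?T ?T) \<union> pairs {one} ?RT" if "is_atomic Sg a" for a
    using that unfolding is_atomic_def eq_fm_def rel_fm_def
  proof (elim disjE bexE exE conjE)
    fix r ts assume "r \<in> elts (rel_syms Sg)" "maps ts (arity Sg r) (terms Sg)" "a = pair one (pair r ts)"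
    then show ?thesis using tuple_subset_pairs[OF _ arity_omega(1) order_refl] by simp
  qed simp
qed (intro df)

definition theory_of :: "'v set \<Rightarrow> 'v" where
  "theory_of K = mk {\<phi>. quasi_identity Sg \<phi> \<and> (\<forall>A\<in>K. models Sg A \<phi>)}"

text \<open>Quasi-identities are bounded by a power set over the literals, from which separation
  cuts out the theory. The separating formula quantifies over all of \<open>K\<close>, which is
  possible because \<open>K\<close> is definable.\<close>

lemma elts_theory_of:
  assumes K: "definable_class K" "\<And>A. A \<in> K \<Longrightarrow> is_structure Sg A"
  shows "elts (theory_of K) = {\<phi>. quasi_identity Sg \<phi> \<and> (\<forall>A\<in>K. models Sg A \<phi>)}"
proof -
  let ?At = "{a. is_atomic Sg a}"
  let ?L = "pairs {zero, one} ?At"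
  let ?F = "{\<phi>. elts \<phi> \<subseteq> pairs (elts omega) ?L}"
  let ?Q = "\<lambda>\<phi>. quasi_identity Sg \<phi> \<and> (\<forall>A. A \<in> K \<longrightarrow> (\<forall>h. maps h omega (carrier A) \<longrightarrow>
    (\<exists>ev. is_evaluation' A h ev \<and> (\<exists>k a. pair k (pos_lit a) \<in> elts \<phi> \<and> sat_atomic' A ev a \<or>
       pair k (neg_lit a) \<in> elts \<phi> \<and> \<not> sat_atomic' A ev a))))"
  have "small ?F"
    by (intro small_Pow small_pairs small_elts small_insert small_empty small_atomic)
  moreover have "dfp (\<lambda>e. ?Q (e 0))"
    unfolding is_evaluation'_def sat_atomic'_def
    by (intro df dfp_quasi_identity dfp_class[OF K(1)])
  moreover have "\<phi> \<in> ?F" if Q: "?Q \<phi>" for \<phi>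
  proof -
    obtain n where n: "n \<in> elts omega" "fun_on \<phi> (succ n)"
      "\<And>k l. pair k l \<in> elts \<phi> \<Longrightarrow> \<exists>a. is_atomic Sg a \<and> (l = pos_lit a \<or> l = neg_lit a)"
      using quasi_identity_literals[OF conjunct1[OF Q]] by metis
    have "app \<phi> k \<in> ?L" if "k \<in> elts (succ n)" for k
      using n(3)[of k "app \<phi> k"] that unfolding pair_mem_fun[OF n(2)] pos_lit_def neg_lit_def by auto
    then show ?thesis
      using fun_subset_pairs[OF n(2) omega_subset[OF succ_omega[OF n(1)]], of ?L] by simp
  qed
  ultimately have "small {\<phi>. ?Q \<phi>}" by (rule small_Collect)
  moreover have "{\<phi>. ?Q \<phi>} = {\<phi>. quasi_identity Sg \<phi> \<and> (\<forall>A\<in>K. models Sg A \<phi>)}"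
    using models_ap[OF K(2)] by blast
  ultimately show ?thesis unfolding theory_of_def by (simp add: elts_mk)
qed

text \<open>
  Up to isomorphism, the subalgebra generated by an assignment \<open>h\<close> has the classes of terms with
  the same value as elements. This bounds the structures that are needed without ranks.
\<close>

lemma term_copy:
  assumes B: "is_structure Sg B" and h: "maps h omega (carrier B)"
  obtains C j h' where "is_structure Sg C" "embedding j C B"
    "elts (carrier C) \<subseteq> {x. elts x \<subseteq> elts (terms Sg)}" "maps h' omega (carrier C)"
    "\<And>a. is_atomic Sg a \<Longrightarrow> sat_atomic Sg C h' a \<longleftrightarrow> sat_atomic Sg B h a"
proof -
  let ?v = "term_val Sg B h"
  note dft_v = dft_term_val[OF B h]
  define cl where "cl t = mk {t'. t' \<in> elts (terms Sg) \<and> ?v t' = ?v t}" for t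
  have dft_cl: "dft S \<Longrightarrow> dft (\<lambda>e. cl (S e))" for S
    by (rule dft1[where F = cl]) (unfold cl_def, intro df dft_v)
  have elts_cl: "elts (cl t) = {t'. t' \<in> elts (terms Sg) \<and> ?v t' = ?v t}" for t
    unfolding cl_def by (intro elts_mk small_sep df dft_v)
  have cl_eq: "cl s = cl t \<longleftrightarrow> ?v s = ?v t" if "s \<in> elts (terms Sg)" for s t
  proof
    assume "cl s = cl t"
    then have "s \<in> elts (cl t)" using elts_cl[of s] that by auto
    then show "?v s = ?v t" by (simp add: elts_cl)
  qed (simp add: cl_def)
  define D where "D = mk (cl ` elts (terms Sg))"
  have D: "elts D = cl ` elts (terms Sg)"
    unfolding D_def by (intro elts_mk small_image small_elts dft_cl df)
  define j where "j = mk ((\<lambda>t. pair (cl t) (?v t)) ` elts (terms Sg))"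
  have elts_j: "elts j = (\<lambda>t. pair (cl t) (?v t)) ` elts (terms Sg)"
    unfolding j_def by (intro elts_mk small_image small_elts df dft_cl dft_v)
  have fun_j: "fun_on j D"
    unfolding fun_on_def elts_j D using cl_eq by auto
  have j_cl: "app j (cl t) = ?v t" if "t \<in> elts (terms Sg)" for t
    using pair_mem_fun[OF fun_j, of "cl t" "?v t"] that unfolding elts_j by auto
  have j: "maps j D (carrier B)"
    unfolding maps_def using fun_j j_cl term_val_closed[OF B h] D by auto
  have inj: "inj_on (app j) (elts D)"
    unfolding inj_on_def D using j_cl cl_eq by auto
  have closed: "\<forall>f\<in>elts (fun_syms Sg). \<forall>t. maps t (arity Sg f) D \<longrightarrow>
      (\<exists>d\<in>elts D. app j d = app (fun_int B f) (lam (arity Sg f) (\<lambda>k. app j (app t k))))"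
  proof (intro ballI allI impI)
    fix f t assume f: "f \<in> elts (fun_syms Sg)" and t: "maps t (arity Sg f) D"
    have "\<exists>s. s \<in> elts (terms Sg) \<and> app t k = cl s" if "k \<in> elts (arity Sg f)" for k
      using maps_app[OF t that] D by auto
    moreover have "dfp (\<lambda>e. e 1 \<in> elts (terms Sg) \<and> app t (e 0) = cl (e 1))"
      by (intro df dft_cl dft_app maps_func[OF t])
    \<comment> \<open>One term is picked from each class in the finite tuple; the class of the
      compound term built from them is the element required.\<close>
    ultimately obtain ts where ts: "fun_on ts (arity Sg f)"
      "\<And>k. k \<in> elts (arity Sg f) \<Longrightarrow> app ts k \<in> elts (terms Sg) \<and> app t k = cl (app ts k)"
      using finite_choice[OF arity_omega(2)[OF f], of "\<lambda>k s. s \<in> elts (terms Sg) \<and> app t k = cl s"] by auto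
    then have m: "maps ts (arity Sg f) (terms Sg)" by (simp add: maps_def)
    have "lam (arity Sg f) (\<lambda>k. app j (app t k)) = lam (arity Sg f) (\<lambda>k. ?v (app ts k))"
      by (rule lam_cong) (simp_all add: ts(2) j_cl)
    then have "app j (cl (fapp f ts)) = app (fun_int B f) (lam (arity Sg f) (\<lambda>k. app j (app t k)))"
      by (simp add: j_cl[OF terms_fapp[OF f m]] term_val_fapp[OF B h f m])
    then show "\<exists>d\<in>elts D. app j d = app (fun_int B f) (lam (arity Sg f) (\<lambda>k. app j (app t k)))"
      using D terms_fapp[OF f m] by blast
  qed
  have ne: "elts D \<noteq> {}" using D terms_var[OF zero_omega] by auto
  let ?C = "pullback B D j"
  note C = is_structure_pullback[OF B ne j inj closed] embedding_pullback[OF B ne j inj closed]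
    carrier_pullback[OF B ne j inj closed]
  define h' where "h' = lam omega (\<lambda>n. cl (var n))"
  have set: "set_fun omega (\<lambda>n. cl (var n))" by (intro set_funI df dft_cl)
  have h': "maps h' omega (carrier ?C)"
    unfolding h'_def C(3) by (rule maps_lam[OF set]) (auto simp: D intro: terms_var)
  have "lam omega (\<lambda>n. app j (app h' n)) = lam omega (app h)"
    unfolding h'_def by (rule lam_cong) (simp_all add: app_lam[OF set] j_cl terms_var term_val_var[OF B h])
  \<comment> \<open>\<open>h\<close> factors through the embedding \<open>j\<close>, so atomic
    formulas have the same truth value under \<open>h'\<close> in the copy as under \<open>h\<close>
    in \<open>B\<close>.\<close>
  then have hj: "lam omega (\<lambda>n. app j (app h' n)) = h"
    using lam_app[OF maps_fun_on[OF h]] by simp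
  show thesis
  proof (rule that[OF C(1,2) _ h'])
    show "elts (carrier ?C) \<subseteq> {x. elts x \<subseteq> elts (terms Sg)}"
      unfolding C(3) D by (auto simp: elts_cl)
    show "sat_atomic Sg ?C h' a \<longleftrightarrow> sat_atomic Sg B h a" if "is_atomic Sg a" for a
      using sat_atomic_embedding[OF C(1) h' B C(2) that] hj by simp
  qed
qed

end

section \<open>Indices and facts\<close>

locale closed_class = signature mem Sg for mem :: "'v \<Rightarrow> 'v \<Rightarrow> bool" and Sg +
  fixes K :: "'v set" and A :: 'v
  assumes definable: "definable_class K"
    and K_structure: "\<And>B. B \<in> K \<Longrightarrow> is_structure Sg B"
    and has_unit: "\<exists>U \<in> K. is_unit Sg U"
    and isos: "closed_under_isomorphisms Sg K"
    and subs: "closed_under_substructures Sg K"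
    and reds: "closed_under_reduced_products Sg K"
    and A_structure: "is_structure Sg A"
    and A_models: "\<And>\<phi>. quasi_identity Sg \<phi> \<Longrightarrow> (\<And>B. B \<in> K \<Longrightarrow> models Sg B \<phi>) \<Longrightarrow> models Sg A \<phi>"
begin

definition is_index :: "'v \<Rightarrow> bool" where
  "is_index i \<longleftrightarrow> (\<exists>B h. i = pair B h \<and> B \<in> K \<and> (\<forall>x\<in>elts (carrier B). elts x \<subseteq> elts (terms Sg)) \<and>
     maps h (carrier A) (carrier B))"

definition idx :: 'v where
  "idx = mk {i. is_index i}"

lemma elts_idx: "elts idx = {i. is_index i}"
proof -
  \<comment> \<open>Bounds, in this order, for elements, tuples, families of relations, families of
    operations and whole structures whose elements are sets of terms.\<close>
  let ?W = "{x. elts x \<subseteq> elts (terms Sg)}"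
  let ?T = "{t. elts t \<subseteq> pairs (elts omega) ?W}"
  let ?RI = "{u. elts u \<subseteq> pairs (elts (rel_syms Sg)) {x. elts x \<subseteq> ?T}}"
  let ?FI = "{u. elts u \<subseteq> pairs (elts (fun_syms Sg)) {x. elts x \<subseteq> pairs ?T ?W}}"
  let ?St = "pairs {x. elts x \<subseteq> ?W} (pairs ?RI ?FI)"
  have "small {i. is_index i}"
  proof (rule small_Collect)
    show "small (pairs ?St {h. elts h \<subseteq> pairs (elts (carrier A)) ?W})"
      by (intro small_pairs small_Pow small_elts)
    show "dfp (\<lambda>e. is_index (e 0))"
      unfolding is_index_def by (intro df dfp_class[OF definable])
    fix i assume "is_index i"
    then obtain B h where i: "i = pair B h" and B: "B \<in> K" "elts (carrier B) \<subseteq> ?W"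
      and h: "maps h (carrier A) (carrier B)"
      unfolding is_index_def by blast
    note S = K_structure[OF B(1)]
    have B_eq: "B = triple (carrier B) (fst_of (snd_of B)) (snd_of (snd_of B))"
      and RI: "fun_on (fst_of (snd_of B)) (rel_syms Sg)" and FI: "fun_on (snd_of (snd_of B)) (fun_syms Sg)"
      using S unfolding is_structure_iff by blast+
    have tuples: "t \<in> ?T" if "maps t n (carrier B)" "n \<in> elts omega" for t n
      using tuple_subset_pairs[OF that B(2)] by blast
    have "fst_of (snd_of B) \<in> ?RI"
    proof (rule CollectI, rule fun_subset_pairs[OF RI order_refl])
      fix r assume "r \<in> elts (rel_syms Sg)"
      then show "app (fst_of (snd_of B)) r \<in> {x. elts x \<subseteq> ?T}"
        using rel_int_maps[OF S] tuples arity_omega(1) unfolding rel_int_def by blast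
    qed
    moreover have "snd_of (snd_of B) \<in> ?FI"
    proof (rule CollectI, rule fun_subset_pairs[OF FI order_refl])
      fix f assume f: "f \<in> elts (fun_syms Sg)"
      note F = fun_int_maps[OF S f, unfolded fun_int_def]
      show "app (snd_of (snd_of B)) f \<in> {x. elts x \<subseteq> pairs ?T ?W}"
      proof (rule CollectI, rule fun_subset_pairs[OF maps_fun_on[OF F]])
        show "elts (tuples (carrier B) (arity Sg f)) \<subseteq> ?T"
          using tuples arity_omega(2)[OF f] unfolding elts_tuples by blast
      qed (use maps_app[OF F] B(2) in blast)
    qed
    ultimately have "B \<in> ?St"
      using B(2) by (subst B_eq) (simp add: triple_def)
    moreover have "elts h \<subseteq> pairs (elts (carrier A)) ?W"
      by (rule fun_subset_pairs[OF maps_fun_on[OF h]]) (use maps_app[OF h] B(2) in blast)+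
    ultimately show "i \<in> pairs ?St {h. elts h \<subseteq> pairs (elts (carrier A)) ?W}"
      by (simp add: i)
  qed
  then show ?thesis unfolding idx_def by (rule elts_mk)
qed

lemma idx_cases:
  assumes "i \<in> elts idx"
  obtains B h where "i = pair B h" "B \<in> K" "is_structure Sg B" "maps h (carrier A) (carrier B)"
  using assms K_structure unfolding elts_idx is_index_def by blast

definition fam :: 'v where
  "fam = lam idx fst_of"

lemma set_fam: "set_fun idx fst_of"
  by (intro set_funI df)

lemma fam_app: "i \<in> elts idx \<Longrightarrow> app fam i = fst_of i"
  unfolding fam_def by (rule app_lam[OF set_fam])

lemma fun_on_fam: "fun_on fam idx"
  unfolding fam_def by (rule fun_on_lam[OF set_fam])

lemma fam_K: "i \<in> elts idx \<Longrightarrow> app fam i \<in> K"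
  by (auto simp: fam_app elim: idx_cases)

text \<open>The point of the product with coordinate \<open>h(a)\<close> at the index
  \<open>(B, h)\<close>. Since \<open>A\<close> is nonempty, such points also make the product
  nonempty without any choice.\<close>

definition hat :: "'v \<Rightarrow> 'v" where
  "hat a = lam idx (\<lambda>i. ap (snd_of i) a)"

lemma dft_hat [df]: "dft S \<Longrightarrow> dft (\<lambda>e. hat (S e))"
  by (rule dft1[where F = hat]) (unfold hat_def, intro df)

lemma set_hat: "set_fun idx (\<lambda>i. ap (snd_of i) a)"
  by (intro set_funI df)

lemma hat_app: "i \<in> elts idx \<Longrightarrow> app (hat a) i = ap (snd_of i) a"
  unfolding hat_def by (rule app_lam[OF set_hat])

lemma hat_closed:
  assumes "a \<in> elts (carrier A)" "i \<in> elts idx"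
  shows "ap (snd_of i) a \<in> elts (carrier (fst_of i))"
  using assms(2)
proof (cases rule: idx_cases)
  case (1 B h)
  then show ?thesis using maps_app[OF 1(4) assms(1)] by (simp add: app_eq_ap[OF maps_func[OF 1(4)]])
qed

text \<open>
  A fact is a formula \<open>f(t) = b\<close> or \<open>r(t)\<close> about elements of \<open>A\<close>, coded with the tags \<open>zero\<close> and
  \<open>one\<close>. It is satisfied at an index \<open>(B, h)\<close> if it becomes true in \<open>B\<close> after applying \<open>h\<close>.
\<close>

definition is_fact :: "'v \<Rightarrow> bool" where
  "is_fact d \<longleftrightarrow>
    (\<exists>f\<in>elts (fun_syms Sg). \<exists>t. \<exists>b\<in>elts (carrier A). maps t (arity Sg f) (carrier A) \<and>
       d = pair zero (triple f t b)) \<or>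
    (\<exists>r\<in>elts (rel_syms Sg). \<exists>t. maps t (arity Sg r) (carrier A) \<and> d = pair one (pair r t))"

definition sat_fact :: "'v \<Rightarrow> 'v \<Rightarrow> bool" where
  "sat_fact i d \<longleftrightarrow>
    (\<exists>f t b. d = pair zero (triple f t b) \<and>
       ap (ap (snd_of (snd_of (fst_of i))) f) (lam (arity Sg f) (\<lambda>k. ap (snd_of i) (ap t k))) = ap (snd_of i) b) \<or>
    (\<exists>r t. d = pair one (pair r t) \<and>
       lam (arity Sg r) (\<lambda>k. ap (snd_of i) (ap t k)) \<in> elts (ap (fst_of (snd_of (fst_of i))) r))"

definition true_fact :: "'v \<Rightarrow> bool" where
  "true_fact d \<longleftrightarrow>
    (\<exists>f\<in>elts (fun_syms Sg). \<exists>t. maps t (arity Sg f) (carrier A) \<and>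
       d = pair zero (triple f t (ap (ap (snd_of (snd_of A)) f) t))) \<or>
    (\<exists>r\<in>elts (rel_syms Sg). \<exists>t. t \<in> elts (ap (fst_of (snd_of A)) r) \<and> d = pair one (pair r t))"

lemma dfp_sat_fact [df]: "dft S \<Longrightarrow> dft T \<Longrightarrow> dfp (\<lambda>e. sat_fact (S e) (T e))"
  by (rule dfp2[where P = sat_fact]) (unfold sat_fact_def, intro df)

lemma dfp_true_fact [df]: "dft S \<Longrightarrow> dfp (\<lambda>e. true_fact (S e))"
  by (rule dfp1[where P = true_fact]) (unfold true_fact_def, intro df)

lemma is_fact_true: "true_fact d \<Longrightarrow> is_fact d"
  unfolding true_fact_def is_fact_def
  using fun_int_closed[OF A_structure] rel_int_maps[OF A_structure]
  by (auto simp: app_fun_int_ap[OF A_structure] rel_int_ap[OF A_structure])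

lemma sat_fact_fun [simp]: "sat_fact i (pair zero (triple f t b)) \<longleftrightarrow>
    ap (ap (snd_of (snd_of (fst_of i))) f) (lam (arity Sg f) (\<lambda>k. ap (snd_of i) (ap t k))) = ap (snd_of i) b"
  by (simp add: sat_fact_def)

lemma sat_fact_rel [simp]: "sat_fact i (pair one (pair r t)) \<longleftrightarrow>
    lam (arity Sg r) (\<lambda>k. ap (snd_of i) (ap t k)) \<in> elts (ap (fst_of (snd_of (fst_of i))) r)"
  by (simp add: sat_fact_def)

text \<open>The element \<open>x\<close> of \<open>A\<close> is named by the variable with number \<open>v(x)\<close>.\<close>

definition fact_fm :: "'v \<Rightarrow> 'v \<Rightarrow> 'v" where
  "fact_fm v d = (if fst_of d = zero then
       eq_fm (fapp (fst_of (snd_of d)) (lam (arity Sg (fst_of (snd_of d)))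
         (\<lambda>k. var (ap v (ap (fst_of (snd_of (snd_of d))) k)))))
       (var (ap v (snd_of (snd_of (snd_of d)))))
     else rel_fm (fst_of (snd_of d)) (lam (arity Sg (fst_of (snd_of d))) (\<lambda>k. var (ap v (ap (snd_of (snd_of d)) k)))))"

lemma dft_fact_fm [df]: "dft S \<Longrightarrow> dft T \<Longrightarrow> dft (\<lambda>e. fact_fm (S e) (T e))"
  by (rule dft2[where F = fact_fm]) (unfold fact_fm_def, intro df)

lemma fact_fm_simps [simp]:
  "fact_fm v (pair zero (triple f t b)) = eq_fm (fapp f (lam (arity Sg f) (\<lambda>k. var (ap v (ap t k))))) (var (ap v b))"
  "fact_fm v (pair one (pair r t)) = rel_fm r (lam (arity Sg r) (\<lambda>k. var (ap v (ap t k))))"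
  by (simp_all add: fact_fm_def triple_def)

lemma var_tuple:
  assumes "maps v (carrier A) omega" "maps t n (carrier A)"
  shows "set_fun n (\<lambda>k. var (ap v (ap t k)))" "maps (lam n (\<lambda>k. var (ap v (ap t k)))) n (terms Sg)"
proof -
  show s: "set_fun n (\<lambda>k. var (ap v (ap t k)))" by (intro set_funI df)
  show "maps (lam n (\<lambda>k. var (ap v (ap t k)))) n (terms Sg)"
    using maps_app[OF assms(1) maps_app[OF assms(2)]]
    by (intro maps_lam[OF s] terms_var) (simp add: app_eq_ap[OF maps_func[OF assms(1)]] app_eq_ap[OF maps_func[OF assms(2)]])
qed

lemma is_atomic_fact_fm:
  assumes "is_fact d" "maps v (carrier A) omega"
  shows "is_atomic Sg (fact_fm v d)"
  using assms(1) unfolding is_fact_def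
proof (elim disjE bexE exE conjE)
  fix f t b assume f: "f \<in> elts (fun_syms Sg)" "b \<in> elts (carrier A)" "maps t (arity Sg f) (carrier A)"
    "d = pair zero (triple f t b)"
  have "ap v b \<in> elts omega"
    using maps_app[OF assms(2) f(2)] by (simp add: app_eq_ap[OF maps_func[OF assms(2)]])
  then show ?thesis
    unfolding is_atomic_def f(4) fact_fm_simps
    using terms_fapp[OF f(1) var_tuple(2)[OF assms(2) f(3)]] terms_var by blast
next
  fix r t assume "r \<in> elts (rel_syms Sg)" "maps t (arity Sg r) (carrier A)" "d = pair one (pair r t)"
  then show ?thesis
    unfolding is_atomic_def using var_tuple(2)[OF assms(2)] by auto
qed

text \<open>The formula of a fact under the assignment \<open>k\<close> says the same as the fact at
  the map \<open>k\<close> after \<open>v\<close>. This is true for every numbering, even if it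
  gives different elements the same variable.\<close>

lemma sat_fact_fm:
  assumes B: "is_structure Sg B" "maps k omega (carrier B)" and v: "maps v (carrier A) omega"
    and d: "is_fact d"
  shows "sat_atomic Sg B k (fact_fm v d) \<longleftrightarrow> sat_fact (pair B (lam (carrier A) (\<lambda>x. app k (app v x)))) d"
proof -
  let ?h = "lam (carrier A) (\<lambda>x. app k (app v x))"
  note h = lam_comp[OF B(2) v]
  have val: "term_val Sg B k (var (ap v x)) = ap ?h x" if "x \<in> elts (carrier A)" for x
    unfolding app_eq_ap[OF maps_func[OF v], symmetric] app_eq_ap[OF maps_func[OF h(2)], symmetric]
    by (simp only: term_val_var[OF B maps_app[OF v that]] app_lam[OF h(1) that])
  have tup: "lam n (\<lambda>j. term_val Sg B k (app (lam n (\<lambda>j. var (ap v (ap t j)))) j)) = lam n (\<lambda>j. ap ?h (ap t j))"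
    if t: "maps t n (carrier A)" for t n
  proof (rule lam_cong)
    fix j assume j: "j \<in> elts n"
    have "ap t j \<in> elts (carrier A)"
      using maps_app[OF t j] by (simp add: app_eq_ap[OF maps_func[OF t]])
    then show "term_val Sg B k (app (lam n (\<lambda>j. var (ap v (ap t j)))) j) = ap ?h (ap t j)"
      using app_lam[OF var_tuple(1)[OF v t] j] val by simp
  qed simp
  from d show ?thesis
    unfolding is_fact_def
  proof (elim disjE bexE exE conjE)
    fix f t b assume f: "f \<in> elts (fun_syms Sg)" "b \<in> elts (carrier A)" "maps t (arity Sg f) (carrier A)"
      "d = pair zero (triple f t b)"
    show ?thesis
      unfolding f(4) fact_fm_simps sat_atomic_eq sat_fact_fun fst_of_pair snd_of_pair
        term_val_fapp[OF B f(1) var_tuple(2)[OF v f(3)]] tup[OF f(3)] val[OF f(2)] app_fun_int_ap[OF B(1) f(1)] ..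
  next
    fix r t assume r: "r \<in> elts (rel_syms Sg)" "maps t (arity Sg r) (carrier A)" "d = pair one (pair r t)"
    show ?thesis
      unfolding r(3) fact_fm_simps sat_atomic_rel sat_fact_rel fst_of_pair snd_of_pair
        tup[OF r(2)] rel_int_ap[OF B(1)] ..
  qed
qed

text \<open>The elements of \<open>B\<close> need not be sets of terms, so \<open>B\<close> is
  replaced by its term copy, which lies in \<open>K\<close> because it embeds into \<open>B\<close>.
  One copy serves for all numberings \<open>v\<close>.\<close>

lemma index_of_assignment:
  assumes B: "B \<in> K" and k: "maps k omega (carrier B)"
  obtains C k' where "is_structure Sg C" "maps k' omega (carrier C)"
    "\<And>a. is_atomic Sg a \<Longrightarrow> sat_atomic Sg C k' a \<longleftrightarrow> sat_atomic Sg B k a"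
    "\<And>v. maps v (carrier A) omega \<Longrightarrow> pair C (lam (carrier A) (\<lambda>x. app k' (app v x))) \<in> elts idx"
proof -
  obtain C j k' where C: "is_structure Sg C" "embedding j C B"
    "elts (carrier C) \<subseteq> {x. elts x \<subseteq> elts (terms Sg)}" and k': "maps k' omega (carrier C)"
    and sat: "\<And>a. is_atomic Sg a \<Longrightarrow> sat_atomic Sg C k' a \<longleftrightarrow> sat_atomic Sg B k a"
    using term_copy[OF K_structure[OF B] k] by blast
  have "C \<in> K"
    by (rule closed_under_embeddings[OF isos subs B K_structure[OF B] C(1,2)])
  then have "pair C (lam (carrier A) (\<lambda>x. app k' (app v x))) \<in> elts idx" if "maps v (carrier A) omega" for v
    unfolding elts_idx is_index_def using C(3) lam_comp(2)[OF k' that] by blast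
  then show thesis using that C(1) k' sat by blast
qed

text \<open>The unit of \<open>K\<close> makes the filter proper.\<close>

lemma ex_index_all_facts: "\<exists>i\<in>elts idx. \<forall>d. is_fact d \<longrightarrow> sat_fact i d"
proof -
  obtain U u where U: "U \<in> K" "is_unit Sg U" "elts (carrier U) = {u}"
    using has_unit unfolding is_unit_def by blast
  have set: "set_fun omega (\<lambda>_. u)" "set_fun (carrier A) (\<lambda>_. zero)" by (intro set_funI df)+
  have k: "maps (lam omega (\<lambda>_. u)) omega (carrier U)" by (rule maps_lam[OF set(1)]) (simp add: U(3))
  have v: "maps (lam (carrier A) (\<lambda>_. zero)) (carrier A) omega" by (rule maps_lam[OF set(2)]) simp
  \<comment> \<open>The unit itself need not occur in an index, but its term copy does.\<close>
  obtain C k' where C: "is_structure Sg C" "maps k' omega (carrier C)"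
    "\<And>a. is_atomic Sg a \<Longrightarrow> sat_atomic Sg C k' a \<longleftrightarrow> sat_atomic Sg U (lam omega (\<lambda>_. u)) a"
    "\<And>v. maps v (carrier A) omega \<Longrightarrow> pair C (lam (carrier A) (\<lambda>x. app k' (app v x))) \<in> elts idx"
    using index_of_assignment[OF U(1) k] by blast
  show ?thesis
    using C(4)[OF v] sat_fact_fm[OF C(1,2) v] C(3)[OF is_atomic_fact_fm[OF _ v]]
      unit_sat_atomic[OF U(2) k is_atomic_fact_fm[OF _ v]] by blast
qed

definition elem_of_fact :: "'v \<Rightarrow> 'v \<Rightarrow> bool" where
  "elem_of_fact d x \<longleftrightarrow>
    (\<exists>f t b. d = pair zero (triple f t b) \<and> (x = b \<or> (\<exists>k\<in>elts (arity Sg f). x = ap t k))) \<or>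
    (\<exists>r t. d = pair one (pair r t) \<and> (\<exists>k\<in>elts (arity Sg r). x = ap t k))"

lemma dfp_elem_of_fact: "dfp (\<lambda>e. elem_of_fact (e 0) (e 1))"
  unfolding elem_of_fact_def by (intro df)

lemma fin_elems:
  assumes "is_fact d"
  shows "\<exists>u. fin u \<and> (\<forall>x. elem_of_fact d x \<longrightarrow> x \<in> elts u)"
  using assms unfolding is_fact_def
proof (elim disjE bexE exE conjE)
  fix f t b assume f: "f \<in> elts (fun_syms Sg)" "maps t (arity Sg f) (carrier A)" "d = pair zero (triple f t b)"
  obtain u where "fin u" "\<forall>k\<in>elts (arity Sg f). app t k \<in> elts u"
    using fin_range[OF arity_omega(2)[OF f(1)] maps_fun_on[OF f(2)]] by blast
  then show ?thesis
    by (intro exI[of _ "adj b u"]) (auto simp: f(3) elem_of_fact_def app_eq_ap[OF maps_func[OF f(2)]])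
next
  fix r t assume r: "r \<in> elts (rel_syms Sg)" "maps t (arity Sg r) (carrier A)" "d = pair one (pair r t)"
  obtain u where "fin u" "\<forall>k\<in>elts (arity Sg r). app t k \<in> elts u"
    using fin_range[OF arity_omega(1)[OF r(1)] maps_fun_on[OF r(2)]] by blast
  then show ?thesis
    by (intro exI[of _ u]) (auto simp: r(3) elem_of_fact_def app_eq_ap[OF maps_func[OF r(2)]])
qed

text \<open>If \<open>h\<close> fixes the elements that occur in the fact, then the fact at
  \<open>pair A h\<close> is a statement about \<open>A\<close> alone. The pair need not be an
  index; it serves to compare a fact with its formula in \<open>A\<close>.\<close>

lemma sat_fact_fixed:
  assumes d: "is_fact d" and h: "maps h (carrier A) (carrier A)"
    and fixed: "\<And>x. elem_of_fact d x \<Longrightarrow> x \<in> elts (carrier A) \<Longrightarrow> app h x = x"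
  shows "sat_fact (pair A h) d \<longleftrightarrow> true_fact d"
proof -
  have tup: "lam n (\<lambda>k. ap h (ap t k)) = t"
    if t: "maps t n (carrier A)" and e: "\<And>k. k \<in> elts n \<Longrightarrow> elem_of_fact d (ap t k)" for t n
  proof -
    have "lam n (\<lambda>k. ap h (ap t k)) = lam n (app t)"
    proof (rule lam_cong)
      fix k assume k: "k \<in> elts n"
      show "ap h (ap t k) = app t k"
        using fixed[OF e[OF k]] maps_app[OF t k]
        by (simp add: app_eq_ap[OF maps_func[OF t]] app_eq_ap[OF maps_func[OF h]])
    qed simp
    then show ?thesis using lam_app[OF maps_fun_on[OF t]] by simp
  qed
  from d show ?thesis
    unfolding is_fact_def
  proof (elim disjE bexE exE conjE)
    fix f t b assume f: "f \<in> elts (fun_syms Sg)" "b \<in> elts (carrier A)" "maps t (arity Sg f) (carrier A)"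
      "d = pair zero (triple f t b)"
    have "lam (arity Sg f) (\<lambda>k. ap h (ap t k)) = t"
      by (rule tup[OF f(3)]) (auto simp: f(4) elem_of_fact_def)
    moreover have "ap h b = b"
      using fixed[of b] f(2) by (simp add: f(4) elem_of_fact_def app_eq_ap[OF maps_func[OF h]])
    ultimately show ?thesis
      using f(1,3) by (auto simp: f(4) true_fact_def)
  next
    fix r t assume r: "r \<in> elts (rel_syms Sg)" "maps t (arity Sg r) (carrier A)" "d = pair one (pair r t)"
    have "lam (arity Sg r) (\<lambda>k. ap h (ap t k)) = t"
      by (rule tup[OF r(2)]) (auto simp: r(3) elem_of_fact_def)
    then show ?thesis
      using r(1) by (auto simp: r(3) true_fact_def)
  qed
qed

definition realizable :: "'v \<Rightarrow> 'v \<Rightarrow> 'v \<Rightarrow> bool" where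
  "realizable D v c \<longleftrightarrow> (\<exists>C k. is_structure Sg C \<and> maps k omega (carrier C) \<and>
      \<not> sat_atomic Sg C k c \<and> pair C (lam (carrier A) (\<lambda>x. app k (app v x))) \<in> elts idx \<and>
      (\<forall>d\<in>elts D. sat_fact (pair C (lam (carrier A) (\<lambda>x. app k (app v x)))) d))"

text \<open>
  The finitely many facts in \<open>D\<close> together with the negation of an atomic formula that is false in
  \<open>A\<close> are realized in \<open>K\<close>, since the corresponding quasi-identity fails in \<open>A\<close>.
\<close>

lemma separation_index:
  assumes D: "fin D" "\<And>d. d \<in> elts D \<Longrightarrow> true_fact d" and S: "fin S"
  obtains k v where "maps k omega (carrier A)" "maps v (carrier A) omega"
    "\<And>x. x \<in> elts S \<Longrightarrow> x \<in> elts (carrier A) \<Longrightarrow> app k (app v x) = x"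
    "\<And>c. is_atomic Sg c \<Longrightarrow> \<not> sat_atomic Sg A k c \<Longrightarrow> realizable D v c"
proof -
  have facts: "is_fact d" if "d \<in> elts D" for d using that D(2) is_fact_true by blast
  \<comment> \<open>\<open>T\<close> covers the elements in the facts of \<open>D\<close>, while
    \<open>S\<close> is meant for those of the statement to be refuted. On both, \<open>k\<close>
    after \<open>v\<close> must be the identity, so that the formulas say in \<open>A\<close> what
    the facts say.\<close>
  obtain T where T: "fin T" "\<And>d x. d \<in> elts D \<Longrightarrow> elem_of_fact d x \<Longrightarrow> x \<in> elts T"
    using fin_UN[OF D(1) dfp_elem_of_fact fin_elems[OF facts]] by blast
  obtain k v where k: "maps k omega (carrier A)" and v: "maps v (carrier A) omega"
    and kv: "\<And>x. x \<in> elts (mk (elts S \<union> elts T)) \<Longrightarrow> x \<in> elts (carrier A) \<Longrightarrow> app k (app v x) = x"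
    using fin_cover[OF fin_Un[OF S T(1)] elts_carrier_nonempty[OF A_structure]] by blast
  have kv': "app k (app v x) = x" if "x \<in> elts S \<union> elts T" "x \<in> elts (carrier A)" for x
    using kv[of x] that by (simp add: elts_mk)
  let ?kv = "lam (carrier A) (\<lambda>x. app k (app v x))"
  note m = lam_comp[OF k v]
  have D_true: "sat_atomic Sg A k (fact_fm v d)" if d: "d \<in> elts D" for d
  proof -
    have "sat_fact (pair A ?kv) d \<longleftrightarrow> true_fact d"
    proof (rule sat_fact_fixed[OF facts[OF d] m(2)])
      fix x assume "elem_of_fact d x" "x \<in> elts (carrier A)"
      then show "app ?kv x = x" using T(2)[OF d] kv'[of x] by (simp add: app_lam[OF m(1)])
    qed
    then show ?thesis using sat_fact_fm[OF A_structure k v facts[OF d]] D(2)[OF d] by simp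
  qed
  obtain n e where n: "n \<in> elts omega" "fun_on e n" "elts D = app e ` elts n"
    using fin_enum[OF D(1)] by blast
  show thesis
  proof (rule that[OF k v])
    show "app k (app v x) = x" if "x \<in> elts S" "x \<in> elts (carrier A)" for x
      using kv' that by blast
    fix c assume c: "is_atomic Sg c" "\<not> sat_atomic Sg A k c"
    \<comment> \<open>The premises occupy the positions below \<open>n\<close> and the conclusion
      \<open>c\<close> the position \<open>n\<close>. So the disjunction is nonempty even if
      \<open>D\<close> is.\<close>
    let ?l = "\<lambda>j. if j \<in> elts n then neg_lit (fact_fm v (app e j)) else pos_lit c"
    define \<phi> where "\<phi> = lam (succ n) ?l"
    have set: "set_fun (succ n) ?l" by (intro set_funI df dft_app fun_on_func[OF n(2)])
    have fun_\<phi>: "fun_on \<phi> (succ n)" unfolding \<phi>_def by (rule fun_on_lam[OF set])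
    have app_\<phi>: "app \<phi> j = ?l j" if "j \<in> elts (succ n)" for j
      unfolding \<phi>_def by (rule app_lam[OF set that])
    have atom: "is_atomic Sg (fact_fm v (app e j))" if "j \<in> elts n" for j
      using is_atomic_fact_fm[OF facts v] n(3) that by blast
    have "quasi_identity Sg \<phi>"
      unfolding quasi_identity_def basic_horn_def
    proof (intro conjI bexI[OF _ n(1)] fun_\<phi> ballI impI)
      show "is_pos_lit Sg (app \<phi> j) \<or> is_neg_lit Sg (app \<phi> j)" if "j \<in> elts (succ n)" for j
        using app_\<phi>[OF that] atom c(1) unfolding is_pos_lit_def is_neg_lit_def by auto
      have "j = n" if j: "j \<in> elts (succ n)" "is_pos_lit Sg (app \<phi> j)" for j
      proof (rule ccontr)
        assume "j \<noteq> n"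
        then show False using j unfolding app_\<phi>[OF j(1)] is_pos_lit_def by auto
      qed
      then show "i = j" if "i \<in> elts (succ n)" "j \<in> elts (succ n)"
        "is_pos_lit Sg (app \<phi> i) \<and> is_pos_lit Sg (app \<phi> j)" for i j
        using that by blast
      show "\<exists>k l. pair k l \<in> elts \<phi> \<and> is_pos_lit Sg l"
        by (intro exI[of _ n] exI[of _ "pos_lit c"])
          (use app_\<phi>[of n] c(1) in \<open>auto simp: pair_mem_fun[OF fun_\<phi>] is_pos_lit_def\<close>)
    qed
    moreover have "\<not> models Sg A \<phi>"
    proof
      assume "models Sg A \<phi>"
      then obtain j l where jl: "pair j l \<in> elts \<phi>" "sat_lit Sg A k l"
        using k unfolding models_def by blast
      then show False
        using app_\<phi>[of j] c(2) D_true n(3) unfolding pair_mem_fun[OF fun_\<phi>] by (auto split: if_splits)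
    qed
    \<comment> \<open>\<open>A\<close> satisfies all quasi-identities valid in \<open>K\<close>, so
      the one that fails in \<open>A\<close> also fails in some member: there, all premises are true
      and \<open>c\<close> is false.\<close>
    ultimately obtain B where B: "B \<in> K" "\<not> models Sg B \<phi>" using A_models by blast
    then obtain k0 where k0: "maps k0 omega (carrier B)"
      and false: "\<And>j l. pair j l \<in> elts \<phi> \<Longrightarrow> \<not> sat_lit Sg B k0 l"
      unfolding models_def by blast
    have not_c: "\<not> sat_atomic Sg B k0 c"
      using false[of n "pos_lit c"] app_\<phi>[of n] by (simp add: pair_mem_fun[OF fun_\<phi>])
    have D_B: "sat_atomic Sg B k0 (fact_fm v (app e j))" if "j \<in> elts n" for j
      using false[of j "neg_lit (fact_fm v (app e j))"] app_\<phi>[of j] that by (simp add: pair_mem_fun[OF fun_\<phi>])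
    obtain C k' where C: "is_structure Sg C" "maps k' omega (carrier C)"
      "\<And>a. is_atomic Sg a \<Longrightarrow> sat_atomic Sg C k' a \<longleftrightarrow> sat_atomic Sg B k0 a"
      "\<And>v. maps v (carrier A) omega \<Longrightarrow> pair C (lam (carrier A) (\<lambda>x. app k' (app v x))) \<in> elts idx"
      using index_of_assignment[OF B(1) k0] by blast
    have "sat_fact (pair C (lam (carrier A) (\<lambda>x. app k' (app v x)))) d" if d: "d \<in> elts D" for d
    proof -
      obtain j where "j \<in> elts n" "d = app e j" using d n(3) by blast
      then show ?thesis using sat_fact_fm[OF C(1,2) v facts[OF d]] C(3)[OF atom] D_B by blast
    qed
    then show "realizable D v c"
      unfolding realizable_def using C(1,2) C(3)[OF c(1)] C(4)[OF v] not_c by blast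
  qed
qed

section \<open>The filter of facts and the embedding of \<open>A\<close>\<close>

definition flt :: 'v where
  "flt = mk {X. elts X \<subseteq> elts idx \<and> (\<exists>D. fin D \<and> (\<forall>d\<in>elts D. true_fact d) \<and>
     (\<forall>i\<in>elts idx. (\<forall>d\<in>elts D. sat_fact i d) \<longrightarrow> i \<in> elts X))}"

lemma elts_flt: "X \<in> elts flt \<longleftrightarrow> elts X \<subseteq> elts idx \<and> (\<exists>D. fin D \<and> (\<forall>d\<in>elts D. true_fact d) \<and>
     (\<forall>i\<in>elts idx. (\<forall>d\<in>elts D. sat_fact i d) \<longrightarrow> i \<in> elts X))"
proof -
  have "small {X. elts X \<subseteq> elts idx \<and> (\<exists>D. fin D \<and> (\<forall>d\<in>elts D. true_fact d) \<and>
     (\<forall>i\<in>elts idx. (\<forall>d\<in>elts D. sat_fact i d) \<longrightarrow> i \<in> elts X))}"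
    by (rule small_Collect[OF small_Pow[OF small_elts[of idx]]]) (intro df, blast)
  then show ?thesis unfolding flt_def by (simp add: elts_mk)
qed

lemma proper_filter_flt: "proper_filter idx flt"
  unfolding proper_filter_def
proof (intro conjI ballI allI impI)
  show "elts X \<subseteq> elts idx" if "X \<in> elts flt" for X using that elts_flt by blast
  show "idx \<in> elts flt" unfolding elts_flt by (intro conjI exI[of _ zero]) auto
  show "zero \<notin> elts flt"
    unfolding elts_flt using ex_index_all_facts is_fact_true by fastforce
  show "Y \<in> elts flt" if X: "X \<in> elts flt" and XY: "elts X \<subseteq> elts Y \<and> elts Y \<subseteq> elts idx" for X Y
    using X XY unfolding elts_flt by blast
  fix X Y assume "X \<in> elts flt" "Y \<in> elts flt"
  then obtain D E where D: "fin D" "\<forall>d\<in>elts D. true_fact d"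
      "\<forall>i\<in>elts idx. (\<forall>d\<in>elts D. sat_fact i d) \<longrightarrow> i \<in> elts X"
    and E: "fin E" "\<forall>d\<in>elts E. true_fact d"
      "\<forall>i\<in>elts idx. (\<forall>d\<in>elts E. sat_fact i d) \<longrightarrow> i \<in> elts Y"
    and sub: "elts X \<subseteq> elts idx"
    unfolding elts_flt by blast
  have XY: "elts (mk (elts X \<inter> elts Y)) = elts X \<inter> elts Y"
    unfolding Int_def by (intro elts_mk small_sep df)
  have DE: "elts (mk (elts D \<union> elts E)) = elts D \<union> elts E" by (simp add: elts_mk)
  show "mk (elts X \<inter> elts Y) \<in> elts flt"
    unfolding elts_flt XY
    by (intro conjI exI[of _ "mk (elts D \<union> elts E)"] fin_Un D(1) E(1)) (use sub D E in \<open>auto simp: DE\<close>)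
qed

lemma hat_product: "a \<in> elts (carrier A) \<Longrightarrow> hat a \<in> elts (product idx fam)"
  unfolding elts_product[OF fun_on_fam]
  using fun_on_lam[OF set_hat] hat_closed by (auto simp: hat_def app_lam[OF set_hat] fam_app)

interpretation fam: filtered_family mem Sg idx fam flt
proof
  show "elts (product idx fam) \<noteq> {}"
    using elts_carrier_nonempty[OF A_structure] hat_product by blast
  show "is_structure Sg (app fam i)" if "i \<in> elts idx" for i
    using K_structure[OF fam_K[OF that]] .
qed (rule proper_filter_flt, rule fun_on_fam)

lemma large_iff:
  assumes "small {i \<in> elts idx. P i}"
  shows "fam.large P \<longleftrightarrow> (\<exists>D. fin D \<and> (\<forall>d\<in>elts D. true_fact d) \<and>
     (\<forall>i\<in>elts idx. (\<forall>d\<in>elts D. sat_fact i d) \<longrightarrow> P i))"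
  unfolding fam.large_def elts_flt elts_mk[OF assms] by blast

lemma large_fact:
  assumes "small {i \<in> elts idx. P i}" "true_fact d" "\<And>i. i \<in> elts idx \<Longrightarrow> sat_fact i d \<Longrightarrow> P i"
  shows "fam.large P"
  unfolding large_iff[OF assms(1)]
  by (intro exI[of _ "adj d zero"]) (use assms(2,3) in auto)

lemma hat_tuple:
  assumes "maps t n (carrier A)"
  shows "set_fun n (\<lambda>k. hat (app t k))"
    and "maps (lam n (\<lambda>k. hat (app t k))) n (product idx fam)"
    and "i \<in> elts idx \<Longrightarrow> coords n (lam n (\<lambda>k. hat (app t k))) i = lam n (\<lambda>k. ap (snd_of i) (ap t k))"
proof -
  show s: "set_fun n (\<lambda>k. hat (app t k))"
    by (intro set_funI df dft_app maps_func[OF assms])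
  show "maps (lam n (\<lambda>k. hat (app t k))) n (product idx fam)"
    by (rule maps_lam[OF s]) (intro hat_product maps_app[OF assms])
  show "coords n (lam n (\<lambda>k. hat (app t k))) i = lam n (\<lambda>k. ap (snd_of i) (ap t k))" if "i \<in> elts idx"
    unfolding coords_def
    by (rule lam_cong) (simp_all add: app_lam[OF s] hat_app[OF that] flip: app_eq_ap[OF maps_func[OF assms]])
qed

definition emb :: 'v where
  "emb = lam (carrier A) (\<lambda>a. fam.cls' (hat a))"

lemma set_emb: "set_fun (carrier A) (\<lambda>a. fam.cls' (hat a))"
  by (intro set_funI df fam.dft_cls')

lemma emb_app: "a \<in> elts (carrier A) \<Longrightarrow> app emb a = mod_class idx fam flt (hat a)"
  unfolding emb_def by (simp add: app_lam[OF set_emb] fam.cls_eq[OF hat_product])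

lemma emb_tuple:
  assumes "maps t n (carrier A)"
  shows "lam n (\<lambda>k. app emb (app t k)) = mod_classes idx fam flt n (lam n (\<lambda>k. hat (app t k)))"
  unfolding mod_classes_def
  by (rule lam_cong) (simp_all add: app_lam[OF hat_tuple(1)[OF assms]] emb_app maps_app[OF assms])

lemma embedding_emb: "embedding emb A (reduced_product Sg idx fam flt)"
  unfolding embedding_def fun_hom_def
proof (intro conjI ballI allI impI)
  show "maps emb (carrier A) (carrier (reduced_product Sg idx fam flt))"
    unfolding emb_def
    by (rule maps_lam[OF set_emb])
      (auto simp: fam.elts_red_carrier fam.cls_eq[OF hat_product, symmetric] intro: hat_product)
next
  fix f t assume f: "f \<in> elts (fun_syms Sg)" and t: "maps t (arity Sg f) (carrier A)"
  let ?b = "app (fun_int A f) t" and ?s = "lam (arity Sg f) (\<lambda>k. hat (app t k))"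
  note b = fun_int_closed[OF A_structure f t] and s = hat_tuple(2)[OF t]
  note P = hat_product[OF b] fam.pointwise_Prod[OF f s]
  \<comment> \<open>The two product elements to be compared agree at every index at which the fact
    \<open>f(t) = b\<close> is preserved, with \<open>b\<close> the value of \<open>f\<close> in
    \<open>A\<close>.\<close>
  have "true_fact (pair zero (triple f t ?b))"
    unfolding true_fact_def using f t by (auto simp: app_fun_int_ap[OF A_structure f])
  then have "fam.large (\<lambda>i. app (hat ?b) i = app (fam.pointwise f ?s) i)"
  proof (rule large_fact[OF fam.small_agree[OF P]])
    fix i assume i: "i \<in> elts idx" and "sat_fact i (pair zero (triple f t ?b))"
    then have "ap (ap (snd_of (snd_of (fst_of i))) f) (coords (arity Sg f) ?s i) = ap (snd_of i) ?b"
      by (simp add: hat_tuple(3)[OF t i])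
    then show "app (hat ?b) i = app (fam.pointwise f ?s) i"
      using app_fun_int_ap[OF K_structure[OF fam_K[OF i]] f] fam_app[OF i]
      by (simp add: fam.pointwise_app[OF f s i] hat_app[OF i])
  qed
  then have "mod_class idx fam flt (hat ?b) = mod_class idx fam flt (fam.pointwise f ?s)"
    by (simp add: fam.cls_eq_iff[OF P] fam.eq_mod_iff)
  then show "app emb ?b = app (fun_int (reduced_product Sg idx fam flt) f)
      (lam (arity Sg f) (\<lambda>k. app emb (app t k)))"
    by (simp add: emb_app[OF b] emb_tuple[OF t] fam.fun_int_RP[OF f] fam.red_fun_app[OF f s])
next
  show "inj_on (app emb) (elts (carrier A))"
  proof (rule inj_onI, rule ccontr)
    fix a b assume ab: "a \<in> elts (carrier A)" "b \<in> elts (carrier A)" "app emb a = app emb b" "a \<noteq> b"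
    have "fam.large (\<lambda>i. app (hat a) i = app (hat b) i)"
      using ab(3) emb_app[OF ab(1)] emb_app[OF ab(2)] fam.cls_eq_iff[OF hat_product[OF ab(1)] hat_product[OF ab(2)]]
      by (simp add: fam.eq_mod_iff)
    \<comment> \<open>The facts in \<open>D\<close> would force \<open>h(a) = h(b)\<close> at all
      indices that satisfy them. This is refuted by an index obtained from the false equation
      between the variables that name \<open>a\<close> and \<open>b\<close>.\<close>
    then obtain D where D: "fin D" "\<And>d. d \<in> elts D \<Longrightarrow> true_fact d"
      "\<And>i. i \<in> elts idx \<Longrightarrow> \<forall>d\<in>elts D. sat_fact i d \<Longrightarrow> app (hat a) i = app (hat b) i"
      unfolding large_iff[OF fam.small_agree[OF hat_product[OF ab(1)] hat_product[OF ab(2)]]] by blast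
    have "fin (adj a (adj b zero))" by simp
    then obtain k v where k: "maps k omega (carrier A)" and v: "maps v (carrier A) omega"
      and kv: "\<And>x. x \<in> elts (adj a (adj b zero)) \<Longrightarrow> x \<in> elts (carrier A) \<Longrightarrow> app k (app v x) = x"
      and sep: "\<And>c. is_atomic Sg c \<Longrightarrow> \<not> sat_atomic Sg A k c \<Longrightarrow> realizable D v c"
      using separation_index[OF D(1,2)] by blast
    note va = maps_app[OF v ab(1)] and vb = maps_app[OF v ab(2)]
    let ?c = "eq_fm (var (app v a)) (var (app v b))"
    have "is_atomic Sg ?c" unfolding is_atomic_def using terms_var[OF va] terms_var[OF vb] by blast
    moreover have "\<not> sat_atomic Sg A k ?c"
      using ab kv[of a] kv[of b] by (simp add: term_val_var[OF A_structure k] va vb)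
    ultimately obtain C k' where C: "is_structure Sg C" "maps k' omega (carrier C)" "\<not> sat_atomic Sg C k' ?c"
      "pair C (lam (carrier A) (\<lambda>x. app k' (app v x))) \<in> elts idx"
      "\<forall>d\<in>elts D. sat_fact (pair C (lam (carrier A) (\<lambda>x. app k' (app v x)))) d"
      using sep unfolding realizable_def by blast
    have "app (lam (carrier A) (\<lambda>x. app k' (app v x))) a = app (lam (carrier A) (\<lambda>x. app k' (app v x))) b"
      using D(3)[OF C(4,5)] unfolding hat_app[OF C(4)] snd_of_pair
      by (simp only: app_eq_ap[OF maps_func[OF lam_comp(2)[OF C(2) v]]])
    then show False
      using C(3) ab(1,2) by (simp add: app_lam[OF lam_comp(1)[OF C(2) v]] term_val_var[OF C(1,2)] va vb)
  qed
next
  fix r t assume r: "r \<in> elts (rel_syms Sg)" and t: "maps t (arity Sg r) (carrier A)"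
  let ?s = "lam (arity Sg r) (\<lambda>k. hat (app t k))" and ?d = "pair one (pair r t)"
  note s = hat_tuple(2)[OF t]
  have sat: "coords (arity Sg r) ?s i \<in> elts (rel_int (app fam i) r) \<longleftrightarrow> sat_fact i ?d"
    if "i \<in> elts idx" for i
    using rel_int_ap[OF K_structure[OF fam_K[OF that]], of r]
    by (simp add: hat_tuple(3)[OF t that] fam_app[OF that])
  have iff: "lam (arity Sg r) (\<lambda>k. app emb (app t k)) \<in> elts (rel_int (reduced_product Sg idx fam flt) r)
      \<longleftrightarrow> fam.large (\<lambda>i. coords (arity Sg r) ?s i \<in> elts (rel_int (app fam i) r))"
    unfolding emb_tuple[OF t] by (rule fam.rel_RP[OF r s])
  note sm = fam.small_coords_rel[OF r s]
  have fact: "is_fact ?d" unfolding is_fact_def using r t by blast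
  show "t \<in> elts (rel_int A r) \<longleftrightarrow>
      lam (arity Sg r) (\<lambda>k. app emb (app t k)) \<in> elts (rel_int (reduced_product Sg idx fam flt) r)"
    unfolding iff
  proof
    assume "t \<in> elts (rel_int A r)"
    then have "true_fact ?d"
      unfolding true_fact_def using r rel_int_ap[OF A_structure] by auto
    then show "fam.large (\<lambda>i. coords (arity Sg r) ?s i \<in> elts (rel_int (app fam i) r))"
      by (rule large_fact[OF sm]) (simp add: sat)
  next
    assume "fam.large (\<lambda>i. coords (arity Sg r) ?s i \<in> elts (rel_int (app fam i) r))"
    \<comment> \<open>The facts in \<open>D\<close> would force the fact \<open>?d\<close> at all
      indices that satisfy them. If it were false in \<open>A\<close>, separation would yield an
      index with \<open>D\<close> and without \<open>?d\<close>.\<close>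
    then obtain D where D: "fin D" "\<And>d. d \<in> elts D \<Longrightarrow> true_fact d"
      "\<And>i. i \<in> elts idx \<Longrightarrow> \<forall>d\<in>elts D. sat_fact i d \<Longrightarrow> sat_fact i ?d"
      unfolding large_iff[OF sm] using sat by blast
    show "t \<in> elts (rel_int A r)"
    proof (rule ccontr)
      assume "t \<notin> elts (rel_int A r)"
      then have not_true: "\<not> true_fact ?d"
        unfolding true_fact_def by (auto simp: rel_int_ap[OF A_structure])
      \<comment> \<open>These elements must be named faithfully for the formula of \<open>?d\<close>
        to be false in \<open>A\<close> as well.\<close>
      obtain u where u: "fin u" "\<And>x. elem_of_fact ?d x \<Longrightarrow> x \<in> elts u"
        using fin_elems[OF fact] by blast
      obtain k v where k: "maps k omega (carrier A)" and v: "maps v (carrier A) omega"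
        and kv: "\<And>x. x \<in> elts u \<Longrightarrow> x \<in> elts (carrier A) \<Longrightarrow> app k (app v x) = x"
        and sep: "\<And>c. is_atomic Sg c \<Longrightarrow> \<not> sat_atomic Sg A k c \<Longrightarrow> realizable D v c"
        using separation_index[OF D(1,2) u(1)] by blast
      note m = lam_comp[OF k v]
      have "sat_fact (pair A (lam (carrier A) (\<lambda>x. app k (app v x)))) ?d \<longleftrightarrow> true_fact ?d"
      proof (rule sat_fact_fixed[OF fact m(2)])
        fix x assume "elem_of_fact ?d x" "x \<in> elts (carrier A)"
        then show "app (lam (carrier A) (\<lambda>x. app k (app v x))) x = x"
          using u(2)[of x] kv[of x] by (simp add: app_lam[OF m(1)])
      qed
      then have "\<not> sat_atomic Sg A k (fact_fm v ?d)"
        using not_true sat_fact_fm[OF A_structure k v fact] by blast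
      then obtain C k' where C: "is_structure Sg C" "maps k' omega (carrier C)"
        "\<not> sat_atomic Sg C k' (fact_fm v ?d)"
        "pair C (lam (carrier A) (\<lambda>x. app k' (app v x))) \<in> elts idx"
        "\<forall>d\<in>elts D. sat_fact (pair C (lam (carrier A) (\<lambda>x. app k' (app v x)))) d"
        using sep[OF is_atomic_fact_fm[OF fact v]] unfolding realizable_def by blast
      show False
        using C(3) D(3)[OF C(4,5)] sat_fact_fm[OF C(1,2) v fact] by blast
    qed
  qed
qed

lemma A_in_K: "A \<in> K"
proof -
  have "reduced_product Sg idx fam flt \<in> K"
    using reds proper_filter_flt fun_on_fam fam_K fam.product_nonempty
    unfolding closed_under_reduced_products_def by blast
  then show ?thesis
    by (rule closed_under_embeddings[OF isos subs _ fam.is_structure_RP A_structure embedding_emb])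
qed

end

section \<open>The two directions\<close>

context signature
begin

lemma closed_class_is_quasivariety:
  assumes K: "definable_class K" "\<And>A. A \<in> K \<Longrightarrow> is_structure Sg A"
    and closed: "\<exists>U \<in> K. is_unit Sg U" "closed_under_isomorphisms Sg K"
      "closed_under_substructures Sg K" "closed_under_reduced_products Sg K"
  shows "is_quasivariety Sg K"
  unfolding is_quasivariety_def
proof (intro exI[of _ "theory_of K"] conjI)
  note th = elts_theory_of[OF K]
  show "\<forall>\<phi>\<in>elts (theory_of K). quasi_identity Sg \<phi>" by (simp add: th)
  show "K = {A. is_structure Sg A \<and> (\<forall>\<phi>\<in>elts (theory_of K). models Sg A \<phi>)}"
  proof (intro set_eqI iffI)
    fix A assume "A \<in> {A. is_structure Sg A \<and> (\<forall>\<phi>\<in>elts (theory_of K). models Sg A \<phi>)}"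
    then interpret closed_class mem Sg K A
      by unfold_locales (use K closed th in auto)
    show "A \<in> K" by (rule A_in_K)
  qed (use K(2) th in auto)
qed

lemma quasivariety_closed:
  assumes "is_quasivariety Sg K"
  shows "\<exists>U \<in> K. is_unit Sg U" "closed_under_isomorphisms Sg K"
    "closed_under_substructures Sg K" "closed_under_reduced_products Sg K"
proof -
  obtain \<Gamma> where \<Gamma>: "\<And>\<phi>. \<phi> \<in> elts \<Gamma> \<Longrightarrow> quasi_identity Sg \<phi>"
    and K: "\<And>A. A \<in> K \<longleftrightarrow> is_structure Sg A \<and> (\<forall>\<phi>\<in>elts \<Gamma>. models Sg A \<phi>)"
    using assms unfolding is_quasivariety_def by blast
  obtain U where "is_unit Sg U" using ex_unit by blast
  then show "\<exists>U \<in> K. is_unit Sg U"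
    using K unit_models \<Gamma> unfolding is_unit_def by blast
  \<comment> \<open>Isomorphic copies and substructures of members both embed into members, so one
    preservation result yields both closure conditions.\<close>
  have emb: "A \<in> K" if "embedding g A B" "is_structure Sg A" "B \<in> K" for g A B
    using that models_embedding \<Gamma> unfolding K by blast
  show "closed_under_isomorphisms Sg K"
    unfolding closed_under_isomorphisms_def
  proof (intro ballI allI impI)
    fix A B assume A: "A \<in> K" and B: "is_structure Sg B \<and> (\<exists>g. is_isomorphism Sg g A B)"
    have "is_structure Sg A" using A by (simp add: K)
    then obtain g where "is_isomorphism Sg g B A" using isomorphism_sym B by blast
    then show "B \<in> K" using emb A B unfolding isomorphism_iff by blast
  qed
  show "closed_under_substructures Sg K"
    unfolding closed_under_substructures_def
  proof (intro ballI allI impI)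
    fix A B assume A: "A \<in> K" and B: "is_substructure Sg B A"
    then have "is_structure Sg B" "is_structure Sg A" "elts (carrier B) \<subseteq> elts (carrier A)"
      by (auto simp: is_substructure_def)
    then show "B \<in> K" using emb A B embedding_id_iff by blast
  qed
  show "closed_under_reduced_products Sg K"
    unfolding closed_under_reduced_products_def
  proof (intro allI impI)
    fix I A F
    assume "proper_filter I F \<and> fun_on A I \<and> (\<forall>i\<in>elts I. app A i \<in> K) \<and> elts (product I A) \<noteq> {}"
    then interpret filtered_family mem Sg I A F
      by unfold_locales (auto simp: K)
    show "reduced_product Sg I A F \<in> K"
      using is_structure_RP reduced_product_models \<Gamma> \<open>_ \<and> _\<close> unfolding K by blast
  qed
qed

end

theorem corollary3p3:
  fixes mem :: "'v \<Rightarrow> 'v \<Rightarrow> bool" and Sg :: 'v and K :: "'v set"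
  assumes "ZF mem"
    and "membership.is_signature mem Sg"
    and "membership.definable_class mem K"
    and "\<And>A. A \<in> K \<Longrightarrow> membership.is_structure mem Sg A"
  shows "membership.is_quasivariety mem Sg K \<longleftrightarrow>
      (\<exists>U \<in> K. membership.is_unit mem Sg U) \<and>
      membership.closed_under_isomorphisms mem Sg K \<and>
      membership.closed_under_substructures mem Sg K \<and>
      membership.closed_under_reduced_products mem Sg K"
proof -
  interpret signature mem Sg
    using assms(1,2) by (simp add: signature_def signature_axioms_def)
  show ?thesis
    using quasivariety_closed[of K] closed_class_is_quasivariety[OF assms(3,4)] by blast
qed

end
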